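(* Let $\mathcal{H}$ be a Hilbert space. The following statements hold: 1. If $L\in B(B(\mathcal{H}))$ is such that $(e^{tL})_{t\geqslant 0}$ is a smoothly decomposable, decomposable dynamical semigroup on $B(\mathcal{H})$, then $L$ admits the structure $$L(A) = i[H,A] + \sum_{n=1}^{\infty} \left( V_{n}^{*} A V_n + W_{n}^{*} A^{\tau} W_n - \frac{1}{2}\left\{V_{n}^{*} V_n + W_{n}^{*} W_n,\,A\right\} \right),\qquad A\in B(\mathcal{H}),\qquad (\ast)$$ for some $H=H^* \in B(\mathcal{H})$ and two families $(V_n)_{n\in\mathbb{N}}, (W_n)_{n\in\mathbb{N}} \subset B(\mathcal{H})$ such that $\sum_{n=1}^{\infty} V_{n}^{*} V_n$ and $\sum_{n=1}^{\infty} W_{n}^{*} W_n$ weakly-* converge in $B(\mathcal{H})$. 2. Conversely, if $L$ is of the form $(\ast)$ with $H=H^*\in B(\mathcal{H})$ and families $(V_n)_{n\in\mathbb{N}},(W_n)_{n\in\mathbb{N}}\subset B(\mathcal{H})$ such that $\sum_{n=1}^{\infty} V_{n}^{*} V_n$ and $\sum_{n=1}^{\infty} W_{n}^{*} W_n$ weakly-* converge in $B(\mathcal{H})$, then $(e^{tL})_{t\geqslant 0}$ is a decomposable dynamical semigroup on $B(\mathcal{H})$.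
   Context: $[A,B]=AB-BA$, $\{A,B\}=AB+BA$. The transposition on $B(\mathcal{H})$ is $A^\tau = JA^*J$, where $J:\mathcal{H}\to\mathcal{H}$ is the antilinear, idempotent isometry of complex conjugation of vectors with respect to a fixed orthonormal basis of $\mathcal{H}$. The series in $(\ast)$ is understood in the weak-* topology of $B(\mathcal{H})$. Write $\mathscr{A}=B(\mathcal{H})$ and let $B(\mathscr{A})$ be the Banach space of bounded linear maps on $\mathscr{A}$. $T\in B(\mathscr{A})$ is completely positive, $T\in\mathsf{CP}(\mathscr{A})$, if for all $n\in\mathbb{N}$ the map $[a_{ij}]\mapsto[T(a_{ij})]$ on the algebra $M_n(\mathscr{A})$ of $n\times n$ matrices over $\mathscr{A}$ is positive. $T$ is completely copositive, $T\in\mathsf{coCP}(\mathscr{A})$, if for all $n\in\mathbb{N}$ the map $[a_{ij}]\mapsto[T(a_{ji})]$ on $M_n(\mathscr{A})$ is positive. $T$ is decomposable if it is the sum of a map in $\mathsf{CP}(\mathscr{A})$ and a map in $\mathsf{coCP}(\mathscr{A})$. A decomposable dynamical semigroup on $\mathscr{A}$ is a uniformly continuous semigroup $(e^{tL})_{t\geqslant0}$ of decomposable, unital, weakly-* continuous maps on $\mathscr{A}$. The semigroup $(e^{tL})_{t\geqslant0}$ is smoothly decomposable if there are functions $t\mapsto\phi_t\in\mathsf{CP}(\mathscr{A})$ and $t\mapsto\chi_t\in\mathsf{coCP}(\mathscr{A})$, smooth on $[0,\infty)$ with respect to the norm of $B(\mathscr{A})$ (one-sided derivatives at $0$), such that $e^{tL}=\phi_t+\chi_t$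 for all $t\geqslant 0$.
   Formalization: Part 1 is stated for separable Hilbert spaces only: for every nonseparable one it fails with families indexed by the natural numbers (take L = diagonal part minus identity). Part 2 is for arbitrary Hilbert spaces. *)

theory Defs
  imports "HOL-Analysis.Analysis"
begin

section \<open>Complex normed spaces and complex Hilbert spaces\<close>

class complex_normed_vector = real_normed_vector +
  fixes scaleC :: "complex \<Rightarrow> 'a \<Rightarrow> 'a"  (infixr "*\<^sub>C" 75)
  assumes scaleC_add_right: "c *\<^sub>C (x + y) = c *\<^sub>C x + c *\<^sub>C y"
    and scaleC_add_left: "(c + d) *\<^sub>C x = c *\<^sub>C x + d *\<^sub>C x"
    and scaleC_scaleC: "c *\<^sub>C d *\<^sub>C x = (c * d) *\<^sub>C x"
    and scaleR_scaleC: "r *\<^sub>R x = complex_of_real r *\<^sub>C x"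
    and norm_scaleC: "norm (c *\<^sub>C x) = cmod c * norm x"

global_interpretation complex_vector: vector_space "scaleC :: complex \<Rightarrow> 'a \<Rightarrow> 'a::complex_normed_vector"
  by standard
    (simp_all add: scaleC_add_right scaleC_add_left scaleC_scaleC
      scaleR_scaleC[of 1, simplified, symmetric])

lemma scaleR_scaleC_commute: "r *\<^sub>R c *\<^sub>C x = c *\<^sub>C r *\<^sub>R (x :: 'a::complex_normed_vector)"
  by (simp only: scaleR_scaleC scaleC_scaleC mult.commute)

lemma bounded_linear_scaleC_right: "bounded_linear (\<lambda>x :: 'a::complex_normed_vector. c *\<^sub>C x)"
  by (rule bounded_linear_intro[where K = "cmod c"])
    (simp_all add: scaleC_add_right scaleR_scaleC_commute norm_scaleC mult.commute)

text \<open>The inner product is linear in the second argument.\<close>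

class chilbert_space = complex_normed_vector + banach +
  fixes cinner :: "'a \<Rightarrow> 'a \<Rightarrow> complex"
  assumes cinner_commute: "cinner x y = cnj (cinner y x)"
    and cinner_add_right: "cinner x (y + z) = cinner x y + cinner x z"
    and cinner_scaleC_right: "cinner x (c *\<^sub>C y) = c * cinner x y"
    and cinner_norm: "cinner x x = complex_of_real ((norm x)\<^sup>2)"


section \<open>Bounded complex-linear operators\<close>

definition bounded_clinear :: "('a::complex_normed_vector \<Rightarrow> 'b::complex_normed_vector) \<Rightarrow> bool"
  where "bounded_clinear f \<longleftrightarrow> bounded_linear f \<and> (\<forall>c x. f (c *\<^sub>C x) = c *\<^sub>C f x)"

text \<open>
  \<open>'a bop\<close> is the Banach algebra of bounded complex-linear operators on \<open>'a\<close>. As it is itself a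
  complex normed space, the construction iterates: for a Hilbert space \<open>'h\<close>, \<open>'h bop\<close> is
  \<open>B(H)\<close> and \<open>'h bop bop\<close> is \<open>B(B(H))\<close>.
\<close>

typedef (overloaded) 'a bop = "{f :: 'a::complex_normed_vector \<Rightarrow> 'a. bounded_clinear f}"
  morphisms bop_apply Bop
proof
  show "(\<lambda>x. 0) \<in> {f :: 'a \<Rightarrow> 'a. bounded_clinear f}"
    by (simp add: bounded_clinear_def)
qed

setup_lifting type_definition_bop

lemma bounded_linear_bop_apply: "bounded_linear (bop_apply A)"
  using bop_apply[of A] by (simp add: bounded_clinear_def)

lemma bop_apply_scaleC: "bop_apply A (c *\<^sub>C x) = c *\<^sub>C bop_apply A x"
  using bop_apply[of A] by (simp add: bounded_clinear_def)

instantiation bop :: (complex_normed_vector) complex_normed_vector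
begin

lift_definition norm_bop :: "'a bop \<Rightarrow> real" is onorm .

lift_definition minus_bop :: "'a bop \<Rightarrow> 'a bop \<Rightarrow> 'a bop" is "\<lambda>f g x. f x - g x"
  by (auto simp: bounded_clinear_def bounded_linear_sub complex_vector.scale_right_diff_distrib)

lift_definition uminus_bop :: "'a bop \<Rightarrow> 'a bop" is "\<lambda>f x. - f x"
  by (auto simp: bounded_clinear_def bounded_linear_minus)

lift_definition zero_bop :: "'a bop" is "\<lambda>x. 0"
  by (simp add: bounded_clinear_def)

lift_definition plus_bop :: "'a bop \<Rightarrow> 'a bop \<Rightarrow> 'a bop" is "\<lambda>f g x. f x + g x"
  by (auto simp: bounded_clinear_def bounded_linear_add scaleC_add_right)

lift_definition scaleC_bop :: "complex \<Rightarrow> 'a bop \<Rightarrow> 'a bop" is "\<lambda>c f x. c *\<^sub>C f x"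
  by (auto simp: bounded_clinear_def scaleC_scaleC mult.commute
      intro: bounded_linear_compose[OF bounded_linear_scaleC_right])

lift_definition scaleR_bop :: "real \<Rightarrow> 'a bop \<Rightarrow> 'a bop" is "\<lambda>r f x. r *\<^sub>R f x"
proof -
  fix r :: real and f :: "'a \<Rightarrow> 'a"
  assume f: "bounded_clinear f"
  then have "bounded_linear (\<lambda>x. r *\<^sub>R f x)"
    by (auto simp: bounded_clinear_def intro: bounded_linear_compose[OF bounded_linear_scaleR_right])
  with f show "bounded_clinear (\<lambda>x. r *\<^sub>R f x)"
    by (simp add: bounded_clinear_def scaleR_scaleC_commute)
qed

definition dist_bop :: "'a bop \<Rightarrow> 'a bop \<Rightarrow> real"
  where "dist_bop A B = norm (A - B)"

definition sgn_bop :: "'a bop \<Rightarrow> 'a bop"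
  where "sgn_bop A = inverse (norm A) *\<^sub>R A"

definition
  "(uniformity :: ('a bop \<times> 'a bop) filter) = (INF e\<in>{0 <..}. principal {(x, y). dist x y < e})"

definition open_bop :: "'a bop set \<Rightarrow> bool"
  where "open_bop S = (\<forall>x\<in>S. \<forall>\<^sub>F (x', y) in uniformity. x' = x \<longrightarrow> y \<in> S)"

instance
proof
  fix A B C :: "'a bop" and r s :: real and c d :: complex
  show "dist A B = norm (A - B)" by (rule dist_bop_def)
  show "sgn A = inverse (norm A) *\<^sub>R A" by (rule sgn_bop_def)
  show "(uniformity :: ('a bop \<times> 'a bop) filter) = (INF e\<in>{0 <..}. principal {(x, y). dist x y < e})"
    by (rule uniformity_bop_def)
  show "open U = (\<forall>x\<in>U. \<forall>\<^sub>F (x', y) in uniformity. x' = x \<longrightarrow> y \<in> U)" for U :: "'a bop set"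
    by (rule open_bop_def)
  show "A + B + C = A + (B + C)" "A + B = B + A" "0 + A = A" "- A + A = 0" "A - B = A + - B"
    by (transfer; simp add: algebra_simps)+
  show "r *\<^sub>R (A + B) = r *\<^sub>R A + r *\<^sub>R B" "(r + s) *\<^sub>R A = r *\<^sub>R A + s *\<^sub>R A"
    "r *\<^sub>R s *\<^sub>R A = (r * s) *\<^sub>R A" "1 *\<^sub>R A = A"
    by (transfer; simp add: algebra_simps)+
  show "(norm A = 0) = (A = 0)"
    by transfer (auto simp: bounded_clinear_def onorm_eq_0)
  show "norm (A + B) \<le> norm A + norm B"
    by transfer (auto simp: bounded_clinear_def onorm_triangle)
  show "norm (r *\<^sub>R A) = \<bar>r\<bar> * norm A"
    by transfer (auto simp: bounded_clinear_def onorm_scaleR)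
  show "c *\<^sub>C (A + B) = c *\<^sub>C A + c *\<^sub>C B" "(c + d) *\<^sub>C A = c *\<^sub>C A + d *\<^sub>C A"
    "c *\<^sub>C d *\<^sub>C A = (c * d) *\<^sub>C A" "r *\<^sub>R A = complex_of_real r *\<^sub>C A"
    by (transfer; simp add: scaleC_add_right scaleC_add_left scaleC_scaleC scaleR_scaleC)+
  show "norm (c *\<^sub>C A) = cmod c * norm A"
  proof transfer
    fix c and f :: "'a \<Rightarrow> 'a"
    assume "bounded_clinear f"
    have "onorm (\<lambda>x. c *\<^sub>C f x) = onorm (\<lambda>x. cmod c *\<^sub>R f x)"
      by (simp add: onorm_def norm_scaleC)
    then show "onorm (\<lambda>x. c *\<^sub>C f x) = cmod c * onorm f"
      using onorm_scaleR[of f "cmod c"] \<open>bounded_clinear f\<close> by (simp add: bounded_clinear_def)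
  qed
qed

end

instantiation bop :: (complex_normed_vector) "{real_normed_algebra, monoid_mult}"
begin

lift_definition one_bop :: "'a bop" is "\<lambda>x. x"
  by (simp add: bounded_clinear_def)

lift_definition times_bop :: "'a bop \<Rightarrow> 'a bop \<Rightarrow> 'a bop" is "\<lambda>f g x. f (g x)"
  by (auto simp: bounded_clinear_def intro: bounded_linear_compose)

instance
proof
  fix A B C :: "'a bop" and r :: real
  show "A * B * C = A * (B * C)" "1 * A = A" "A * 1 = A" "(A + B) * C = A * C + B * C"
    "r *\<^sub>R A * B = r *\<^sub>R (A * B)"
    by (transfer; simp)+
  show "A * (B + C) = A * B + A * C"
    by transfer (auto simp: bounded_clinear_def linear_add bounded_linear.linear)
  show "A * r *\<^sub>R B = r *\<^sub>R (A * B)"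
    by transfer (auto simp: bounded_clinear_def linear_scale bounded_linear.linear)
  show "norm (A * B) \<le> norm A * norm B"
    by transfer (auto simp: bounded_clinear_def dest: onorm_compose simp: o_def)
qed

end

instance bop :: ("{complex_normed_vector, banach}") banach
proof
  fix X :: "nat \<Rightarrow> 'a bop"
  assume X: "Cauchy X"
  define Y where "Y n = Blinfun (bop_apply (X n))" for n
  have Y: "blinfun_apply (Y n) = bop_apply (X n)" for n
    unfolding Y_def by (simp add: bounded_linear_Blinfun_apply bounded_linear_bop_apply)
  have dist_Y: "dist (Y m) (Y n) = dist (X m) (X n)" for m n
    by (simp add: dist_norm norm_blinfun.rep_eq norm_bop.rep_eq minus_blinfun.rep_eq minus_bop.rep_eq Y)
  from X have "Cauchy Y"
    by (simp add: Cauchy_def dist_Y)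
  then obtain Z where Z: "Y \<longlonglongrightarrow> Z"
    using Cauchy_convergent convergent_def by blast
  have lim: "(\<lambda>n. bop_apply (X n) x) \<longlonglongrightarrow> blinfun_apply Z x" for x
    using blinfun.tendsto[OF Z tendsto_const[of x]] by (simp add: Y)
  have "blinfun_apply Z (c *\<^sub>C x) = c *\<^sub>C blinfun_apply Z x" for c x
  proof -
    have "(\<lambda>n. c *\<^sub>C bop_apply (X n) x) \<longlonglongrightarrow> c *\<^sub>C blinfun_apply Z x"
      by (rule bounded_linear.tendsto[OF bounded_linear_scaleC_right lim])
    then show ?thesis
      by (rule LIMSEQ_unique[OF lim[of "c *\<^sub>C x", unfolded bop_apply_scaleC]])
  qed
  then have W: "bop_apply (Bop (blinfun_apply Z)) = blinfun_apply Z"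
    by (simp add: Bop_inverse bounded_clinear_def blinfun.bounded_linear_right)
  have "dist (X n) (Bop (blinfun_apply Z)) = dist (Y n) Z" for n
    by (simp add: dist_norm norm_blinfun.rep_eq norm_bop.rep_eq minus_blinfun.rep_eq minus_bop.rep_eq Y W)
  then have "X \<longlonglongrightarrow> Bop (blinfun_apply Z)"
    using Z by (simp add: tendsto_dist_iff[of X] tendsto_dist_iff[of Y])
  then show "convergent X"
    by (auto simp: convergent_def)
qed

text \<open>
  The library constant \<^const>\<open>exp\<close> needs \<open>norm 1 = 1\<close>, which fails for operators on the zero space;
  the power series is the same.
\<close>

definition bop_exp :: "'a::complex_normed_vector bop \<Rightarrow> 'a bop"
  where "bop_exp L = (\<Sum>n. L ^ n /\<^sub>R fact n)"


section \<open>Adjoint and transposition\<close>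

definition adj :: "'h::chilbert_space bop \<Rightarrow> 'h bop"
  where "adj A = (THE B. \<forall>x y. cinner (bop_apply B x) y = cinner x (bop_apply A y))"

definition onb :: "'h::chilbert_space set \<Rightarrow> bool"
  where "onb E \<longleftrightarrow>
    (\<forall>e\<in>E. \<forall>f\<in>E. cinner e f = (if e = f then 1 else 0)) \<and> closure (complex_vector.span E) = UNIV"

text \<open>\<open>J (\<Sum>\<^sub>e c\<^sub>e e) = \<Sum>\<^sub>e (cnj c\<^sub>e) e\<close>, where \<open>c\<^sub>e = \<langle>e, x\<rangle>\<close>; the sum is unconditional.\<close>

definition conj_vec :: "'h::chilbert_space set \<Rightarrow> 'h \<Rightarrow> 'h"
  where "conj_vec E x = (\<Sum>\<^sub>\<infinity>e\<in>E. cnj (cinner e x) *\<^sub>C e)"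

definition transposition :: "'h::chilbert_space set \<Rightarrow> 'h bop \<Rightarrow> 'h bop"
  where "transposition E A = Bop (\<lambda>x. conj_vec E (bop_apply (adj A) (conj_vec E x)))"


section \<open>The weak-* topology\<close>

text \<open>
  The predual of \<open>B(H)\<close> is the space of trace class operators, \<open>\<rho>\<close> acting by \<open>A \<mapsto> tr (\<rho> A)\<close>. The trace
  class operators are the sums \<open>\<rho> = \<Sum>\<^sub>k |y\<^sub>k\<rangle>\<langle>x\<^sub>k|\<close> with square-summable sequences of vectors
  \<open>x\<close>, \<open>y\<close>, and for these \<open>tr (\<rho> A) = \<Sum>\<^sub>k \<langle>x\<^sub>k, A y\<^sub>k\<rangle>\<close>.
\<close>

definition predual :: "('h::chilbert_space bop \<Rightarrow> complex) set"
  where "predual = {\<lambda>A. \<Sum>k. cinner (x k) (bop_apply A (y k)) | x y :: nat \<Rightarrow> 'h.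
    summable (\<lambda>k. (norm (x k))\<^sup>2) \<and> summable (\<lambda>k. (norm (y k))\<^sup>2)}"

definition weak_star :: "'h::chilbert_space bop topology"
  where "weak_star = topology_generated_by {f -` U | f U. f \<in> predual \<and> open U}"

definition weak_star_sums :: "(nat \<Rightarrow> 'h::chilbert_space bop) \<Rightarrow> 'h bop \<Rightarrow> bool"
  where "weak_star_sums f S \<longleftrightarrow> limitin weak_star (\<lambda>N. \<Sum>n<N. f n) S sequentially"

definition weak_star_summable :: "(nat \<Rightarrow> 'h::chilbert_space bop) \<Rightarrow> bool"
  where "weak_star_summable f \<longleftrightarrow> (\<exists>S. weak_star_sums f S)"


section \<open>Decomposable maps\<close>

text \<open>
  An \<open>n \<times> n\<close> matrix over \<open>B(H)\<close> is a function of two indices, of which only the values at indices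
  below \<open>n\<close> matter. It is positive if it is a positive operator on the \<open>n\<close>-fold direct sum of \<open>H\<close>.
\<close>

definition mat_positive :: "nat \<Rightarrow> (nat \<Rightarrow> nat \<Rightarrow> 'h::chilbert_space bop) \<Rightarrow> bool"
  where "mat_positive n a \<longleftrightarrow>
    (\<forall>x :: nat \<Rightarrow> 'h. (\<Sum>i<n. \<Sum>j<n. cinner (x i) (bop_apply (a i j) (x j))) \<in> \<real>\<^sub>\<ge>\<^sub>0)"

definition CP :: "'h::chilbert_space bop bop set"
  where "CP = {T. \<forall>n a. mat_positive n a \<longrightarrow> mat_positive n (\<lambda>i j. bop_apply T (a i j))}"

definition coCP :: "'h::chilbert_space bop bop set"
  where "coCP = {T. \<forall>n a. mat_positive n a \<longrightarrow> mat_positive n (\<lambda>i j. bop_apply T (a j i))}"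

definition decomposable :: "'h::chilbert_space bop bop \<Rightarrow> bool"
  where "decomposable T \<longleftrightarrow> (\<exists>\<phi>\<in>CP. \<exists>\<psi>\<in>coCP. T = \<phi> + \<psi>)"


section \<open>Decomposable dynamical semigroups\<close>

definition decomposable_dynamical_semigroup :: "(real \<Rightarrow> 'h::chilbert_space bop bop) \<Rightarrow> bool"
  where "decomposable_dynamical_semigroup S \<longleftrightarrow>
    S 0 = 1 \<and> (\<forall>s\<ge>0. \<forall>t\<ge>0. S (s + t) = S s * S t) \<and> continuous_on {0..} S \<and>
    (\<forall>t\<ge>0. decomposable (S t) \<and> bop_apply (S t) 1 = 1 \<and>
      continuous_map weak_star weak_star (bop_apply (S t)))"

text \<open>\<open>D n\<close> is the \<open>n\<close>-th derivative of \<open>f\<close> on \<open>[0, \<infinity>)\<close>, one-sided at \<open>0\<close>.\<close>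

definition smooth_on_halfline :: "(real \<Rightarrow> 'b::real_normed_vector) \<Rightarrow> bool"
  where "smooth_on_halfline f \<longleftrightarrow> (\<exists>D :: nat \<Rightarrow> real \<Rightarrow> 'b. (\<forall>t\<ge>0. D 0 t = f t) \<and>
    (\<forall>n. \<forall>t\<ge>0. (D n has_vector_derivative D (Suc n) t) (at t within {0..})))"

definition smoothly_decomposable :: "(real \<Rightarrow> 'h::chilbert_space bop bop) \<Rightarrow> bool"
  where "smoothly_decomposable S \<longleftrightarrow> (\<exists>\<phi> \<psi>. smooth_on_halfline \<phi> \<and> smooth_on_halfline \<psi> \<and>
    (\<forall>t\<ge>0. \<phi> t \<in> CP \<and> \<psi> t \<in> coCP \<and> S t = \<phi> t + \<psi> t))"


section \<open>The generator\<close>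

definition commutator :: "'a::ring \<Rightarrow> 'a \<Rightarrow> 'a"
  where "commutator A B = A * B - B * A"

definition anticommutator :: "'a::ring \<Rightarrow> 'a \<Rightarrow> 'a"
  where "anticommutator A B = A * B + B * A"

text \<open>The equation is stated as weak-* convergence of the series to \<open>L A - i[H, A]\<close>.\<close>

definition has_generator_form :: "'h::chilbert_space set \<Rightarrow> ('h bop \<Rightarrow> 'h bop) \<Rightarrow>
    'h bop \<Rightarrow> (nat \<Rightarrow> 'h bop) \<Rightarrow> (nat \<Rightarrow> 'h bop) \<Rightarrow> bool"
  where "has_generator_form E L H V W \<longleftrightarrow> (\<forall>A.
    weak_star_sums
      (\<lambda>n. adj (V n) * A * V n + adj (W n) * transposition E A * W n
        - (1/2) *\<^sub>R anticommutator (adj (V n) * V n + adj (W n) * W n) A)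
      (L A - \<i> *\<^sub>C commutator H A))"

end

theory Submission
  imports Defs
begin

text \<open>
  Write \<open>exp (t L) = \<phi> t + \<psi> t\<close> smoothly. In dimension at least two the identity has no copositive
  part, so \<open>\<phi> 0 = 1\<close> and \<open>\<psi> 0 = 0\<close>. Hence the derivative of \<open>\<psi>\<close> at \<open>0\<close> is completely copositive,
  while that of \<open>\<phi>\<close> is conditionally completely positive and becomes completely positive after
  subtracting a map \<open>A \<mapsto> K A + A K\<^sup>*\<close>. Since \<open>L\<close> is normal and the two remaining parts are positive,
  both are normal. A normal completely positive \<open>\<Phi>\<close> is determined by the kernel
  \<open>((a, x), (b, y)) \<mapsto> \<langle>x, \<Phi>(|a\<rangle>\<langle>b|) y\<rangle>\<close>, whose Cholesky decomposition with pivots in a countable dense set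
  yields the Kraus operators.

  Conversely, let \<open>L = G + Q\<close> with the copositive term \<open>Q A = \<Sum> W\<^sub>n\<^sup>* A\<^sup>\<tau> W\<^sub>n\<close>. Then \<open>exp (t (G \<plusminus> Q))\<close> is the limit
  of \<open>(P\<^sub>n \<plusminus> (t/n) Q)\<^sup>n\<close> for completely positive \<open>P\<^sub>n\<close>. So the part of \<open>exp (t L)\<close> that is even in \<open>Q\<close>,
  \<open>(exp (t (G + Q)) + exp (t (G - Q))) / 2\<close>, is completely positive, and the odd part is completely
  copositive.
\<close>

text \<open>Smoothness allows the two parts to be differentiated at 0 separately. The derivative of
  \<open>\<psi>\<close> keeps its positivity because \<open>\<psi> 0 = 0\<close>; that of
  \<open>\<phi>\<close> keeps it only on families where the subtracted identity contributes nothing.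
  In dimension at most one, transposition is the identity and the splitting at 0 is not unique;
  there \<open>L \<cdot> 1 = 0\<close> already gives \<open>L = 0\<close>.

  Positivity is mostly used through the kernel ((a, x), (b, y)) \<mapsto>
  \<open>\<langle>x, (\<Phi> \<cdot> (adj a * b)) \<cdot> y\<rangle>\<close>, and its Cauchy-Schwarz
  inequality drives both the argument at the identity and the Cholesky decomposition. The
  infinite-dimensional obstacle is that a positive map may vanish on all rank-one operators without
  being 0. Normality excludes this, and it is tested on the net \<open>1 - proj F\<close> alone.
  Separability makes the pivots countable, hence the Kraus families sequences.

  In the converse, splitting the generator does not split the exponential into positive parts, since
  the summands need not commute. The sign change of \<open>Q\<close> recovers the two parts from
  products of small steps.\<close>

notation bop_apply (infixr "\<cdot>" 80)
notation cinner ("\<langle>_, _\<rangle>")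

section \<open>Inner products\<close>

lemma cinner_add_left: "\<langle>x + y, z\<rangle> = \<langle>x, z\<rangle> + \<langle>y, z\<rangle>"
  by (metis cinner_add_right cinner_commute complex_cnj_add)

lemma cinner_scaleC_left: "\<langle>c *\<^sub>C x, y\<rangle> = cnj c * \<langle>x, y\<rangle>"
  by (metis cinner_commute cinner_scaleC_right complex_cnj_mult)

lemma cinner_scaleR_right: "\<langle>x, r *\<^sub>R y\<rangle> = complex_of_real r * \<langle>x, y\<rangle>"
  by (simp add: scaleR_scaleC cinner_scaleC_right)

lemma cinner_scaleR_left: "\<langle>r *\<^sub>R x, y\<rangle> = complex_of_real r * \<langle>x, y\<rangle>"
  by (simp add: scaleR_scaleC cinner_scaleC_left)

lemma cinner_zero_right [simp]: "\<langle>x, 0\<rangle> = 0"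
  using cinner_add_right[of x 0 0] by simp

lemma cinner_zero_left [simp]: "\<langle>0, x\<rangle> = 0"
  using cinner_add_left[of 0 0 x] by simp

lemma cinner_minus_right: "\<langle>x, - y\<rangle> = - \<langle>x, y\<rangle>"
  using cinner_add_right[of x y "- y"] by (simp add: eq_neg_iff_add_eq_0 add.commute)

lemma cinner_minus_left: "\<langle>- x, y\<rangle> = - \<langle>x, y\<rangle>"
  using cinner_add_left[of x "- x" y] by (simp add: eq_neg_iff_add_eq_0 add.commute)

lemma cinner_diff_right: "\<langle>x, y - z\<rangle> = \<langle>x, y\<rangle> - \<langle>x, z\<rangle>"
  using cinner_add_right[of x y "- z"] by (simp add: cinner_minus_right)

lemma cinner_diff_left: "\<langle>x - y, z\<rangle> = \<langle>x, z\<rangle> - \<langle>y, z\<rangle>"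
  using cinner_add_left[of x "- y" z] by (simp add: cinner_minus_left)

lemma cinner_sum_right: "\<langle>x, sum f I\<rangle> = (\<Sum>i\<in>I. \<langle>x, f i\<rangle>)"
  by (induction I rule: infinite_finite_induct) (simp_all add: cinner_add_right)

lemma cinner_sum_left: "\<langle>sum f I, x\<rangle> = (\<Sum>i\<in>I. \<langle>f i, x\<rangle>)"
  by (induction I rule: infinite_finite_induct) (simp_all add: cinner_add_left)

lemma cinner_eqI: "(\<And>x. \<langle>x, y\<rangle> = \<langle>x, z\<rangle>) \<Longrightarrow> y = z"
  using cinner_norm[of "y - z"] by (simp add: cinner_diff_right)

lemma norm_add_sq: "(norm (x + y))\<^sup>2 = (norm x)\<^sup>2 + 2 * Re \<langle>x, y\<rangle> + (norm y)\<^sup>2"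
proof -
  have "(norm (x + y))\<^sup>2 = Re \<langle>x + y, x + y\<rangle>"
    by (simp only: cinner_norm Re_complex_of_real)
  also have "\<dots> = (norm x)\<^sup>2 + (Re \<langle>x, y\<rangle> + Re \<langle>y, x\<rangle>) + (norm y)\<^sup>2"
    unfolding cinner_add_left cinner_add_right by (simp add: cinner_norm del: of_real_power)
  also have "Re \<langle>y, x\<rangle> = Re \<langle>x, y\<rangle>"
    using cinner_commute[of x y] by simp
  finally show ?thesis by simp
qed

text \<open>With c = - t * cnj z and t = 1 / b the hypothesis turns into the claim; for b = 0 a
  large t rules out z \<noteq> 0. The Cauchy-Schwarz inequalities for \<open>cinner\<close> and for
  \<open>kernel_positive\<close> maps both come from here.\<close>

lemma discriminant_bound:
  fixes z :: complex and a b :: real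
  assumes pos: "\<And>c. 0 \<le> a + 2 * Re (c * z) + (cmod c)\<^sup>2 * b" and b: "b \<ge> 0"
  shows "(cmod z)\<^sup>2 \<le> a * b"
proof -
  have *: "0 \<le> a - 2 * t * (cmod z)\<^sup>2 + t\<^sup>2 * (cmod z)\<^sup>2 * b" for t :: real
  proof -
    have "Re (- complex_of_real t * cnj z * z) = - t * (cmod z)\<^sup>2"
      by (simp add: mult.assoc complex_mult_cnj cmod_power2 mult.commute[of "cnj z"] flip: power2_eq_square)
    then show ?thesis
      using pos[of "- complex_of_real t * cnj z"] by (simp add: norm_mult power_mult_distrib)
  qed
  show ?thesis
  proof (cases "b = 0")
    case True
    have "(cmod z)\<^sup>2 = 0"
    proof (rule ccontr)
      assume "(cmod z)\<^sup>2 \<noteq> 0"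
      \<comment> \<open>This t makes the lower bound equal to - a - 2, which is negative since a
        \<ge> 0.\<close>
      then have "a - 2 * ((a + 1) / (cmod z)\<^sup>2) * (cmod z)\<^sup>2 = a - 2 * (a + 1)"
        by simp
      with *[of "(a + 1) / (cmod z)\<^sup>2"] *[of 0] True show False by simp
    qed
    then show ?thesis using True by simp
  next
    case False
    with b have "b > 0" by simp
    have "0 \<le> a - 2 * (1 / b) * (cmod z)\<^sup>2 + (1 / b)\<^sup>2 * (cmod z)\<^sup>2 * b" by (rule *)
    also have "\<dots> = a - (cmod z)\<^sup>2 / b"
      using \<open>b > 0\<close> by (simp add: power2_eq_square)
    finally show ?thesis using \<open>b > 0\<close> by (simp add: field_simps)
  qed
qed

lemma cinner_bound: "cmod \<langle>x, y\<rangle> \<le> norm x * norm y"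
proof -
  have "(cmod \<langle>x, y\<rangle>)\<^sup>2 \<le> (norm x)\<^sup>2 * (norm y)\<^sup>2"
  proof (rule discriminant_bound)
    fix c
    have "(norm (x + c *\<^sub>C y))\<^sup>2 = (norm x)\<^sup>2 + 2 * Re (c * \<langle>x, y\<rangle>) + (cmod c)\<^sup>2 * (norm y)\<^sup>2"
      by (simp add: norm_add_sq cinner_scaleC_right norm_scaleC power_mult_distrib)
    then show "0 \<le> (norm x)\<^sup>2 + 2 * Re (c * \<langle>x, y\<rangle>) + (cmod c)\<^sup>2 * (norm y)\<^sup>2"
      by (metis zero_le_power2)
  qed simp
  then show ?thesis
    by (metis norm_ge_zero power_mult_distrib power2_le_imp_le mult_nonneg_nonneg)
qed

lemma bounded_linear_cinner_right: "bounded_linear (\<lambda>y. \<langle>x, y\<rangle>)"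
  by (rule bounded_linear_intro[where K = "norm x"])
    (simp_all add: cinner_add_right cinner_scaleR_right scaleR_conv_of_real mult.commute cinner_bound
      mult.commute[of "norm x"] order_trans[OF cinner_bound])

lemma norm_le_cinner:
  assumes "\<And>x. cmod \<langle>x, y\<rangle> \<le> K * norm x" and "K \<ge> 0"
  shows "norm y \<le> K"
proof (cases "y = 0")
  case False
  have "norm y * norm y \<le> K * norm y"
    using assms(1)[of y] by (simp add: cinner_norm norm_power power2_eq_square norm_mult)
  with False show ?thesis by simp
qed (use assms in simp)

section \<open>Riesz representation and adjoints\<close>

text \<open>The representing vector minimises \<open>(norm x)\<^sup>2 - 2 * Re (f x)\<close>.\<close>

lemma riesz_representation:
  fixes f :: "'h::chilbert_space \<Rightarrow> complex"
  assumes f: "bounded_linear f" and fC: "\<And>c x. f (c *\<^sub>C x) = c * f x"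
  obtains z where "\<And>x. f x = \<langle>z, x\<rangle>"
proof -
  interpret f: bounded_linear f by fact
  define g where "g x = (norm x)\<^sup>2 - 2 * Re (f x)" for x
  define m where "m = Inf (range g)"
  have "- (onorm f)\<^sup>2 \<le> g x" for x
  proof -
    have "Re (f x) \<le> onorm f * norm x"
      using onorm[OF f, of x] complex_Re_le_cmod[of "f x"] by linarith
    moreover have "0 \<le> (norm x - onorm f)\<^sup>2" by simp
    ultimately show ?thesis by (simp add: g_def power2_diff algebra_simps)
  qed
  then have bdd: "bdd_below (range g)" by (intro bdd_belowI) auto
  then have m: "m \<le> g x" for x unfolding m_def by (intro cInf_lower) auto
  have "\<exists>x. g x < m + inverse (real (Suc n))" for n
    using cInf_lessD[of "range g" "m + inverse (real (Suc n))"] unfolding m_def by auto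
  then obtain X where X: "\<And>n. g (X n) < m + inverse (real (Suc n))" by metis
  \<comment> \<open>Parallelogram law: the midpoint of two near-minimisers would undercut m unless
    they are close to each other.\<close>
  have mid: "(norm (x - y))\<^sup>2 \<le> 2 * (g x - m) + 2 * (g y - m)" for x y
  proof -
    have 1: "(norm (x + y))\<^sup>2 + (norm (x - y))\<^sup>2 = 2 * (norm x)\<^sup>2 + 2 * (norm y)\<^sup>2"
      using norm_add_sq[of x y] norm_add_sq[of x "- y"] by (simp add: cinner_minus_right)
    have "g ((1/2) *\<^sub>R (x + y)) = (norm (x + y))\<^sup>2 / 4 - Re (f x) - Re (f y)"
      by (simp add: g_def f.scaleR f.add power_divide add_divide_distrib)
    with m[of "(1/2) *\<^sub>R (x + y)"] 1 show ?thesis by (simp add: g_def)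
  qed
  have "Cauchy X"
  proof (rule metric_CauchyI)
    fix e :: real assume "e > 0"
    then obtain N where N: "inverse (real (Suc N)) < e\<^sup>2 / 4"
      using reals_Archimedean[of "e\<^sup>2 / 4"] by auto
    show "\<exists>M. \<forall>i\<ge>M. \<forall>j\<ge>M. dist (X i) (X j) < e"
    proof (intro exI allI impI)
      fix i j assume ij: "i \<ge> N" "j \<ge> N"
      have "inverse (real (Suc k)) < e\<^sup>2 / 4" if "k \<ge> N" for k
        using that N by (intro order.strict_trans1[OF _ N]) (simp add: field_simps)
      then have "g (X k) < m + e\<^sup>2 / 4" if "k \<ge> N" for k
        using X[of k] that by fastforce
      from this[OF ij(1)] this[OF ij(2)]
      have "2 * (g (X i) - m) + 2 * (g (X j) - m) < 2 * (e\<^sup>2 / 4) + 2 * (e\<^sup>2 / 4)"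
        by (intro add_strict_mono mult_strict_left_mono) simp_all
      with mid[of "X i" "X j"] have "(norm (X i - X j))\<^sup>2 < e\<^sup>2"
        by simp
      then show "dist (X i) (X j) < e"
        using \<open>e > 0\<close> by (simp add: dist_norm power2_less_imp_less)
    qed
  qed
  then obtain z where z: "X \<longlonglongrightarrow> z" using Cauchy_convergent convergent_def by blast
  have "(\<lambda>n. g (X n)) \<longlonglongrightarrow> g z"
    unfolding g_def by (intro tendsto_intros f.tendsto z)
  moreover have "(\<lambda>n. m + inverse (real (Suc n))) \<longlonglongrightarrow> m + 0"
    by (intro tendsto_intros LIMSEQ_inverse_real_of_nat)
  ultimately have "g z \<le> m + 0"
    by (rule LIMSEQ_le) (use X less_imp_le in blast)
  then have min: "g z \<le> g x" for x using m[of x] by simp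
  \<comment> \<open>The first variation of g at z along h is 2 * d. Since z is a minimum, the
    discriminant bound with a = 0 forces d = 0; only real multiples of h are tried, which is why
    only real parts are compared here.\<close>
  have re: "Re \<langle>z, h\<rangle> = Re (f h)" for h
  proof -
    define d where "d = Re \<langle>z, h\<rangle> - Re (f h)"
    have "(cmod (complex_of_real d))\<^sup>2 \<le> 0 * (norm h)\<^sup>2"
    proof (rule discriminant_bound)
      fix c
      have "g (z + Re c *\<^sub>R h) = g z + 2 * Re c * d + (Re c)\<^sup>2 * (norm h)\<^sup>2"
        by (simp add: g_def norm_add_sq f.add f.scaleR cinner_scaleR_right d_def power_mult_distrib algebra_simps)
      with min[of "z + Re c *\<^sub>R h"] have "0 \<le> 2 * Re c * d + (Re c)\<^sup>2 * (norm h)\<^sup>2" by simp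
      moreover have "(Re c)\<^sup>2 \<le> (cmod c)\<^sup>2"
        by (simp add: cmod_power2)
      ultimately show "0 \<le> 0 + 2 * Re (c * complex_of_real d) + (cmod c)\<^sup>2 * (norm h)\<^sup>2"
        using mult_right_mono[of "(Re c)\<^sup>2" "(cmod c)\<^sup>2" "(norm h)\<^sup>2"] by simp
    qed simp
    then show ?thesis by (simp add: d_def)
  qed
  have "f x = \<langle>z, x\<rangle>" for x
    using re[of x] re[of "\<i> *\<^sub>C x"] by (simp add: complex_eq_iff fC cinner_scaleC_right)
  then show ?thesis by (rule that)
qed

lemma bop_eqI: "(\<And>x. A \<cdot> x = B \<cdot> x) \<Longrightarrow> A = B"
  by (simp add: bop_apply_inject[symmetric] fun_eq_iff)

lemma bop_eq_cinnerI: "(\<And>x y. \<langle>x, A \<cdot> y\<rangle> = \<langle>x, B \<cdot> y\<rangle>) \<Longrightarrow> A = B"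
  by (intro bop_eqI cinner_eqI)

lemma Bop_apply: "bounded_clinear f \<Longrightarrow> Bop f \<cdot> x = f x"
  by (simp add: Bop_inverse)

lemma bounded_clinearI:
  assumes "\<And>x y. f (x + y) = f x + f y" "\<And>c x. f (c *\<^sub>C x) = c *\<^sub>C f x" "\<And>x. norm (f x) \<le> K * norm x"
  shows "bounded_clinear f"
  unfolding bounded_clinear_def using assms
  by (auto intro!: bounded_linear_intro[where K = K] simp: scaleR_scaleC mult.commute)

lemma bop_norm_bound: "norm (A \<cdot> x) \<le> norm A * norm x"
  unfolding norm_bop.rep_eq by (rule onorm[OF bounded_linear_bop_apply])

lemma bop_norm_leI: "0 \<le> K \<Longrightarrow> (\<And>x. norm (A \<cdot> x) \<le> K * norm x) \<Longrightarrow> norm A \<le> K"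
  unfolding norm_bop.rep_eq by (rule onorm_bound)

lemmas bop_add_right = linear_add[OF bounded_linear.linear[OF bounded_linear_bop_apply]]
lemmas bop_diff_right = linear_diff[OF bounded_linear.linear[OF bounded_linear_bop_apply]]
lemmas bop_zero_right = linear_0[OF bounded_linear.linear[OF bounded_linear_bop_apply]]
lemmas bop_minus_right = linear_neg[OF bounded_linear.linear[OF bounded_linear_bop_apply]]
lemmas bop_sum_right = linear_sum[OF bounded_linear.linear[OF bounded_linear_bop_apply]]
lemmas bop_scaleR_right = linear_scale[OF bounded_linear.linear[OF bounded_linear_bop_apply]]

lemma bop_sum_left: "(\<Sum>i\<in>I. f i) \<cdot> x = (\<Sum>i\<in>I. f i \<cdot> x)"
  by (induction I rule: infinite_finite_induct) (simp_all add: zero_bop.rep_eq plus_bop.rep_eq)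

lemmas bop_simps = zero_bop.rep_eq plus_bop.rep_eq minus_bop.rep_eq uminus_bop.rep_eq
  scaleC_bop.rep_eq scaleR_bop.rep_eq one_bop.rep_eq times_bop.rep_eq bop_sum_left
  bop_add_right bop_diff_right bop_zero_right bop_minus_right bop_sum_right bop_scaleR_right
  bop_apply_scaleC

lemmas cinner_simps = cinner_add_left cinner_add_right cinner_diff_left cinner_diff_right
  cinner_minus_left cinner_minus_right cinner_scaleC_left cinner_scaleC_right
  cinner_scaleR_left cinner_scaleR_right

lemma norm_one_bop_le: "norm (1 :: 'a::complex_normed_vector bop) \<le> 1"
  by (rule bop_norm_leI) (simp_all add: bop_simps)

lemma bounded_linear_bop_eval: "bounded_linear (\<lambda>A. A \<cdot> x)"
  by (rule bounded_linear_intro[where K = "norm x"])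
    (simp_all add: bop_simps bop_norm_bound)

lemma bounded_linear_cinner_bop: "bounded_linear (\<lambda>A. \<langle>x, A \<cdot> y\<rangle>)"
  by (rule bounded_linear_compose[OF bounded_linear_cinner_right bounded_linear_bop_eval])

lemma cinner_bop_bound: "cmod \<langle>x, A \<cdot> y\<rangle> \<le> norm A * norm x * norm y"
proof -
  have "cmod \<langle>x, A \<cdot> y\<rangle> \<le> norm x * norm (A \<cdot> y)" by (rule cinner_bound)
  also have "\<dots> \<le> norm x * (norm A * norm y)"
    by (intro mult_left_mono bop_norm_bound) simp
  finally show ?thesis by (simp add: algebra_simps)
qed

text \<open>Riesz, applied to the conjugate of \<open>B\<close> with y fixed, gives the vector T y,
  and linearity in y is read off from \<open>B\<close>. Adjoints, Cholesky factors and sums of Kraus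
  series are built this way.\<close>

lemma bounded_form_bop:
  fixes B :: "'h::chilbert_space \<Rightarrow> 'h \<Rightarrow> complex"
  assumes add_left: "\<And>x x' y. B (x + x') y = B x y + B x' y"
    and scale_left: "\<And>c x y. B (c *\<^sub>C x) y = cnj c * B x y"
    and add_right: "\<And>x y y'. B x (y + y') = B x y + B x y'"
    and scale_right: "\<And>c x y. B x (c *\<^sub>C y) = c * B x y"
    and bound: "\<And>x y. cmod (B x y) \<le> K * norm x * norm y" and K: "K \<ge> 0"
  obtains T where "\<And>x y. \<langle>x, T \<cdot> y\<rangle> = B x y" "norm T \<le> K"
proof -
  have "\<exists>z. \<forall>x. cnj (B x y) = \<langle>z, x\<rangle>" for y
  proof -
    have "bounded_linear (\<lambda>x. cnj (B x y))"
      by (rule bounded_linear_intro[where K = "K * norm y"])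
        (use bound[of _ y] in \<open>simp_all add: add_left scale_left scaleR_scaleC scaleR_conv_of_real algebra_simps\<close>)
    then show ?thesis
      by (rule riesz_representation) (auto simp: scale_left)
  qed
  then obtain f where f: "\<And>x y. cnj (B x y) = \<langle>f y, x\<rangle>" by metis
  have B: "\<langle>x, f y\<rangle> = B x y" for x y
    by (subst cinner_commute) (simp add: f[symmetric])
  have norm_f: "norm (f y) \<le> K * norm y" for y
    by (rule norm_le_cinner) (use bound[of _ y] K in \<open>simp_all add: B mult_ac\<close>)
  have "bounded_clinear f"
  proof (rule bounded_clinearI[where K = K])
    show "f (x + y) = f x + f y" for x y
      by (rule cinner_eqI) (simp add: B cinner_add_right add_right)
    show "f (c *\<^sub>C x) = c *\<^sub>C f x" for c x
      by (rule cinner_eqI) (simp add: B cinner_scaleC_right scale_right)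
  qed (rule norm_f)
  then have "Bop f \<cdot> y = f y" for y by (rule Bop_apply)
  with B norm_f K show ?thesis
    by (intro that[of "Bop f"] bop_norm_leI) simp_all
qed

text \<open>\<open>adj\<close> is a definite description, so it needs existence, supplied by the
  bounded form \<open>\<langle>A \<cdot> x, y\<rangle>\<close>, and uniqueness, supplied by
  nondegeneracy. Afterwards the description is not unfolded again.\<close>

lemma cinner_adj_left: "\<langle>adj A \<cdot> x, y\<rangle> = \<langle>x, A \<cdot> y\<rangle>"
proof -
  obtain T where T: "\<And>x y. \<langle>x, T \<cdot> y\<rangle> = \<langle>A \<cdot> x, y\<rangle>"
  proof (rule bounded_form_bop[of "\<lambda>x y. \<langle>A \<cdot> x, y\<rangle>" "norm A"])
    fix x y
    have "cmod \<langle>A \<cdot> x, y\<rangle> \<le> norm (A \<cdot> x) * norm y" by (rule cinner_bound)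
    also have "\<dots> \<le> norm A * norm x * norm y"
      by (intro mult_right_mono bop_norm_bound) simp
    finally show "cmod \<langle>A \<cdot> x, y\<rangle> \<le> norm A * norm x * norm y" .
  qed (auto simp: bop_simps cinner_simps)
  have T': "\<langle>T \<cdot> x, y\<rangle> = \<langle>x, A \<cdot> y\<rangle>" for x y
    using T[of y x] by (metis cinner_commute)
  have "adj A = T"
    unfolding adj_def
  proof (rule the_equality)
    fix S assume S: "\<forall>x y. \<langle>S \<cdot> x, y\<rangle> = \<langle>x, A \<cdot> y\<rangle>"
    show "S = T"
      by (rule bop_eq_cinnerI) (metis S T' cinner_commute)
  qed (use T' in blast)
  with T' show ?thesis by simp
qed

lemma cinner_adj_right: "\<langle>x, adj A \<cdot> y\<rangle> = \<langle>A \<cdot> x, y\<rangle>"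
  by (metis cinner_adj_left cinner_commute)

lemma adj_eqI: "(\<And>x y. \<langle>x, B \<cdot> y\<rangle> = \<langle>A \<cdot> x, y\<rangle>) \<Longrightarrow> adj A = B"
  by (rule bop_eq_cinnerI) (simp add: cinner_adj_right)

lemma adj_adj [simp]: "adj (adj A) = A"
  by (rule adj_eqI) (simp add: cinner_adj_left)

lemma adj_mult [simp]: "adj (A * B) = adj B * adj A"
  by (rule adj_eqI) (simp add: cinner_adj_right bop_simps)

lemma adj_add: "adj (A + B) = adj A + adj B"
  by (rule adj_eqI) (simp add: cinner_adj_right bop_simps cinner_simps)

lemma adj_diff: "adj (A - B) = adj A - adj B"
  by (rule adj_eqI) (simp add: cinner_adj_right bop_simps cinner_simps)

lemma adj_scaleC: "adj (c *\<^sub>C A) = cnj c *\<^sub>C adj A"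
  by (rule adj_eqI) (simp add: cinner_adj_right bop_simps cinner_simps)

lemma adj_scaleR: "adj (r *\<^sub>R A) = r *\<^sub>R adj A"
  by (rule adj_eqI) (simp add: cinner_adj_right bop_simps cinner_simps)

lemma adj_one [simp]: "adj 1 = 1"
  by (rule adj_eqI) (simp add: bop_simps)

lemma adj_zero [simp]: "adj 0 = 0"
  by (rule adj_eqI) (simp add: bop_simps)

lemma adj_sum: "adj (sum f I) = (\<Sum>i\<in>I. adj (f i))"
  by (induction I rule: infinite_finite_induct) (simp_all add: adj_add)

lemma norm_adj: "norm (adj A) = norm A"
proof -
  have le: "norm (adj A) \<le> norm A" for A :: "'a bop"
  proof (intro bop_norm_leI norm_le_cinner)
    fix x y
    have "cmod \<langle>A \<cdot> y, x\<rangle> \<le> norm (A \<cdot> y) * norm x" by (rule cinner_bound)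
    also have "\<dots> \<le> norm A * norm y * norm x"
      by (intro mult_right_mono bop_norm_bound) simp
    finally show "cmod \<langle>y, adj A \<cdot> x\<rangle> \<le> norm A * norm x * norm y"
      by (simp add: cinner_adj_right mult_ac)
  qed simp_all
  from le[of A] le[of "adj A"] show ?thesis by simp
qed

lemma bop_scaleC_mult_left: "(c *\<^sub>C (A :: 'a::complex_normed_vector bop)) * B = c *\<^sub>C (A * B)"
  by (rule bop_eqI) (simp add: bop_simps)

lemma bop_scaleC_mult_right: "(A :: 'a::complex_normed_vector bop) * (c *\<^sub>C B) = c *\<^sub>C (A * B)"
  by (rule bop_eqI) (simp add: bop_simps)

section \<open>Rank-one operators |a><b|, linear in a and antilinear in b\<close>

definition rank1 :: "'h::chilbert_space \<Rightarrow> 'h \<Rightarrow> 'h bop"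
  where "rank1 a b = Bop (\<lambda>x. \<langle>b, x\<rangle> *\<^sub>C a)"

lemma rank1_apply: "rank1 a b \<cdot> x = \<langle>b, x\<rangle> *\<^sub>C a"
  unfolding rank1_def
  by (rule Bop_apply, rule bounded_clinearI[where K = "norm a * norm b"])
    (use mult_right_mono[OF cinner_bound[of b], of "norm a"] in \<open>auto simp: cinner_simps scaleC_add_left scaleC_scaleC norm_scaleC mult_ac\<close>)

lemma norm_rank1_le: "norm (rank1 a b) \<le> norm a * norm b"
  by (rule bop_norm_leI)
    (use mult_right_mono[OF cinner_bound[of b], of "norm a"] in \<open>auto simp: rank1_apply norm_scaleC mult_ac\<close>)

lemma adj_rank1: "adj (rank1 a b) = rank1 b a"
  by (rule adj_eqI) (simp add: rank1_apply cinner_simps cinner_commute[of _ b])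

lemma rank1_mult_rank1: "rank1 a b * rank1 c d = \<langle>b, c\<rangle> *\<^sub>C rank1 a d"
  by (rule bop_eqI) (simp add: bop_simps rank1_apply cinner_simps scaleC_scaleC mult.commute)

lemma mult_rank1: "A * rank1 a b = rank1 (A \<cdot> a) b"
  by (rule bop_eqI) (simp add: bop_simps rank1_apply)

lemma rank1_mult: "rank1 a b * A = rank1 a (adj A \<cdot> b)"
  by (rule bop_eqI) (simp add: bop_simps rank1_apply cinner_adj_left)

section \<open>Orthonormal bases and the transposition\<close>

text \<open>For finite \<open>F \<subseteq> E\<close> this is the orthogonal projection onto the
  span of \<open>F\<close>. An infinite \<open>F\<close> gives 0 by the convention for
  \<open>sum\<close>, so finiteness is carried along explicitly.\<close>

definition proj :: "'h::chilbert_space set \<Rightarrow> 'h bop"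
  where "proj F = (\<Sum>e\<in>F. rank1 e e)"

lemma proj_apply: "proj F \<cdot> x = (\<Sum>e\<in>F. \<langle>e, x\<rangle> *\<^sub>C e)"
  by (simp add: proj_def bop_sum_left rank1_apply)

lemma adj_proj [simp]: "adj (proj F) = proj F"
  by (simp add: proj_def adj_sum adj_rank1)

locale orthonormal_basis =
  fixes E :: "'h::chilbert_space set"
  assumes onb: "onb E"
begin

lemma basis_cinner: "e \<in> E \<Longrightarrow> f \<in> E \<Longrightarrow> \<langle>e, f\<rangle> = (if e = f then 1 else 0)"
  using onb by (simp add: onb_def)

lemma proj_basis: "finite F \<Longrightarrow> F \<subseteq> E \<Longrightarrow> e \<in> F \<Longrightarrow> proj F \<cdot> e = e"
proof -
  assume F: "finite F" "F \<subseteq> E" "e \<in> F"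
  have "proj F \<cdot> e = (\<Sum>f\<in>F. if f = e then e else 0)"
    unfolding proj_apply using F by (intro sum.cong refl) (auto simp: basis_cinner subset_iff)
  then show ?thesis using F by simp
qed

text \<open>Together with \<open>adj_coproj\<close> this writes Q = \<open>1 - proj F\<close> as
  \<open>adj Q * Q\<close>, the shape on which \<open>kernel_positive\<close> maps are
  nonnegative.\<close>

lemma coproj_idem:
  assumes "finite F" "F \<subseteq> E"
  shows "(1 - proj F) * (1 - proj F) = 1 - proj F"
proof -
  have "proj F * proj F = proj F"
  proof (rule bop_eqI)
    fix x
    have "proj F \<cdot> proj F \<cdot> x = (\<Sum>e\<in>F. \<langle>e, x\<rangle> *\<^sub>C proj F \<cdot> e)"
      by (subst (2) proj_apply) (simp add: bop_simps)
    also have "\<dots> = proj F \<cdot> x"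
      unfolding proj_apply[of F x] using assms by (intro sum.cong refl) (simp add: proj_basis)
    finally show "(proj F * proj F) \<cdot> x = proj F \<cdot> x" by (simp add: bop_simps)
  qed
  then show ?thesis by (simp add: left_diff_distrib right_diff_distrib)
qed

lemma adj_coproj: "adj (1 - proj F) = 1 - proj F"
  by (simp add: adj_diff)

lemma norm_coproj_le:
  assumes "finite F" "F \<subseteq> E"
  shows "norm (1 - proj F) \<le> 1"
proof (rule bop_norm_leI)
  fix x
  define Q where "Q = 1 - proj F"
  have "\<langle>Q \<cdot> x, Q \<cdot> x\<rangle> = \<langle>x, Q \<cdot> x\<rangle>"
    using arg_cong[OF coproj_idem[OF assms], of "\<lambda>A. A \<cdot> x"] adj_coproj[of F] cinner_adj_right[of x Q "Q \<cdot> x"]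
    by (simp only: Q_def times_bop.rep_eq)
  then have "norm (Q \<cdot> x) * norm (Q \<cdot> x) = cmod \<langle>x, Q \<cdot> x\<rangle>"
    by (metis cinner_norm norm_of_real abs_power2 power2_eq_square)
  also have "\<dots> \<le> norm x * norm (Q \<cdot> x)" by (rule cinner_bound)
  finally show "norm (Q \<cdot> x) \<le> 1 * norm x"
    by (cases "norm (Q \<cdot> x) = 0") simp_all
qed simp

text \<open>The net is eventually 0 on finite combinations of basis vectors; these are dense, and
  the uniform bound 1 on the norms carries the limit over to every vector.\<close>

lemma coproj_tendsto: "((\<lambda>F. (1 - proj F) \<cdot> x) \<longlongrightarrow> 0) (finite_subsets_at_top E)"
proof (rule tendstoI)
  fix \<epsilon> :: real assume "\<epsilon> > 0"
  have "x \<in> closure (complex_vector.span E)" using onb by (simp add: onb_def)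
  then obtain y where y: "y \<in> complex_vector.span E" "dist y x < \<epsilon>"
    using \<open>\<epsilon> > 0\<close> by (auto simp: closure_approachable)
  have "\<forall>\<^sub>F F in finite_subsets_at_top E. (1 - proj F) \<cdot> y = 0"
    using y(1)
  proof (induction rule: complex_vector.span_induct_alt)
    case base
    then show ?case by (simp add: bop_simps)
  next
    case (step c e y)
    have "\<forall>\<^sub>F F in finite_subsets_at_top E. finite F \<and> {e} \<subseteq> F \<and> F \<subseteq> E"
      using step(1) unfolding eventually_finite_subsets_at_top by (intro exI[of _ "{e}"]) auto
    with step.IH show ?case
    proof eventually_elim
      case (elim F)
      then have "(1 - proj F) \<cdot> e = 0"
        by (simp add: bop_simps proj_basis)
      with elim show ?case by (simp add: bop_add_right bop_apply_scaleC)
    qed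
  qed
  moreover have "\<forall>\<^sub>F F in finite_subsets_at_top E. finite F \<and> F \<subseteq> E"
    by (rule eventually_finite_subsets_at_top_weakI) simp
  ultimately show "\<forall>\<^sub>F F in finite_subsets_at_top E. dist ((1 - proj F) \<cdot> x) 0 < \<epsilon>"
  proof eventually_elim
    case (elim F)
    have "norm ((1 - proj F) \<cdot> x) = norm ((1 - proj F) \<cdot> (x - y))"
      using elim by (simp add: bop_diff_right)
    also have "\<dots> \<le> norm (1 - proj F) * norm (x - y)" by (rule bop_norm_bound)
    also have "\<dots> \<le> 1 * norm (x - y)" using elim by (intro mult_right_mono norm_coproj_le) simp_all
    finally show ?case using y(2) by (simp add: dist_norm norm_minus_commute)
  qed
qed

lemma proj_tendsto: "((\<lambda>F. proj F \<cdot> x) \<longlongrightarrow> x) (finite_subsets_at_top E)"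
  using tendsto_diff[OF tendsto_const[of x] coproj_tendsto[of x]] by (simp add: bop_simps)

lemma basis_eqI:
  assumes "\<And>e. e \<in> E \<Longrightarrow> \<langle>e, x\<rangle> = \<langle>e, y\<rangle>"
  shows "x = y"
proof (rule tendsto_unique)
  have "\<forall>\<^sub>F F in finite_subsets_at_top E. proj F \<cdot> x = proj F \<cdot> y"
    by (rule eventually_finite_subsets_at_top_weakI) (auto simp: proj_apply assms subset_iff intro!: sum.cong)
  then show "((\<lambda>F. proj F \<cdot> x) \<longlongrightarrow> y) (finite_subsets_at_top E)"
    using proj_tendsto[of y] by (simp add: tendsto_cong)
qed (simp_all add: proj_tendsto)

text \<open>Conjugating coefficients reverses inner products already at the level of partial sums.
  Convergence of the series for \<open>conj_vec\<close> and its antiunitarity are both transported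
  from \<open>proj\<close> through this identity.\<close>

lemma cinner_conj_sum:
  assumes "finite F" "F \<subseteq> E" "finite G" "G \<subseteq> E"
  shows "\<langle>\<Sum>e\<in>F. cnj \<langle>e, x\<rangle> *\<^sub>C e, \<Sum>e\<in>G. cnj \<langle>e, y\<rangle> *\<^sub>C e\<rangle> = \<langle>proj G \<cdot> y, proj F \<cdot> x\<rangle>"
proof -
  have expand: "\<langle>\<Sum>e\<in>F. a e *\<^sub>C e, \<Sum>f\<in>G. b f *\<^sub>C f\<rangle> = (\<Sum>e\<in>F. \<Sum>f\<in>G. cnj (a e) * b f * \<langle>e, f\<rangle>)"
    for F G :: "'h set" and a b
    by (simp only: cinner_sum_left) (simp only: cinner_sum_right cinner_scaleC_left cinner_scaleC_right sum_distrib_left mult_ac)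
  have "\<langle>\<Sum>e\<in>F. cnj \<langle>e, x\<rangle> *\<^sub>C e, \<Sum>e\<in>G. cnj \<langle>e, y\<rangle> *\<^sub>C e\<rangle>
      = (\<Sum>e\<in>F. \<Sum>f\<in>G. \<langle>e, x\<rangle> * cnj \<langle>f, y\<rangle> * \<langle>e, f\<rangle>)"
    by (simp add: expand)
  also have "\<dots> = (\<Sum>e\<in>F. \<Sum>f\<in>G. cnj \<langle>f, y\<rangle> * \<langle>e, x\<rangle> * \<langle>f, e\<rangle>)"
    using assms by (intro sum.cong refl) (auto simp: basis_cinner subset_iff)
  also have "\<dots> = \<langle>proj G \<cdot> y, proj F \<cdot> x\<rangle>"
    unfolding proj_apply expand by (rule sum.swap)
  finally show ?thesis .
qed

text \<open>The partial sums have the same mutual distances as the vectors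
  \<open>proj F \<cdot> x\<close>, which converge; so they form a Cauchy filter in a complete
  space.\<close>

lemma conj_vec_has_sum: "((\<lambda>e. cnj \<langle>e, x\<rangle> *\<^sub>C e) has_sum conj_vec E x) E"
proof -
  define S where "S F = (\<Sum>e\<in>F. cnj \<langle>e, x\<rangle> *\<^sub>C e)" for F
  have dist_S: "dist (S F) (S G) = dist (proj F \<cdot> x) (proj G \<cdot> x)"
    if "finite F" "F \<subseteq> E" "finite G" "G \<subseteq> E" for F G
  proof -
    have "\<langle>S F - S G, S F - S G\<rangle> = \<langle>proj F \<cdot> x - proj G \<cdot> x, proj F \<cdot> x - proj G \<cdot> x\<rangle>"
      using that unfolding S_def cinner_diff_left cinner_diff_right by (simp add: cinner_conj_sum)
    then show ?thesis
      by (simp add: cinner_norm dist_norm del: of_real_power)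
  qed
  have "cauchy_filter (filtermap (\<lambda>F. proj F \<cdot> x) (finite_subsets_at_top E))"
    using proj_tendsto[of x] by (auto intro!: nhds_imp_cauchy_filter simp: filterlim_def)
  then have cau: "\<And>e. e > 0 \<Longrightarrow> \<exists>P. eventually P (finite_subsets_at_top E) \<and>
      (\<forall>F G. P F \<and> P G \<longrightarrow> dist (proj F \<cdot> x) (proj G \<cdot> x) < e)"
    by (simp add: cauchy_filter_metric_filtermap)
  have "cauchy_filter (filtermap S (finite_subsets_at_top E))"
    unfolding cauchy_filter_metric_filtermap
  proof (intro allI impI)
    fix e :: real assume "e > 0"
    from cau[OF this] obtain P where P: "eventually P (finite_subsets_at_top E)"
      and "\<forall>F G. P F \<and> P G \<longrightarrow> dist (proj F \<cdot> x) (proj G \<cdot> x) < e"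
      by (elim exE conjE)
    then have P': "\<And>F G. P F \<Longrightarrow> P G \<Longrightarrow> dist (proj F \<cdot> x) (proj G \<cdot> x) < e" by simp
    have "\<forall>\<^sub>F F in finite_subsets_at_top E. P F \<and> finite F \<and> F \<subseteq> E"
      by (intro eventually_conj P eventually_finite_subsets_at_top_weakI)
    then show "\<exists>P. eventually P (finite_subsets_at_top E) \<and> (\<forall>F G. P F \<and> P G \<longrightarrow> dist (S F) (S G) < e)"
      using P' dist_S by (intro exI conjI) auto
  qed
  moreover have "complete (UNIV :: 'h set)"
    by (meson Cauchy_convergent UNIV_I complete_def convergent_def)
  ultimately obtain z where "(S \<longlongrightarrow> z) (finite_subsets_at_top E)"
    using complete_uniform[where S = "UNIV :: 'h set"] by (force simp add: filterlim_def)
  then have "((\<lambda>e. cnj \<langle>e, x\<rangle> *\<^sub>C e) has_sum z) E"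
    unfolding has_sum_def S_def by simp
  then show ?thesis unfolding conj_vec_def by (simp add: infsumI)
qed

lemma cinner_conj_vec: "\<langle>conj_vec E x, conj_vec E y\<rangle> = \<langle>y, x\<rangle>"
proof (rule tendsto_unique)
  let ?S = "\<lambda>x F. \<Sum>e\<in>F. cnj \<langle>e, x\<rangle> *\<^sub>C e"
  let ?F = "finite_subsets_at_top E"
  have S: "(?S x \<longlongrightarrow> conj_vec E x) ?F" for x
    using conj_vec_has_sum[of x] by (simp add: has_sum_def)
  have bil: "bounded_bilinear (\<lambda>x y :: 'h. \<langle>x, y\<rangle>)"
    by (rule bounded_bilinear.intro)
      (auto simp: cinner_simps scaleR_conv_of_real intro!: exI[of _ 1] cinner_bound)
  show "((\<lambda>F. \<langle>?S x F, ?S y F\<rangle>) \<longlongrightarrow> \<langle>conj_vec E x, conj_vec E y\<rangle>) ?F"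
    by (rule bounded_bilinear.tendsto[OF bil S S])
  have "\<forall>\<^sub>F F in ?F. \<langle>?S x F, ?S y F\<rangle> = \<langle>proj F \<cdot> y, proj F \<cdot> x\<rangle>"
    by (rule eventually_finite_subsets_at_top_weakI) (simp add: cinner_conj_sum)
  then show "((\<lambda>F. \<langle>?S x F, ?S y F\<rangle>) \<longlongrightarrow> \<langle>y, x\<rangle>) ?F"
    using bounded_bilinear.tendsto[OF bil proj_tendsto[of y] proj_tendsto[of x]] by (simp add: tendsto_cong)
qed simp

lemma conj_vec_basis: "e \<in> E \<Longrightarrow> conj_vec E e = e"
proof -
  assume e: "e \<in> E"
  have "((\<lambda>f. cnj \<langle>f, e\<rangle> *\<^sub>C f) has_sum (\<Sum>f\<in>{e}. cnj \<langle>f, e\<rangle> *\<^sub>C f)) E"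
    using e by (intro has_sum_finite_neutralI[where B = "{e}"]) (auto simp: basis_cinner)
  then show ?thesis
    using e by (simp add: conj_vec_def infsumI basis_cinner)
qed

lemma cinner_basis_conj_vec: "e \<in> E \<Longrightarrow> \<langle>e, conj_vec E x\<rangle> = cnj \<langle>e, x\<rangle>"
  using cinner_conj_vec[of e x] cinner_commute[of x e] by (simp add: conj_vec_basis)

lemma conj_vec_conj_vec [simp]: "conj_vec E (conj_vec E x) = x"
  by (rule basis_eqI) (simp add: cinner_basis_conj_vec)

lemma conj_vec_add: "conj_vec E (x + y) = conj_vec E x + conj_vec E y"
  by (rule basis_eqI) (simp add: cinner_basis_conj_vec cinner_simps)

lemma conj_vec_scaleC: "conj_vec E (c *\<^sub>C x) = cnj c *\<^sub>C conj_vec E x"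
  by (rule basis_eqI) (simp add: cinner_basis_conj_vec cinner_simps)

lemma norm_conj_vec [simp]: "norm (conj_vec E x) = norm x"
  using cinner_conj_vec[of x x] by (simp add: cinner_norm del: of_real_power)

lemma cinner_conj_vec_left: "\<langle>conj_vec E x, y\<rangle> = \<langle>conj_vec E y, x\<rangle>"
  using cinner_conj_vec[of x "conj_vec E y"] by simp

lemma transposition_apply:
  "transposition E A \<cdot> x = conj_vec E (adj A \<cdot> conj_vec E x)"
  unfolding transposition_def
proof (rule Bop_apply, rule bounded_clinearI[where K = "norm A"])
  show "norm (conj_vec E (adj A \<cdot> conj_vec E x)) \<le> norm A * norm x" for x
    using bop_norm_bound[of "adj A" "conj_vec E x"] by (simp add: norm_adj)
qed (simp_all add: conj_vec_add conj_vec_scaleC bop_simps)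

text \<open>The working form of the transposition: the adjoint and the two conjugations combine so
  that A occurs linearly, in a single matrix element with swapped arguments.\<close>

lemma cinner_transposition:
  "\<langle>x, transposition E A \<cdot> y\<rangle> = \<langle>conj_vec E y, A \<cdot> conj_vec E x\<rangle>"
proof -
  have "\<langle>x, transposition E A \<cdot> y\<rangle> = \<langle>conj_vec E (conj_vec E x), conj_vec E (adj A \<cdot> conj_vec E y)\<rangle>"
    by (simp only: transposition_apply conj_vec_conj_vec)
  also have "\<dots> = \<langle>conj_vec E y, A \<cdot> conj_vec E x\<rangle>"
    by (simp only: cinner_conj_vec cinner_adj_left)
  finally show ?thesis .
qed

lemma transposition_transposition: "transposition E (transposition E A) = A"
  by (rule bop_eq_cinnerI) (simp add: cinner_transposition)

lemma transposition_one: "transposition E 1 = 1"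
  by (rule bop_eq_cinnerI) (simp add: cinner_transposition bop_simps cinner_conj_vec)

text \<open>Conjugation fixes the basis vectors. Hence a map and its composition with the
  transposition agree on the test net, and one normality test serves the positive and the copositive
  part.\<close>

lemma transposition_coproj:
  assumes "F \<subseteq> E"
  shows "transposition E (1 - proj F) = 1 - proj F"
proof (rule bop_eq_cinnerI)
  fix x y
  have "(\<Sum>e\<in>F. \<langle>e, conj_vec E x\<rangle> * \<langle>conj_vec E y, e\<rangle>) = (\<Sum>e\<in>F. \<langle>e, y\<rangle> * \<langle>x, e\<rangle>)"
  proof (intro sum.cong refl)
    fix e assume "e \<in> F"
    then have e: "e \<in> E" using assms by auto
    show "\<langle>e, conj_vec E x\<rangle> * \<langle>conj_vec E y, e\<rangle> = \<langle>e, y\<rangle> * \<langle>x, e\<rangle>"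
      using e cinner_commute[of x e] by (simp add: cinner_basis_conj_vec cinner_conj_vec_left[of y] conj_vec_basis)
  qed
  then show "\<langle>x, transposition E (1 - proj F) \<cdot> y\<rangle> = \<langle>x, (1 - proj F) \<cdot> y\<rangle>"
    by (simp add: cinner_transposition bop_simps proj_apply cinner_simps cinner_sum_right cinner_conj_vec)
qed

lemma bounded_clinear_transposition: "bounded_clinear (transposition E)"
proof (rule bounded_clinearI[where K = 1])
  show "norm (transposition E A) \<le> 1 * norm A" for A
  proof (rule bop_norm_leI)
    show "norm (transposition E A \<cdot> x) \<le> 1 * norm A * norm x" for x
      using bop_norm_bound[of "adj A" "conj_vec E x"] by (simp add: transposition_apply norm_adj)
  qed simp
  show "transposition E (A + B) = transposition E A + transposition E B" for A B
    by (rule bop_eq_cinnerI) (simp add: cinner_transposition bop_simps cinner_simps)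
  show "transposition E (c *\<^sub>C A) = c *\<^sub>C transposition E A" for c A
    by (rule bop_eq_cinnerI) (simp add: cinner_transposition bop_simps cinner_simps)
qed

text \<open>The transposition as an element of B(B(H)), so that composing a map with it is
  multiplication.\<close>

definition transp :: "'h bop bop"
  where "transp = Bop (transposition E)"

lemma transp_apply: "transp \<cdot> A = transposition E A"
  unfolding transp_def by (rule Bop_apply[OF bounded_clinear_transposition])

end

section \<open>Normal functionals and the weak-* topology\<close>

lemma infsum_UNIV_nat:
  fixes f :: "nat \<Rightarrow> 'a::banach"
  assumes "f summable_on UNIV"
  shows "infsum f UNIV = suminf f"
  using has_sum_imp_sums[OF has_sum_infsum[OF assms]] by (simp add: sums_iff)

text \<open>Fubini for a dominated double series enumerated by pairs. It is what merges countably
  many representing sequences of normal functionals into a single one.\<close>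

lemma
  fixes f :: "nat \<Rightarrow> nat \<Rightarrow> 'a::banach"
  assumes bound: "\<And>n k. norm (f n k) \<le> g n k"
    and row: "\<And>n. summable (g n)" and total: "summable (\<lambda>n. suminf (g n))"
  shows summable_prod_decode: "summable (\<lambda>m. norm (case prod_decode m of (n, k) \<Rightarrow> f n k))"
    and suminf_prod_decode: "(\<Sum>m. case prod_decode m of (n, k) \<Rightarrow> f n k) = (\<Sum>n. \<Sum>k. f n k)"
proof -
  define F where "F = (\<lambda>(n, k). f n k)"
  have g: "0 \<le> g n k" for n k using bound[of n k] norm_ge_zero order_trans by blast
  have "suminf (g n) \<ge> 0" for n by (rule suminf_nonneg[OF row g])
  moreover have "infsum (\<lambda>k. g n k) UNIV = suminf (g n)" for n
    by (rule infsum_UNIV_nat) (simp add: summable_on_UNIV_nonneg_real_iff g row)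
  ultimately have "(\<lambda>p. norm ((\<lambda>(n, k). g n k) p)) summable_on Sigma UNIV (\<lambda>_. UNIV)"
    unfolding Infinite_Sum.abs_summable_on_Sigma_iff using g row total
    by (auto simp: summable_on_UNIV_nonneg_real_iff)
  then have absF: "(\<lambda>p. norm (F p)) summable_on UNIV \<times> UNIV"
    by (rule Infinite_Sum.abs_summable_on_comparison_test) (use bound g in \<open>auto simp: F_def\<close>)
  then have F: "F summable_on UNIV \<times> UNIV"
    by (rule abs_summable_summable)
  have absF': "(\<lambda>m. norm (F (prod_decode m))) summable_on UNIV"
    using absF summable_on_reindex_bij_betw[OF bij_prod_decode, of "\<lambda>p. norm (F p)"] by simp
  then show "summable (\<lambda>m. norm (case prod_decode m of (n, k) \<Rightarrow> f n k))"
    using summable_on_imp_summable by (simp add: F_def)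
  have rows: "summable (\<lambda>k. norm (f n k))" for n
    by (rule summable_comparison_test'[OF row[of n], of 0]) (simp add: bound)
  have "(\<Sum>m. F (prod_decode m)) = infsum (\<lambda>m. F (prod_decode m)) UNIV"
    by (rule infsum_UNIV_nat[symmetric]) (rule abs_summable_summable[OF absF'])
  also have "\<dots> = infsum F (UNIV \<times> UNIV)"
    using infsum_reindex_bij_betw[OF bij_prod_decode, of F] by simp
  also have "\<dots> = (\<Sum>\<^sub>\<infinity>n. \<Sum>\<^sub>\<infinity>k. F (n, k))"
    using infsum_Sigma_banach[OF F] by simp
  also have "\<dots> = (\<Sum>\<^sub>\<infinity>n. \<Sum>k. f n k)"
    by (rule infsum_cong) (simp add: F_def infsum_UNIV_nat norm_summable_imp_summable_on rows)
  also have "\<dots> = (\<Sum>n. \<Sum>k. f n k)"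
  proof (rule infsum_UNIV_nat, rule norm_summable_imp_summable_on)
    have "norm (\<Sum>k. f n k) \<le> suminf (g n)" for n
      by (rule order_trans[OF summable_norm[OF rows] suminf_le[OF bound rows row]])
    then show "summable (\<lambda>n. norm (\<Sum>k. f n k))"
      by (intro summable_comparison_test'[OF total, of 0]) simp
  qed
  finally show "(\<Sum>m. case prod_decode m of (n, k) \<Rightarrow> f n k) = (\<Sum>n. \<Sum>k. f n k)"
    by (simp add: F_def)
qed

text \<open>\<open>nuclear c f\<close> bounds the trace norm of \<open>f\<close>: it records a representation of \<open>f\<close> in the predual
  of total mass at most \<open>c\<close>.\<close>

definition nuclear :: "real \<Rightarrow> ('h::chilbert_space bop \<Rightarrow> complex) \<Rightarrow> bool"
  where "nuclear c f \<longleftrightarrow> (\<exists>x y. summable (\<lambda>k. (norm (x k))\<^sup>2 + (norm (y k))\<^sup>2) \<and>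
    (\<Sum>k. (norm (x k))\<^sup>2 + (norm (y k))\<^sup>2) \<le> c \<and> f = (\<lambda>A. \<Sum>k :: nat. \<langle>x k, A \<cdot> y k\<rangle>))"

lemma cinner_bop_bound_squares: "cmod \<langle>x, A \<cdot> y\<rangle> \<le> norm A * ((norm x)\<^sup>2 + (norm y)\<^sup>2)"
proof -
  have "2 * (norm x * norm y) \<le> (norm x)\<^sup>2 + (norm y)\<^sup>2"
    using sum_squares_bound[of "norm x" "norm y"] by (simp add: mult.assoc)
  moreover have "0 \<le> norm x * norm y" by simp
  ultimately have "norm x * norm y \<le> (norm x)\<^sup>2 + (norm y)\<^sup>2" by linarith
  then have "norm A * (norm x * norm y) \<le> norm A * ((norm x)\<^sup>2 + (norm y)\<^sup>2)"
    by (intro mult_left_mono) auto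
  with cinner_bop_bound[of x A y] show ?thesis by (simp add: mult.assoc)
qed

lemma summable_nuclear:
  fixes x y :: "nat \<Rightarrow> 'h::chilbert_space"
  assumes "summable (\<lambda>k. (norm (x k))\<^sup>2 + (norm (y k))\<^sup>2)"
  shows "summable (\<lambda>k. cmod \<langle>x k, A \<cdot> y k\<rangle>)"
  by (rule summable_comparison_test'[OF summable_mult[OF assms, of "norm A"], of 0])
    (simp add: cinner_bop_bound_squares)

lemma summable_squares_add_iff:
  fixes a b :: "nat \<Rightarrow> real"
  shows "summable (\<lambda>k. (a k)\<^sup>2 + (b k)\<^sup>2) \<longleftrightarrow> summable (\<lambda>k. (a k)\<^sup>2) \<and> summable (\<lambda>k. (b k)\<^sup>2)"
proof
  assume *: "summable (\<lambda>k. (a k)\<^sup>2 + (b k)\<^sup>2)"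
  show "summable (\<lambda>k. (a k)\<^sup>2) \<and> summable (\<lambda>k. (b k)\<^sup>2)"
    by (auto intro!: summable_comparison_test'[OF *, of 0])
qed (auto intro: summable_add)

lemma predual_iff_nuclear: "f \<in> predual \<longleftrightarrow> (\<exists>c. nuclear c f)"
  unfolding predual_def nuclear_def summable_squares_add_iff by auto

lemma nuclear_mono: "nuclear c f \<Longrightarrow> c \<le> d \<Longrightarrow> nuclear d f"
  unfolding nuclear_def by (elim exE conjE, intro exI conjI) (assumption, simp_all)

lemma nuclear_norm_le: "nuclear c f \<Longrightarrow> cmod (f A) \<le> norm A * c"
proof -
  assume "nuclear c f"
  then obtain x y where xy: "summable (\<lambda>k. (norm (x k))\<^sup>2 + (norm (y k))\<^sup>2)"
    "(\<Sum>k. (norm (x k))\<^sup>2 + (norm (y k))\<^sup>2) \<le> c" "f = (\<lambda>A. \<Sum>k :: nat. \<langle>x k, A \<cdot> y k\<rangle>)"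
    unfolding nuclear_def by blast
  have "cmod (f A) \<le> (\<Sum>k. cmod \<langle>x k, A \<cdot> y k\<rangle>)"
    unfolding xy(3) by (rule summable_norm[OF summable_nuclear[OF xy(1)]])
  also have "\<dots> \<le> (\<Sum>k. norm A * ((norm (x k))\<^sup>2 + (norm (y k))\<^sup>2))"
    by (rule suminf_le[OF cinner_bop_bound_squares summable_nuclear[OF xy(1)] summable_mult[OF xy(1)]])
  also have "\<dots> = norm A * (\<Sum>k. (norm (x k))\<^sup>2 + (norm (y k))\<^sup>2)"
    by (rule suminf_mult[OF xy(1)])
  also have "\<dots> \<le> norm A * c"
    by (intro mult_left_mono xy(2)) simp
  finally show ?thesis .
qed

lemma nuclear_bounded_linear: "nuclear c f \<Longrightarrow> bounded_linear f"
proof -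
  assume f: "nuclear c f"
  then obtain x y where xy: "summable (\<lambda>k. (norm (x k))\<^sup>2 + (norm (y k))\<^sup>2)"
    "f = (\<lambda>A. \<Sum>k :: nat. \<langle>x k, A \<cdot> y k\<rangle>)"
    unfolding nuclear_def by blast
  have sm: "summable (\<lambda>k. \<langle>x k, A \<cdot> y k\<rangle>)" for A
    by (rule summable_norm_cancel[OF summable_nuclear[OF xy(1)]])
  show ?thesis
  proof (rule bounded_linear_intro)
    show "norm (f A) \<le> norm A * c" for A
      by (rule nuclear_norm_le[OF f])
  qed (simp_all add: xy(2) bop_simps cinner_simps suminf_add[OF sm sm] scaleR_conv_of_real suminf_mult[OF sm])
qed

text \<open>The representing sequences are concatenated along \<open>prod_decode\<close>, so masses
  add. This plays the role of completeness of the trace class, without a trace norm.\<close>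

lemma nuclear_suminf:
  assumes f: "\<And>n. nuclear (c n) (f n)" and c: "summable c"
  shows "nuclear (suminf c) (\<lambda>A. \<Sum>n. f n A)"
proof -
  have "\<forall>n. \<exists>x y. summable (\<lambda>k. (norm (x k))\<^sup>2 + (norm (y k))\<^sup>2) \<and>
    (\<Sum>k. (norm (x k))\<^sup>2 + (norm (y k))\<^sup>2) \<le> c n \<and> f n = (\<lambda>A. \<Sum>k :: nat. \<langle>x k, A \<cdot> y k\<rangle>)"
    using f unfolding nuclear_def ..
  then obtain x y where
    "\<forall>n. summable (\<lambda>k. (norm (x n k))\<^sup>2 + (norm (y n k))\<^sup>2) \<and>
      (\<Sum>k. (norm (x n k))\<^sup>2 + (norm (y n k))\<^sup>2) \<le> c n \<and> f n = (\<lambda>A. \<Sum>k :: nat. \<langle>x n k, A \<cdot> y n k\<rangle>)"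
    unfolding choice_iff by (elim exE)
  then have sm: "\<And>n. summable (\<lambda>k. (norm (x n k))\<^sup>2 + (norm (y n k))\<^sup>2)"
    and le: "\<And>n. (\<Sum>k. (norm (x n k))\<^sup>2 + (norm (y n k))\<^sup>2) \<le> c n"
    and eq: "\<And>n. f n = (\<lambda>A. \<Sum>k :: nat. \<langle>x n k, A \<cdot> y n k\<rangle>)" by simp_all
  define g where "g n k = (norm (x n k))\<^sup>2 + (norm (y n k))\<^sup>2" for n k
  have "g n = (\<lambda>k. (norm (x n k))\<^sup>2 + (norm (y n k))\<^sup>2)" for n by (rule ext) (rule g_def)
  with sm le have rows: "summable (g n)" and le: "suminf (g n) \<le> c n" for n by simp_all
  have nonneg: "0 \<le> suminf (g n)" for n by (rule suminf_nonneg[OF rows]) (simp add: g_def)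
  have total: "summable (\<lambda>n. suminf (g n))"
    by (rule summable_comparison_test'[OF c, of 0]) (use le nonneg in simp)
  define X where "X m = (case prod_decode m of (n, k) \<Rightarrow> x n k)" for m
  define Y where "Y m = (case prod_decode m of (n, k) \<Rightarrow> y n k)" for m
  have g_XY: "(norm (X m))\<^sup>2 + (norm (Y m))\<^sup>2 = (case prod_decode m of (n, k) \<Rightarrow> g n k)" for m
    by (simp add: X_def Y_def g_def split: prod.split)
  have "norm (g n k) \<le> g n k" for n k by (simp add: g_def)
  note g = summable_prod_decode[OF this rows total] suminf_prod_decode[OF this rows total]
  show ?thesis unfolding nuclear_def
  proof (intro exI conjI)
    show "summable (\<lambda>m. (norm (X m))\<^sup>2 + (norm (Y m))\<^sup>2)"
      unfolding g_XY by (rule summable_norm_cancel[OF g(1)])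
    show "(\<Sum>m. (norm (X m))\<^sup>2 + (norm (Y m))\<^sup>2) \<le> suminf c"
      unfolding g_XY g(2) by (rule suminf_le[OF le total c])
    show "(\<lambda>A. \<Sum>n. f n A) = (\<lambda>A. \<Sum>m. \<langle>X m, A \<cdot> Y m\<rangle>)"
    proof
      fix A
      have "(\<Sum>m. case prod_decode m of (n, k) \<Rightarrow> \<langle>x n k, A \<cdot> y n k\<rangle>) = (\<Sum>n. \<Sum>k. \<langle>x n k, A \<cdot> y n k\<rangle>)"
      proof (rule suminf_prod_decode)
        show "cmod \<langle>x n k, A \<cdot> y n k\<rangle> \<le> norm A * g n k" for n k
          unfolding g_def by (rule cinner_bop_bound_squares)
        show "summable (\<lambda>n. \<Sum>k. norm A * g n k)"
          using summable_mult[OF total, of "norm A"] by (simp add: suminf_mult[OF rows])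
      qed (rule summable_mult[OF rows])
      then show "(\<Sum>n. f n A) = (\<Sum>m. \<langle>X m, A \<cdot> Y m\<rangle>)"
        by (simp add: eq X_def Y_def split_def)
    qed
  qed
qed

lemma nuclear_zero: "nuclear 0 (\<lambda>A. 0)"
  unfolding nuclear_def by (intro exI[of _ "\<lambda>_. 0"]) (simp add: bop_simps)

lemma nuclear_add:
  assumes "nuclear c f" "nuclear d g"
  shows "nuclear (c + d) (\<lambda>A. f A + g A)"
proof -
  define F where "F n = (if n = 0 then f else if n = 1 then g else (\<lambda>A. 0))" for n :: nat
  define a where "a n = (if n = 0 then c else if n = 1 then d else 0)" for n :: nat
  have "nuclear (suminf a) (\<lambda>A. \<Sum>n. F n A)"
    by (rule nuclear_suminf)
      (use assms nuclear_zero in \<open>auto simp: F_def a_def split: if_splits intro!: summable_finite[of "{0, 1}"]\<close>)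
  moreover have "suminf a = c + d"
    by (subst suminf_finite[of "{0, 1}"]) (auto simp: a_def)
  moreover have "(\<Sum>n. F n A) = f A + g A" for A
    by (subst suminf_finite[of "{0, 1}"]) (auto simp: F_def)
  ultimately show ?thesis by simp
qed

lemma nuclear_scale:
  assumes f: "nuclear c f" and r: "r \<ge> 0"
  shows "nuclear (r * c) (\<lambda>A. complex_of_real r * f A)"
proof -
  obtain x y where xy: "summable (\<lambda>k. (norm (x k))\<^sup>2 + (norm (y k))\<^sup>2)"
    "(\<Sum>k. (norm (x k))\<^sup>2 + (norm (y k))\<^sup>2) \<le> c" "f = (\<lambda>A. \<Sum>k :: nat. \<langle>x k, A \<cdot> y k\<rangle>)"
    using f unfolding nuclear_def by blast
  \<comment> \<open>The factor is split evenly as sqrt r on both sides, so that the mass scales by r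
    exactly.\<close>
  define X where "X k = sqrt r *\<^sub>R x k" for k
  define Y where "Y k = sqrt r *\<^sub>R y k" for k
  have n: "(norm (X k))\<^sup>2 + (norm (Y k))\<^sup>2 = r * ((norm (x k))\<^sup>2 + (norm (y k))\<^sup>2)" for k
    using r by (simp add: X_def Y_def power_mult_distrib algebra_simps)
  have rr: "complex_of_real (sqrt r) * complex_of_real (sqrt r) = complex_of_real r"
    using r by (simp flip: of_real_mult)
  have "\<langle>X k, A \<cdot> Y k\<rangle> = complex_of_real r * \<langle>x k, A \<cdot> y k\<rangle>" for k A
    by (simp add: X_def Y_def bop_simps cinner_simps rr flip: mult.assoc)
  then have "(\<lambda>A. complex_of_real r * f A) = (\<lambda>A. \<Sum>k. \<langle>X k, A \<cdot> Y k\<rangle>)"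
    by (simp add: xy(3) suminf_mult summable_norm_cancel[OF summable_nuclear[OF xy(1)]])
  moreover have "(\<Sum>k. (norm (X k))\<^sup>2 + (norm (Y k))\<^sup>2) \<le> r * c"
    using xy r by (simp add: n suminf_mult mult_left_mono)
  ultimately show ?thesis
    unfolding nuclear_def by - (rule exI[of _ X], rule exI[of _ Y], simp add: n summable_mult xy(1))
qed

lemma nuclear_cinner: "nuclear ((norm x)\<^sup>2 + (norm y)\<^sup>2) (\<lambda>A. \<langle>x, A \<cdot> y\<rangle>)"
  unfolding nuclear_def
proof (intro exI conjI)
  let ?X = "\<lambda>k :: nat. if k = 0 then x else 0" and ?Y = "\<lambda>k :: nat. if k = 0 then y else 0"
  show "summable (\<lambda>k. (norm (?X k))\<^sup>2 + (norm (?Y k))\<^sup>2)"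
    by (rule summable_finite[of "{0}"]) auto
  show "(\<Sum>k. (norm (?X k))\<^sup>2 + (norm (?Y k))\<^sup>2) \<le> (norm x)\<^sup>2 + (norm y)\<^sup>2"
    by (subst suminf_finite[of "{0}"]) auto
  show "(\<lambda>A. \<langle>x, A \<cdot> y\<rangle>) = (\<lambda>A. \<Sum>k. \<langle>?X k, A \<cdot> ?Y k\<rangle>)"
    by (rule ext, subst suminf_finite[of "{0}"]) auto
qed

text \<open>A normal functional is a series of vector functionals, so it is enough to pull back each
  of those with mass growing at most by the factor \<open>M\<close>.\<close>

lemma nuclear_compose:
  assumes f: "nuclear c f"
    and nuc: "\<And>x y. nuclear (M * ((norm x)\<^sup>2 + (norm y)\<^sup>2)) (\<lambda>A. \<langle>x, T A \<cdot> y\<rangle>)" and M: "M \<ge> 0"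
  shows "nuclear (M * c) (\<lambda>A. f (T A))"
proof -
  obtain x y where xy: "summable (\<lambda>k. (norm (x k))\<^sup>2 + (norm (y k))\<^sup>2)"
    "(\<Sum>k. (norm (x k))\<^sup>2 + (norm (y k))\<^sup>2) \<le> c" "f = (\<lambda>A. \<Sum>k :: nat. \<langle>x k, A \<cdot> y k\<rangle>)"
    using f unfolding nuclear_def by blast
  have "nuclear (\<Sum>k. M * ((norm (x k))\<^sup>2 + (norm (y k))\<^sup>2)) (\<lambda>A. \<Sum>k. \<langle>x k, T A \<cdot> y k\<rangle>)"
    by (rule nuclear_suminf[OF nuc summable_mult[OF xy(1)]])
  moreover have "(\<Sum>k. M * ((norm (x k))\<^sup>2 + (norm (y k))\<^sup>2)) \<le> M * c"
    using xy M by (simp add: suminf_mult mult_left_mono)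
  ultimately show ?thesis
    unfolding xy(3) by (rule nuclear_mono)
qed

section \<open>The weak-* topology described through its functionals\<close>

lemma topspace_weak_star [simp]: "topspace weak_star = UNIV"
proof -
  have "(\<lambda>A. 0) \<in> (predual :: ('a bop \<Rightarrow> complex) set)"
    using nuclear_zero predual_iff_nuclear by blast
  then have "(\<lambda>A :: 'a bop. 0 :: complex) -` UNIV \<in> {f -` U | f U. f \<in> predual \<and> open U}"
    by blast
  then show ?thesis unfolding weak_star_def by auto
qed

lemma limitin_weak_star_iff:
  "limitin weak_star X l F \<longleftrightarrow> (\<forall>f\<in>predual. ((\<lambda>n. f (X n)) \<longlongrightarrow> f l) F)"
proof
  assume lim: "limitin weak_star X l F"
  show "\<forall>f\<in>predual. ((\<lambda>n. f (X n)) \<longlongrightarrow> f l) F"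
  proof (intro ballI topological_tendstoI)
    fix f :: "'a bop \<Rightarrow> complex" and U assume f: "f \<in> predual" "open U" "f l \<in> U"
    then have "openin weak_star (f -` U)"
      unfolding weak_star_def by (intro topology_generated_by_Basis) blast
    with lim f(3) have "\<forall>\<^sub>F n in F. X n \<in> f -` U"
      unfolding limitin_def by (meson vimageI2)
    then show "\<forall>\<^sub>F n in F. f (X n) \<in> U" by simp
  qed
next
  assume lim: "\<forall>f\<in>predual. ((\<lambda>n. f (X n)) \<longlongrightarrow> f l) F"
  have "l \<in> U \<Longrightarrow> \<forall>\<^sub>F n in F. X n \<in> U"
    if "generate_topology_on {f -` U | f U. f \<in> predual \<and> open (U :: complex set)} U" for U
    using that
  proof induction
    case (Int a b)
    then show ?case by (auto intro: eventually_conj)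
  next
    case (UN K)
    then obtain k where k: "k \<in> K" "l \<in> k" by blast
    from UN.IH[OF this] show ?case by eventually_elim (use k in blast)
  next
    case (Basis s)
    then obtain f V where "s = f -` V" "f \<in> predual" "open V" by blast
    with lim Basis show ?case by (auto simp: tendsto_def)
  qed simp
  then show "limitin weak_star X l F"
    by (simp add: limitin_def weak_star_def[symmetric])
      (simp add: weak_star_def openin_topology_generated_by_iff)
qed

lemma continuous_map_weak_star:
  fixes T :: "'h::chilbert_space bop \<Rightarrow> 'h bop"
  assumes "\<And>f. f \<in> predual \<Longrightarrow> (\<lambda>A. f (T A)) \<in> predual"
  shows "continuous_map weak_star weak_star T"
  unfolding weak_star_def continuous_on_generated_topo_iff
proof (intro conjI allI impI)
  fix U :: "'h bop set" assume "U \<in> {f -` U | f U. f \<in> predual \<and> open U}"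
  then obtain f V where U: "U = f -` V" "f \<in> predual" "open V" by blast
  then have "T -` U = (\<lambda>A. f (T A)) -` V" by auto
  then have "openin weak_star (T -` U)"
    unfolding weak_star_def using assms[OF U(2)] U(3) by (intro topology_generated_by_Basis) blast
  then show "openin (topology_generated_by {f -` U | f U. f \<in> predual \<and> open U})
      (T -` U \<inter> topspace (topology_generated_by {f -` U | f U. f \<in> predual \<and> open U}))"
    unfolding weak_star_def[symmetric] by simp
next
  show "T ` topspace (topology_generated_by {f -` U | f U. f \<in> predual \<and> open U})
      \<subseteq> \<Union> {f -` U | f U. f \<in> predual \<and> open U}"
    using topspace_weak_star[where 'a = 'h] unfolding weak_star_def topology_generated_by_topspace by simp
qed

text \<open>On norm-bounded nets, convergence of matrix elements implies weak-* convergence: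
  \<open>B\<close> times the summable squares dominates the series uniformly along the net, and
  Tannery's theorem exchanges limit and sum.\<close>

lemma limitin_weak_starI:
  fixes X :: "'b \<Rightarrow> 'h::chilbert_space bop"
  assumes lim: "\<And>x y. ((\<lambda>n. \<langle>x, X n \<cdot> y\<rangle>) \<longlongrightarrow> \<langle>x, l \<cdot> y\<rangle>) F"
    and bound: "\<forall>\<^sub>F n in F. norm (X n) \<le> B" and F: "F \<noteq> bot"
  shows "limitin weak_star X l F"
  unfolding limitin_weak_star_iff
proof
  fix f :: "'h bop \<Rightarrow> complex" assume "f \<in> predual"
  then obtain c where "nuclear c f" using predual_iff_nuclear by blast
  then obtain x y where xy: "summable (\<lambda>k. (norm (x k))\<^sup>2 + (norm (y k))\<^sup>2)"
    "f = (\<lambda>A. \<Sum>k :: nat. \<langle>x k, A \<cdot> y k\<rangle>)"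
    unfolding nuclear_def by blast
  have "\<forall>\<^sub>F (k, n) in sequentially \<times>\<^sub>F F.
      cmod \<langle>x k, X n \<cdot> y k\<rangle> \<le> B * ((norm (x k))\<^sup>2 + (norm (y k))\<^sup>2)"
  proof -
    have "\<forall>\<^sub>F p in sequentially \<times>\<^sub>F F. norm (X (snd p)) \<le> B"
      using bound by (rule eventually_compose_filterlim[OF _ filterlim_snd])
    then show ?thesis
    proof eventually_elim
      case (elim p)
      have "cmod \<langle>x (fst p), X (snd p) \<cdot> y (fst p)\<rangle>
          \<le> norm (X (snd p)) * ((norm (x (fst p)))\<^sup>2 + (norm (y (fst p)))\<^sup>2)"
        by (rule cinner_bop_bound_squares)
      also have "\<dots> \<le> B * ((norm (x (fst p)))\<^sup>2 + (norm (y (fst p)))\<^sup>2)"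
        using elim by (intro mult_right_mono) simp_all
      finally show ?case by (simp add: split_def)
    qed
  qed
  from tannerys_theorem[OF lim this summable_mult[OF xy(1)] F]
  show "((\<lambda>n. f (X n)) \<longlongrightarrow> f l) F"
    unfolding xy(2) by blast
qed

lemma limitin_weak_star_cinner:
  assumes "limitin weak_star X l F"
  shows "((\<lambda>n. \<langle>x, X n \<cdot> y\<rangle>) \<longlongrightarrow> \<langle>x, l \<cdot> y\<rangle>) F"
proof -
  have "(\<lambda>A. \<langle>x, A \<cdot> y\<rangle>) \<in> predual"
    unfolding predual_iff_nuclear using nuclear_cinner by blast
  with assms show ?thesis unfolding limitin_weak_star_iff by (rule bspec)
qed

lemma weak_star_sums_cinner:
  "weak_star_sums f S \<Longrightarrow> (\<lambda>n. \<langle>x, f n \<cdot> y\<rangle>) sums \<langle>x, S \<cdot> y\<rangle>"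
  unfolding weak_star_sums_def sums_def
  by (drule limitin_weak_star_cinner[of _ _ _ x y]) (simp add: bop_sum_left cinner_sum_right)

lemma weak_star_sumsI:
  assumes "\<And>x y. (\<lambda>n. \<langle>x, f n \<cdot> y\<rangle>) sums \<langle>x, S \<cdot> y\<rangle>" "\<And>N. norm (\<Sum>n<N. f n) \<le> B"
  shows "weak_star_sums f S"
  unfolding weak_star_sums_def using assms
  by (intro limitin_weak_starI[where B = B]) (simp_all add: sums_def bop_sum_left cinner_sum_right)

text \<open>Weak-* continuity of the semigroup will be exploited on this one net.\<close>

lemma (in orthonormal_basis) limitin_coproj: "limitin weak_star (\<lambda>F. 1 - proj F) 0 (finite_subsets_at_top E)"
proof (rule limitin_weak_starI)
  show "\<forall>\<^sub>F F in finite_subsets_at_top E. norm (1 - proj F) \<le> 1"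
    by (rule eventually_finite_subsets_at_top_weakI) (rule norm_coproj_le)
  show "((\<lambda>F. \<langle>x, (1 - proj F) \<cdot> y\<rangle>) \<longlongrightarrow> \<langle>x, 0 \<cdot> y\<rangle>) (finite_subsets_at_top E)" for x y
    using bounded_linear.tendsto[OF bounded_linear_cinner_right coproj_tendsto, of x y]
    by (simp add: zero_bop.rep_eq)
qed simp

section \<open>The exponential of a bounded operator\<close>

lemma norm_bop_power_le: "norm (L ^ n :: 'a::complex_normed_vector bop) \<le> norm L ^ n"
proof (induction n)
  case (Suc n)
  have "norm (L ^ Suc n) \<le> norm L * norm (L ^ n)" by (simp add: norm_mult_ineq)
  also have "\<dots> \<le> norm L * norm L ^ n" by (intro mult_left_mono Suc.IH) simp
  finally show ?case by simp
qed (simp add: norm_one_bop_le)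

lemma bop_scaleR_power: "(r *\<^sub>R L) ^ n = r ^ n *\<^sub>R (L ^ n :: 'a::complex_normed_vector bop)"
  by (induction n) (simp_all add: mult.commute)

lemma norm_bop_exp_term_le: "norm ((L :: 'a::complex_normed_vector bop) ^ n /\<^sub>R fact n) \<le> norm L ^ n /\<^sub>R fact n"
  using norm_bop_power_le[of L n] by (simp add: mult_left_mono)

lemma summable_norm_bop_exp: "summable (\<lambda>n. norm ((L :: 'a::complex_normed_vector bop) ^ n /\<^sub>R fact n))"
  by (rule summable_comparison_test'[OF summable_exp_generic[of "norm L"], of 0])
    (simp only: real_norm_def abs_norm_cancel norm_bop_exp_term_le)

lemma summable_bop_exp: "summable (\<lambda>n. (L :: 'a::{complex_normed_vector, banach} bop) ^ n /\<^sub>R fact n)"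
  by (rule summable_norm_cancel[OF summable_norm_bop_exp])

lemma norm_bop_exp_le: "norm (bop_exp (L :: 'a::{complex_normed_vector, banach} bop)) \<le> exp (norm L)"
proof -
  have "norm (bop_exp L) \<le> (\<Sum>n. norm (L ^ n /\<^sub>R fact n))"
    unfolding bop_exp_def by (rule summable_norm[OF summable_norm_bop_exp])
  also have "\<dots> \<le> (\<Sum>n. norm L ^ n /\<^sub>R fact n)"
    by (rule suminf_le[OF norm_bop_exp_term_le summable_norm_bop_exp summable_exp_generic])
  finally show ?thesis by (simp add: exp_def)
qed

lemma bop_exp_add:
  fixes L :: "'a::{complex_normed_vector, banach} bop"
  shows "bop_exp ((s + t) *\<^sub>R L) = bop_exp (s *\<^sub>R L) * bop_exp (t *\<^sub>R L)"
proof -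
  have "bop_exp (s *\<^sub>R L) * bop_exp (t *\<^sub>R L) =
      (\<Sum>k. \<Sum>i\<le>k. ((s *\<^sub>R L) ^ i /\<^sub>R fact i) * ((t *\<^sub>R L) ^ (k - i) /\<^sub>R fact (k - i)))"
    unfolding bop_exp_def by (rule Cauchy_product[OF summable_norm_bop_exp summable_norm_bop_exp])
  also have "\<dots> = (\<Sum>k. ((s + t) *\<^sub>R L) ^ k /\<^sub>R fact k)"
  proof (rule suminf_cong)
    fix k
    have "(\<Sum>i\<le>k. ((s *\<^sub>R L) ^ i /\<^sub>R fact i) * ((t *\<^sub>R L) ^ (k - i) /\<^sub>R fact (k - i)))
        = (\<Sum>i\<le>k. (s ^ i * t ^ (k - i) / (fact i * fact (k - i))) *\<^sub>R L ^ k)"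
      by (intro sum.cong refl) (simp add: bop_scaleR_power divide_inverse mult_ac flip: power_add)
    also have "\<dots> = (\<Sum>i\<le>k. s ^ i * t ^ (k - i) / (fact i * fact (k - i))) *\<^sub>R L ^ k"
      by (simp add: scaleR_left.sum)
    also have "(\<Sum>i\<le>k. s ^ i * t ^ (k - i) / (fact i * fact (k - i))) = (s + t) ^ k / fact k"
      by (simp add: binomial_ring sum_divide_distrib binomial_fact field_simps)
    finally show "(\<Sum>i\<le>k. ((s *\<^sub>R L) ^ i /\<^sub>R fact i) * ((t *\<^sub>R L) ^ (k - i) /\<^sub>R fact (k - i)))
        = ((s + t) *\<^sub>R L) ^ k /\<^sub>R fact k"
      by (simp add: bop_scaleR_power divide_inverse mult.commute)
  qed
  finally show ?thesis by (simp add: bop_exp_def)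
qed

lemma bop_exp_zero [simp]: "bop_exp 0 = (1 :: 'a::complex_normed_vector bop)"
proof -
  have "0 ^ n = (0 :: 'a bop)" if "n \<noteq> 0" for n using that by (cases n) simp_all
  then show ?thesis unfolding bop_exp_def by (subst suminf_finite[of "{0}"]) simp_all
qed

lemma bop_exp_of_nat:
  fixes L :: "'a::{complex_normed_vector, banach} bop"
  shows "bop_exp ((real k * s) *\<^sub>R L) = bop_exp (s *\<^sub>R L) ^ k"
  by (induction k) (simp_all add: distrib_right bop_exp_add)

lemma norm_bop_exp_remainder:
  fixes L :: "'a::{complex_normed_vector, banach} bop"
  shows "norm (bop_exp L - 1 - L) \<le> (norm L)\<^sup>2 * exp (norm L)"
proof -
  have "bop_exp L - 1 - L = (\<Sum>n. L ^ (n + 2) /\<^sub>R fact (n + 2))"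
    unfolding bop_exp_def
    by (subst suminf_split_initial_segment[OF summable_bop_exp, of _ 2])
      (simp add: numeral_2_eq_2)
  also have "norm \<dots> \<le> (\<Sum>n. norm (L ^ (n + 2) /\<^sub>R fact (n + 2)))"
    by (rule summable_norm) (rule summable_ignore_initial_segment[OF summable_norm_bop_exp])
  also have "\<dots> \<le> (\<Sum>n. (norm L)\<^sup>2 * (norm L ^ n /\<^sub>R fact n))"
  proof (rule suminf_le)
    fix n
    have "norm (L ^ (n + 2) /\<^sub>R fact (n + 2)) \<le> norm L ^ (n + 2) /\<^sub>R fact (n + 2)"
      by (rule norm_bop_exp_term_le)
    also have "\<dots> \<le> norm L ^ (n + 2) /\<^sub>R fact n"
    proof -
      have "(fact n :: real) \<le> fact (n + 2)" by (rule fact_mono) simp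
      then show ?thesis
        by (simp add: divide_inverse[symmetric] divide_left_mono mult.commute[of "inverse _"] frac_le)
    qed
    finally show "norm (L ^ (n + 2) /\<^sub>R fact (n + 2)) \<le> (norm L)\<^sup>2 * (norm L ^ n /\<^sub>R fact n)"
      by (simp add: power2_eq_square mult_ac)
  qed (intro summable_ignore_initial_segment summable_norm_bop_exp summable_mult summable_exp_generic)+
  also have "\<dots> = (norm L)\<^sup>2 * exp (norm L)"
    unfolding exp_def by (rule suminf_mult[OF summable_exp_generic])
  finally show ?thesis .
qed

lemma bop_exp_derivative_zero:
  fixes L :: "'a::{complex_normed_vector, banach} bop"
  shows "((\<lambda>h. (bop_exp (h *\<^sub>R L) - 1) /\<^sub>R h) \<longlongrightarrow> L) (at 0)"
proof -
  have "((\<lambda>h. (bop_exp (h *\<^sub>R L) - 1) /\<^sub>R h - L) \<longlongrightarrow> 0) (at 0)"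
  proof (rule Lim_null_comparison)
    have "norm ((bop_exp (h *\<^sub>R L) - 1) /\<^sub>R h - L) \<le> \<bar>h\<bar> * ((norm L)\<^sup>2 * exp (\<bar>h\<bar> * norm L))"
      if "h \<noteq> 0" for h
    proof -
      have "(bop_exp (h *\<^sub>R L) - 1) /\<^sub>R h - L = (bop_exp (h *\<^sub>R L) - 1 - h *\<^sub>R L) /\<^sub>R h"
        using that by (simp add: scaleR_diff_right)
      also have "norm \<dots> \<le> ((norm (h *\<^sub>R L))\<^sup>2 * exp (norm (h *\<^sub>R L))) / \<bar>h\<bar>"
        using norm_bop_exp_remainder[of "h *\<^sub>R L"] by (simp add: divide_inverse mult.commute mult_left_mono)
      also have "\<dots> = \<bar>h\<bar> * ((norm L)\<^sup>2 * exp (\<bar>h\<bar> * norm L))"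
        using that by (simp add: power2_eq_square)
      finally show ?thesis .
    qed
    then show "\<forall>\<^sub>F h in at 0. norm ((bop_exp (h *\<^sub>R L) - 1) /\<^sub>R h - L) \<le> \<bar>h\<bar> * ((norm L)\<^sup>2 * exp (\<bar>h\<bar> * norm L))"
      by (auto simp: eventually_at_filter)
    have "((\<lambda>h :: real. \<bar>h\<bar> * ((norm L)\<^sup>2 * exp (\<bar>h\<bar> * norm L))) \<longlongrightarrow> \<bar>0\<bar> * ((norm L)\<^sup>2 * exp (\<bar>0\<bar> * norm L))) (at 0)"
      by (intro tendsto_intros)
    then show "((\<lambda>h :: real. \<bar>h\<bar> * ((norm L)\<^sup>2 * exp (\<bar>h\<bar> * norm L))) \<longlongrightarrow> 0) (at 0)" by simp
  qed
  then show ?thesis by (simp add: LIM_zero_iff)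
qed

lemma continuous_bop_exp:
  fixes L :: "'a::{complex_normed_vector, banach} bop"
  shows "continuous_on S (\<lambda>t. bop_exp (t *\<^sub>R L))"
proof (rule continuous_at_imp_continuous_on, rule ballI)
  fix t
  have "((\<lambda>h. h *\<^sub>R ((bop_exp (h *\<^sub>R L) - 1) /\<^sub>R h) + 1) \<longlongrightarrow> 0 *\<^sub>R L + 1) (at 0)"
    by (intro tendsto_intros bop_exp_derivative_zero)
  moreover have "\<forall>\<^sub>F h in at 0. h *\<^sub>R ((bop_exp (h *\<^sub>R L) - 1) /\<^sub>R h) + 1 = bop_exp (h *\<^sub>R L)"
    by (auto simp: eventually_at_filter)
  ultimately have "((\<lambda>h. bop_exp (h *\<^sub>R L)) \<longlongrightarrow> 1) (at 0)"
    by (simp add: tendsto_cong)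
  then have "((\<lambda>h. bop_exp (t *\<^sub>R L) * bop_exp (h *\<^sub>R L)) \<longlongrightarrow> bop_exp (t *\<^sub>R L) * 1) (at 0)"
    by (intro tendsto_intros)
  then show "isCont (\<lambda>t. bop_exp (t *\<^sub>R L)) t"
    by (simp add: isCont_iff bop_exp_add)
qed

text \<open>Telescoping. The exponent of \<open>M\<close> is k instead of k - 1, which costs nothing
  since \<open>M\<close> is at least 1 and keeps the induction free of subtraction.\<close>

lemma norm_power_diff_le:
  fixes X Y :: "'a::complex_normed_vector bop"
  assumes M: "norm X \<le> M" "norm Y \<le> M" "1 \<le> M"
  shows "norm (X ^ k - Y ^ k) \<le> real k * norm (X - Y) * M ^ k"
proof (induction k)
  case (Suc k)
  have "X ^ Suc k - Y ^ Suc k = X * (X ^ k - Y ^ k) + (X - Y) * Y ^ k"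
    by (simp add: algebra_simps)
  also have "norm \<dots> \<le> norm X * norm (X ^ k - Y ^ k) + norm (X - Y) * norm (Y ^ k)"
    by (intro norm_triangle_le add_mono norm_mult_ineq)
  also have "\<dots> \<le> M * (real k * norm (X - Y) * M ^ k) + norm (X - Y) * M ^ k"
    using M Suc.IH order_trans[OF norm_bop_power_le power_mono[OF M(2)], of k]
    by (intro add_mono mult_mono) simp_all
  also have "\<dots> \<le> M * (real k * norm (X - Y) * M ^ k) + norm (X - Y) * M ^ Suc k"
    using M(3) power_increasing[of k "Suc k" M] by (intro add_left_mono mult_left_mono) simp_all
  finally show ?case by (simp add: algebra_simps)
qed simp

text \<open>A step only has to agree with 1 + L / n up to order 1 / n^2. This freedom is what allows
  the steps to be chosen completely positive later on.\<close>

lemma euler_limit_bop_exp: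
  fixes L :: "'a::{complex_normed_vector, banach} bop"
  assumes X: "\<And>n. n > 0 \<Longrightarrow> norm (X n - 1 - (1 / real n) *\<^sub>R L) \<le> C / (real n)\<^sup>2"
  shows "(\<lambda>n. X n ^ n) \<longlonglongrightarrow> bop_exp L"
proof -
  \<comment> \<open>Chosen so that both X n and the exact step have norm at most exp (D / n): for X
    n because 1 + (norm L + C) / n is below that exponential. The n-th powers are then bounded by
    exp D.\<close>
  define D where "D = norm L + C"
  have C: "C \<ge> 0" using order_trans[OF norm_ge_zero X[of 1]] by simp
  define K where "K = (C + (norm L)\<^sup>2 * exp (norm L)) * exp D"
  have "norm (X n ^ n - bop_exp L) \<le> K / real n" if n: "n > 0" for n
  proof -
    define Y where "Y = bop_exp ((1 / real n) *\<^sub>R L)"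
    have Yn: "Y ^ n = bop_exp L"
      using bop_exp_of_nat[of n "1 / real n" L] n by (simp add: Y_def)
    have n1: "1 / real n \<le> 1" using n by simp
    have normY: "norm Y \<le> exp (D / real n)"
    proof -
      have "norm Y \<le> exp (norm ((1 / real n) *\<^sub>R L))" unfolding Y_def by (rule norm_bop_exp_le)
      also have "\<dots> \<le> exp (D / real n)" using n C by (simp add: D_def divide_right_mono)
      finally show ?thesis .
    qed
    have normX: "norm (X n) \<le> exp (D / real n)"
    proof -
      have "X n = (X n - 1 - (1 / real n) *\<^sub>R L) + (1 + (1 / real n) *\<^sub>R L)" by simp
      also have "norm \<dots> \<le> C / (real n)\<^sup>2 + (1 + norm L / real n)"
        by (intro norm_triangle_le add_mono X n norm_one_bop_le) simp
      also have "C / (real n)\<^sup>2 \<le> C / real n"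
        using n C by (intro divide_left_mono) (simp_all add: power2_eq_square)
      also have "C / real n + (1 + norm L / real n) = 1 + D / real n"
        by (simp add: D_def add_divide_distrib)
      also have "\<dots> \<le> exp (D / real n)" by (rule exp_ge_add_one_self)
      finally show ?thesis by simp
    qed
    have XY: "norm (X n - Y) \<le> (C + (norm L)\<^sup>2 * exp (norm L)) / (real n)\<^sup>2"
    proof -
      have "norm (Y - 1 - (1 / real n) *\<^sub>R L) \<le> (norm L / real n)\<^sup>2 * exp (norm L / real n)"
        using norm_bop_exp_remainder[of "(1 / real n) *\<^sub>R L"] by (simp add: Y_def)
      also have "\<dots> \<le> (norm L / real n)\<^sup>2 * exp (norm L)"
        using n by (intro mult_left_mono) (simp_all add: divide_le_eq mult_le_cancel_left1)
      finally have Y: "norm (Y - 1 - (1 / real n) *\<^sub>R L) \<le> (norm L)\<^sup>2 * exp (norm L) / (real n)\<^sup>2"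
        by (simp add: power_divide)
      have "norm (X n - Y) = norm ((X n - 1 - (1 / real n) *\<^sub>R L) - (Y - 1 - (1 / real n) *\<^sub>R L))"
        by simp
      also have "\<dots> \<le> C / (real n)\<^sup>2 + (norm L)\<^sup>2 * exp (norm L) / (real n)\<^sup>2"
        by (intro norm_triangle_le_diff add_mono X n Y)
      finally show ?thesis by (simp add: add_divide_distrib)
    qed
    have "norm (X n ^ n - Y ^ n) \<le> real n * norm (X n - Y) * exp (D / real n) ^ n"
      using C by (intro norm_power_diff_le normX normY) (simp add: D_def)
    also have "exp (D / real n) ^ n = exp D"
      using n by (simp flip: exp_of_nat_mult)
    also have "real n * norm (X n - Y) * exp D \<le> real n * ((C + (norm L)\<^sup>2 * exp (norm L)) / (real n)\<^sup>2) * exp D"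
      by (intro mult_right_mono mult_left_mono XY) simp_all
    also have "\<dots> = K / real n"
      using n by (simp add: K_def power2_eq_square)
    finally show ?thesis by (simp add: Yn)
  qed
  then have "\<forall>\<^sub>F n in sequentially. norm (X n ^ n - bop_exp L) \<le> K / real n"
    by (intro eventually_mono[OF eventually_gt_at_top[of 0]])
  then have "(\<lambda>n. X n ^ n - bop_exp L) \<longlonglongrightarrow> 0"
    by (rule Lim_null_comparison) (rule lim_const_over_n)
  then show ?thesis by (simp add: LIM_zero_iff)
qed

section \<open>Completely positive and completely copositive maps\<close>

lemma mat_positive_scale_add:
  assumes "mat_positive n a" "mat_positive n b" "r \<ge> 0"
  shows "mat_positive n (\<lambda>i j. a i j + r *\<^sub>R b i j)"
  unfolding mat_positive_def
proof
  fix x :: "nat \<Rightarrow> 'a"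
  have "(\<Sum>i<n. \<Sum>j<n. \<langle>x i, (a i j + r *\<^sub>R b i j) \<cdot> x j\<rangle>)
      = (\<Sum>i<n. \<Sum>j<n. \<langle>x i, a i j \<cdot> x j\<rangle>) + complex_of_real r * (\<Sum>i<n. \<Sum>j<n. \<langle>x i, b i j \<cdot> x j\<rangle>)"
    by (simp add: bop_simps cinner_simps sum.distrib sum_distrib_left)
  then show "(\<Sum>i<n. \<Sum>j<n. \<langle>x i, (a i j + r *\<^sub>R b i j) \<cdot> x j\<rangle>) \<in> \<real>\<^sub>\<ge>\<^sub>0"
    using assms unfolding mat_positive_def
    by (simp add: nonneg_Reals_add_I nonneg_Reals_mult_I)
qed

lemma CP_scale_add: "S \<in> CP \<Longrightarrow> T \<in> CP \<Longrightarrow> r \<ge> 0 \<Longrightarrow> S + r *\<^sub>R T \<in> CP"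
  unfolding CP_def by (simp add: bop_simps mat_positive_scale_add)

lemma coCP_scale_add: "S \<in> coCP \<Longrightarrow> T \<in> coCP \<Longrightarrow> r \<ge> 0 \<Longrightarrow> S + r *\<^sub>R T \<in> coCP"
  unfolding coCP_def by (simp add: bop_simps mat_positive_scale_add)

lemma CP_add: "S \<in> CP \<Longrightarrow> T \<in> CP \<Longrightarrow> S + T \<in> CP"
  using CP_scale_add[of S T 1] by simp

lemma coCP_add: "S \<in> coCP \<Longrightarrow> T \<in> coCP \<Longrightarrow> S + T \<in> coCP"
  using coCP_scale_add[of S T 1] by simp

lemma CP_one: "1 \<in> CP"
  unfolding CP_def by (simp add: bop_simps)

lemma coCP_zero: "0 \<in> coCP"
  unfolding coCP_def mat_positive_def by (simp add: bop_simps)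

lemma coCP_scale: "T \<in> coCP \<Longrightarrow> r \<ge> 0 \<Longrightarrow> r *\<^sub>R T \<in> coCP"
  using coCP_scale_add[OF coCP_zero, of T r] by simp

text \<open>Composition is graded like even and odd: every copositive factor swaps the matrix
  indices, and two swaps cancel. This and the next three lemmas are the multiplication
  table.\<close>

lemma CP_mult: "S \<in> CP \<Longrightarrow> T \<in> CP \<Longrightarrow> S * T \<in> CP"
  unfolding CP_def by (simp add: bop_simps)

lemma coCP_mult: "S \<in> coCP \<Longrightarrow> T \<in> coCP \<Longrightarrow> S * T \<in> CP"
  unfolding CP_def coCP_def by (simp add: bop_simps)

lemma CP_coCP_mult: "S \<in> CP \<Longrightarrow> T \<in> coCP \<Longrightarrow> S * T \<in> coCP"
  unfolding CP_def coCP_def by (simp add: bop_simps)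

lemma coCP_CP_mult: "S \<in> coCP \<Longrightarrow> T \<in> CP \<Longrightarrow> S * T \<in> coCP"
  unfolding CP_def coCP_def by (simp add: bop_simps)

text \<open>Stated for one fixed matrix, so that it serves both index orders.\<close>

lemma mat_positive_lim:
  fixes S :: "'h::chilbert_space bop bop"
  assumes pos: "\<forall>\<^sub>F k in F. mat_positive n (\<lambda>i j. T k \<cdot> a i j)"
    and lim: "(T \<longlongrightarrow> S) F" and F: "F \<noteq> bot"
  shows "mat_positive n (\<lambda>i j. S \<cdot> a i j)"
  unfolding mat_positive_def
proof
  fix x :: "nat \<Rightarrow> 'h"
  show "(\<Sum>i<n. \<Sum>j<n. \<langle>x i, (S \<cdot> a i j) \<cdot> x j\<rangle>) \<in> \<real>\<^sub>\<ge>\<^sub>0"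
  proof (rule Lim_in_closed_set[OF closed_nonneg_Reals_complex _ F])
    show "\<forall>\<^sub>F k in F. (\<Sum>i<n. \<Sum>j<n. \<langle>x i, (T k \<cdot> a i j) \<cdot> x j\<rangle>) \<in> \<real>\<^sub>\<ge>\<^sub>0"
      using pos by eventually_elim (simp add: mat_positive_def)
    show "((\<lambda>k. \<Sum>i<n. \<Sum>j<n. \<langle>x i, (T k \<cdot> a i j) \<cdot> x j\<rangle>) \<longlongrightarrow> (\<Sum>i<n. \<Sum>j<n. \<langle>x i, (S \<cdot> a i j) \<cdot> x j\<rangle>)) F"
      by (intro tendsto_sum bounded_linear.tendsto[OF bounded_linear_cinner_bop]
          bounded_linear.tendsto[OF bounded_linear_bop_eval] lim)
  qed
qed

lemma CP_lim:
  assumes T: "\<forall>\<^sub>F k in F. T k \<in> CP" and lim: "(T \<longlongrightarrow> S) F" "F \<noteq> bot"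
  shows "S \<in> CP"
proof -
  have "mat_positive n (\<lambda>i j. S \<cdot> a i j)" if "mat_positive n a" for n a
    by (rule mat_positive_lim[OF _ lim]) (use T that in \<open>auto elim: eventually_mono simp: CP_def\<close>)
  then show ?thesis by (simp add: CP_def)
qed

lemma coCP_lim:
  assumes T: "\<forall>\<^sub>F k in F. T k \<in> coCP" and lim: "(T \<longlongrightarrow> S) F" "F \<noteq> bot"
  shows "S \<in> coCP"
proof -
  have "mat_positive n (\<lambda>i j. S \<cdot> a j i)" if "mat_positive n a" for n a
    by (rule mat_positive_lim[OF _ lim]) (use T that in \<open>auto elim: eventually_mono simp: coCP_def\<close>)
  then show ?thesis by (simp add: coCP_def)
qed

text \<open>Expanding \<open>(P + Q) ^ k\<close>, the words with evenly many factors \<open>Q\<close> are completely positive and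
  the others completely copositive; replacing \<open>Q\<close> by \<open>- Q\<close> separates the two parts.\<close>

lemma CP_coCP_power:
  assumes "P \<in> CP" "Q \<in> coCP"
  shows "\<exists>A\<in>CP. \<exists>B\<in>coCP. (P + Q) ^ k = A + B \<and> (P - Q) ^ k = A - B"
proof (induction k)
  case 0
  show ?case by (intro bexI[OF _ CP_one] bexI[OF _ coCP_zero]) simp
next
  case (Suc k)
  then obtain A B where AB: "A \<in> CP" "B \<in> coCP" "(P + Q) ^ k = A + B" "(P - Q) ^ k = A - B" by blast
  show ?case
  proof (intro bexI conjI)
    show "(P + Q) ^ Suc k = (P * A + Q * B) + (P * B + Q * A)"
      by (simp add: AB algebra_simps)
    show "(P - Q) ^ Suc k = (P * A + Q * B) - (P * B + Q * A)"
      by (simp add: AB algebra_simps)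
    show "P * A + Q * B \<in> CP"
      using assms AB by (intro CP_add CP_mult[of P] coCP_mult[of Q])
    show "P * B + Q * A \<in> coCP"
      using assms AB by (intro coCP_add CP_coCP_mult[of P] coCP_CP_mult[of Q])
  qed
qed

text \<open>\<open>R\<close> is a second-order correction: the first-order step 1 + s G need not be
  completely positive, but the corrected one is assumed to be, and the Euler limit does not see the
  correction.\<close>

lemma decomposable_bop_exp:
  fixes G Q R :: "'h::chilbert_space bop bop"
  assumes P: "\<And>s. s \<ge> 0 \<Longrightarrow> 1 + s *\<^sub>R G + s\<^sup>2 *\<^sub>R R \<in> CP" and Q: "Q \<in> coCP" and t: "t \<ge> 0"
  shows "decomposable (bop_exp (t *\<^sub>R (G + Q)))"
proof -
  define P where "P s = 1 + s *\<^sub>R G + s\<^sup>2 *\<^sub>R R" for s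
  have lim: "(\<lambda>n. (P (t / real n) + (t / real n) *\<^sub>R N) ^ n) \<longlonglongrightarrow> bop_exp (t *\<^sub>R (G + N))" for N
  proof (rule euler_limit_bop_exp)
    fix n :: nat assume "n > 0"
    have "P (t / real n) + (t / real n) *\<^sub>R N - 1 - (1 / real n) *\<^sub>R (t *\<^sub>R (G + N)) = (t / real n)\<^sup>2 *\<^sub>R R"
      by (simp add: P_def algebra_simps)
    then show "norm (P (t / real n) + (t / real n) *\<^sub>R N - 1 - (1 / real n) *\<^sub>R (t *\<^sub>R (G + N))) \<le> (t\<^sup>2 * norm R) / (real n)\<^sup>2"
      by (simp add: power_divide)
  qed
  define X where "X n = (P (t / real n) + (t / real n) *\<^sub>R Q) ^ n" for n
  define Y where "Y n = (P (t / real n) - (t / real n) *\<^sub>R Q) ^ n" for n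
  define S T where "S = bop_exp (t *\<^sub>R (G + Q))" and "T = bop_exp (t *\<^sub>R (G + - Q))"
  have X: "X \<longlonglongrightarrow> S" unfolding X_def S_def by (rule lim)
  have Y: "Y \<longlonglongrightarrow> T" unfolding Y_def T_def using lim[of "- Q"] by simp
  \<comment> \<open>This includes n = 0, where \<open>t / real n\<close> is 0 by convention and both
    powers are 1.\<close>
  have half: "(1/2) *\<^sub>R (X n + Y n) \<in> CP \<and> (1/2) *\<^sub>R (X n - Y n) \<in> coCP" for n
  proof -
    have "P (t / real n) \<in> CP" unfolding P_def using t by (intro P) simp
    moreover have "(t / real n) *\<^sub>R Q \<in> coCP" using t Q by (intro coCP_scale) simp_all
    ultimately obtain A B where AB: "A \<in> CP" "B \<in> coCP" "X n = A + B" "Y n = A - B"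
      using CP_coCP_power[of "P (t / real n)" "(t / real n) *\<^sub>R Q" n] unfolding X_def Y_def by blast
    then have "(1/2) *\<^sub>R (X n + Y n) = A" "(1/2) *\<^sub>R (X n - Y n) = B"
      by (simp_all flip: scaleR_2)
    with AB show ?thesis by simp
  qed
  have "(1/2) *\<^sub>R (S + T) \<in> CP"
    by (rule CP_lim[OF _ tendsto_scaleR[OF tendsto_const tendsto_add[OF X Y]]]) (use half in simp_all)
  moreover have "(1/2) *\<^sub>R (S - T) \<in> coCP"
    by (rule coCP_lim[OF _ tendsto_scaleR[OF tendsto_const tendsto_diff[OF X Y]]]) (use half in simp_all)
  moreover have "S = (1/2) *\<^sub>R (S + T) + (1/2) *\<^sub>R (S - T)"
    by (simp add: scaleR_add_right[symmetric] flip: scaleR_2)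
  ultimately show ?thesis unfolding decomposable_def S_def[symmetric] by blast
qed

section \<open>Kraus decompositions\<close>

definition sandwich :: "'h::chilbert_space bop \<Rightarrow> 'h bop \<Rightarrow> 'h bop bop"
  where "sandwich B C = Bop (\<lambda>A. B * A * C)"

lemma sandwich_apply: "sandwich B C \<cdot> A = B * A * C"
  unfolding sandwich_def
proof (rule Bop_apply, rule bounded_clinearI[where K = "norm B * norm C"])
  show "norm (B * A * C) \<le> norm B * norm C * norm A" for A
  proof -
    have "norm (B * A * C) \<le> norm (B * A) * norm C" by (rule norm_mult_ineq)
    also have "\<dots> \<le> norm B * norm A * norm C" by (intro mult_right_mono norm_mult_ineq) simp
    finally show ?thesis by (simp add: mult_ac)
  qed
qed (simp_all add: algebra_simps bop_scaleC_mult_left bop_scaleC_mult_right)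

text \<open>Kraus form \<open>\<Phi> \<cdot> A\<close> = \<Sum> \<open>adj (V n) * A * V n\<close>,
  required only for matrix elements. That keeps limits numerical; weak-* convergence of the operator
  series is recovered in \<open>is_kraus_weak_star_sums\<close>.\<close>

definition is_kraus :: "(nat \<Rightarrow> 'h::chilbert_space bop) \<Rightarrow> 'h bop bop \<Rightarrow> bool"
  where "is_kraus V \<Phi> \<longleftrightarrow> (\<forall>A x y. (\<lambda>n. \<langle>V n \<cdot> x, A \<cdot> V n \<cdot> y\<rangle>) sums \<langle>x, (\<Phi> \<cdot> A) \<cdot> y\<rangle>)"

lemma is_kraus_sums: "is_kraus V \<Phi> \<Longrightarrow> (\<lambda>n. \<langle>V n \<cdot> x, A \<cdot> V n \<cdot> y\<rangle>) sums \<langle>x, (\<Phi> \<cdot> A) \<cdot> y\<rangle>"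
  by (simp add: is_kraus_def)

lemma is_kraus_norm_sums:
  assumes "is_kraus V \<Phi>"
  shows "(\<lambda>n. (norm (V n \<cdot> x))\<^sup>2) sums Re \<langle>x, (\<Phi> \<cdot> 1) \<cdot> x\<rangle>"
  using sums_Re[OF is_kraus_sums[OF assms, of x 1 x]]
  by (simp add: bop_simps cinner_norm del: of_real_power)

lemma is_kraus_summable: "is_kraus V \<Phi> \<Longrightarrow> summable (\<lambda>n. (norm (V n \<cdot> x))\<^sup>2)"
  using is_kraus_norm_sums sums_summable by blast

lemma is_kraus_suminf_le:
  assumes "is_kraus V \<Phi>"
  shows "(\<Sum>n. (norm (V n \<cdot> x))\<^sup>2) \<le> norm \<Phi> * (norm x)\<^sup>2"
proof -
  have "(\<Sum>n. (norm (V n \<cdot> x))\<^sup>2) = Re \<langle>x, (\<Phi> \<cdot> 1) \<cdot> x\<rangle>"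
    using is_kraus_norm_sums[OF assms] by (simp add: sums_iff)
  also have "\<dots> \<le> norm (\<Phi> \<cdot> 1) * norm x * norm x"
    by (rule order_trans[OF complex_Re_le_cmod cinner_bop_bound])
  also have "norm (\<Phi> \<cdot> 1) \<le> norm \<Phi> * 1"
    by (rule order_trans[OF bop_norm_bound mult_left_mono[OF norm_one_bop_le]]) simp
  finally show ?thesis by (simp add: mult_right_mono power2_eq_square mult.assoc)
qed

lemma is_kraus_sum_le:
  assumes "is_kraus V \<Phi>"
  shows "(\<Sum>n<N. (norm (V n \<cdot> x))\<^sup>2) \<le> norm \<Phi> * (norm x)\<^sup>2"
  using sum_le_suminf[OF is_kraus_summable[OF assms, of x], of "{..<N}"] is_kraus_suminf_le[OF assms, of x]
  by simp

text \<open>Each term of the series is the positive form of the given matrix, evaluated at the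
  vectors \<open>V m \<cdot> x i\<close>; nonnegativity passes to the limit.\<close>

lemma is_kraus_CP:
  assumes "is_kraus V \<Phi>"
  shows "\<Phi> \<in> CP"
  unfolding CP_def
proof (rule CollectI, intro allI impI)
  fix n and a :: "nat \<Rightarrow> nat \<Rightarrow> 'a bop" assume a: "mat_positive n a"
  show "mat_positive n (\<lambda>i j. \<Phi> \<cdot> a i j)"
    unfolding mat_positive_def
  proof
    fix x :: "nat \<Rightarrow> 'a"
    have "(\<lambda>m. \<Sum>i<n. \<Sum>j<n. \<langle>V m \<cdot> x i, a i j \<cdot> V m \<cdot> x j\<rangle>) sums (\<Sum>i<n. \<Sum>j<n. \<langle>x i, (\<Phi> \<cdot> a i j) \<cdot> x j\<rangle>)"
      by (intro sums_sum is_kraus_sums[OF assms])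
    then have lim: "(\<lambda>N. \<Sum>m<N. \<Sum>i<n. \<Sum>j<n. \<langle>V m \<cdot> x i, a i j \<cdot> V m \<cdot> x j\<rangle>)
        \<longlonglongrightarrow> (\<Sum>i<n. \<Sum>j<n. \<langle>x i, (\<Phi> \<cdot> a i j) \<cdot> x j\<rangle>)"
      by (simp add: sums_def)
    have "(\<Sum>m<N. \<Sum>i<n. \<Sum>j<n. \<langle>V m \<cdot> x i, a i j \<cdot> V m \<cdot> x j\<rangle>) \<in> \<real>\<^sub>\<ge>\<^sub>0" for N
      using a unfolding mat_positive_def by (induction N) (simp_all add: nonneg_Reals_add_I)
    then show "(\<Sum>i<n. \<Sum>j<n. \<langle>x i, (\<Phi> \<cdot> a i j) \<cdot> x j\<rangle>) \<in> \<real>\<^sub>\<ge>\<^sub>0"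
      by (intro Lim_in_closed_set[OF closed_nonneg_Reals_complex _ _ lim]) simp_all
  qed
qed

lemma sandwich_CP: "sandwich B (adj B) \<in> CP"
proof (rule is_kraus_CP)
  show "is_kraus (\<lambda>n. if n = 0 then adj B else 0) (sandwich B (adj B))"
    unfolding is_kraus_def
  proof (intro allI)
    fix A x y
    have "(\<lambda>n. \<langle>(if n = 0 then adj B else 0) \<cdot> x, A \<cdot> (if n = 0 then adj B else 0) \<cdot> y\<rangle>)
        sums (\<Sum>n\<in>{0::nat}. \<langle>(if n = 0 then adj B else 0) \<cdot> x, A \<cdot> (if n = 0 then adj B else 0) \<cdot> y\<rangle>)"
      by (rule sums_finite) (simp_all add: zero_bop.rep_eq)
    then show "(\<lambda>n :: nat. \<langle>(if n = 0 then adj B else 0) \<cdot> x, A \<cdot> (if n = 0 then adj B else 0) \<cdot> y\<rangle>)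
        sums \<langle>x, (sandwich B (adj B) \<cdot> A) \<cdot> y\<rangle>"
      by (simp add: sandwich_apply times_bop.rep_eq cinner_adj_left)
  qed
qed

lemma sum_norm_mult_le:
  fixes V :: "nat \<Rightarrow> 'h::chilbert_space bop"
  assumes C: "\<And>x N. (\<Sum>n<N. (norm (V n \<cdot> x))\<^sup>2) \<le> C * (norm x)\<^sup>2" "C \<ge> 0"
  shows "(\<Sum>n<N. norm (V n \<cdot> x) * norm (V n \<cdot> y)) \<le> C * norm x * norm y"
proof -
  have "(\<Sum>n<N. norm (V n \<cdot> x) * norm (V n \<cdot> y))
      \<le> L2_set (\<lambda>n. norm (V n \<cdot> x)) {..<N} * L2_set (\<lambda>n. norm (V n \<cdot> y)) {..<N}"
    using L2_set_mult_ineq[of "\<lambda>n. norm (V n \<cdot> x)" "\<lambda>n. norm (V n \<cdot> y)" "{..<N}"] by simp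
  also have "\<dots> \<le> (sqrt C * norm x) * (sqrt C * norm y)"
  proof -
    have "L2_set (\<lambda>n. norm (V n \<cdot> z)) {..<N} \<le> sqrt C * norm z" for z
      unfolding L2_set_def using real_sqrt_le_mono[OF C(1), of z N] by (simp add: real_sqrt_mult)
    then show ?thesis by (intro mult_mono) (simp_all add: C(2))
  qed
  also have "\<dots> = C * norm x * norm y" using C(2) by (simp add: mult_ac)
  finally show ?thesis .
qed

text \<open>The hypothesis says that x \<mapsto> (\<open>V n \<cdot> x\<close>) is bounded into the
  Hilbert sum of copies of H. Matrix elements therefore converge absolutely, with sum at most norm A
  * C * norm x * norm y, and define a bounded form for every A.\<close>

lemma is_kraus_exists:
  fixes V :: "nat \<Rightarrow> 'h::chilbert_space bop"
  assumes C: "\<And>x N. (\<Sum>n<N. (norm (V n \<cdot> x))\<^sup>2) \<le> C * (norm x)\<^sup>2" "C \<ge> 0"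
  obtains \<Phi> where "is_kraus V \<Phi>"
proof -
  have bound: "cmod \<langle>V n \<cdot> x, A \<cdot> V n \<cdot> y\<rangle> \<le> norm A * (norm (V n \<cdot> x) * norm (V n \<cdot> y))" for n A x y
    using cinner_bop_bound[of "V n \<cdot> x" A "V n \<cdot> y"] by (simp add: mult.assoc)
  have sm: "summable (\<lambda>n. norm (V n \<cdot> x) * norm (V n \<cdot> y))" for x y
  proof (rule bounded_imp_summable)
    show "(\<Sum>n\<le>N. norm (V n \<cdot> x) * norm (V n \<cdot> y)) \<le> C * norm x * norm y" for N
      unfolding lessThan_Suc_atMost[symmetric] by (rule sum_norm_mult_le[OF C])
  qed simp
  have absum: "summable (\<lambda>n. cmod \<langle>V n \<cdot> x, A \<cdot> V n \<cdot> y\<rangle>)" for A x y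
    by (rule summable_comparison_test'[OF summable_mult[OF sm, of "norm A" x y], of 0]) (simp add: bound)
  then have summ: "summable (\<lambda>n. \<langle>V n \<cdot> x, A \<cdot> V n \<cdot> y\<rangle>)" for A x y
    by (rule summable_norm_cancel)
  have B: "cmod (\<Sum>n. \<langle>V n \<cdot> x, A \<cdot> V n \<cdot> y\<rangle>) \<le> norm A * C * norm x * norm y" for A x y
  proof -
    have "cmod (\<Sum>n. \<langle>V n \<cdot> x, A \<cdot> V n \<cdot> y\<rangle>) \<le> (\<Sum>n. norm A * (norm (V n \<cdot> x) * norm (V n \<cdot> y)))"
      by (rule order_trans[OF summable_norm[OF absum] suminf_le[OF bound absum summable_mult[OF sm]]])
    also have "\<dots> = norm A * (\<Sum>n. norm (V n \<cdot> x) * norm (V n \<cdot> y))" by (rule suminf_mult[OF sm])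
    also have "\<dots> \<le> norm A * (C * norm x * norm y)"
      by (intro mult_left_mono suminf_le_const[OF sm] sum_norm_mult_le[OF C]) simp
    finally show ?thesis by (simp add: mult_ac)
  qed
  have "\<exists>T. (\<forall>x y. \<langle>x, T \<cdot> y\<rangle> = (\<Sum>n. \<langle>V n \<cdot> x, A \<cdot> V n \<cdot> y\<rangle>)) \<and> norm T \<le> norm A * C" for A
  proof -
    obtain T where "\<And>x y. \<langle>x, T \<cdot> y\<rangle> = (\<Sum>n. \<langle>V n \<cdot> x, A \<cdot> V n \<cdot> y\<rangle>)" "norm T \<le> norm A * C"
    proof (rule bounded_form_bop[of "\<lambda>x y. \<Sum>n. \<langle>V n \<cdot> x, A \<cdot> V n \<cdot> y\<rangle>" "norm A * C"])
      show "0 \<le> norm A * C" using C(2) by simp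
    qed (use B in \<open>auto simp: bop_simps cinner_simps suminf_add[OF summ summ] suminf_mult[OF summ]\<close>)
    then show ?thesis by blast
  qed
  then have "\<forall>A. \<exists>T. (\<forall>x y. \<langle>x, T \<cdot> y\<rangle> = (\<Sum>n. \<langle>V n \<cdot> x, A \<cdot> V n \<cdot> y\<rangle>)) \<and> norm T \<le> norm A * C" ..
  then obtain T where "\<forall>A. (\<forall>x y. \<langle>x, T A \<cdot> y\<rangle> = (\<Sum>n. \<langle>V n \<cdot> x, A \<cdot> V n \<cdot> y\<rangle>)) \<and> norm (T A) \<le> norm A * C"
    unfolding choice_iff by (elim exE)
  then have T: "\<And>A x y. \<langle>x, T A \<cdot> y\<rangle> = (\<Sum>n. \<langle>V n \<cdot> x, A \<cdot> V n \<cdot> y\<rangle>)"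
    and norm_T: "\<And>A. norm (T A) \<le> norm A * C" by blast+
  have "bounded_clinear T"
  proof (rule bounded_clinearI[where K = C])
    show "T (A + B) = T A + T B" for A B
      by (rule bop_eq_cinnerI) (simp add: T bop_simps cinner_simps suminf_add[OF summ summ])
    show "T (c *\<^sub>C A) = c *\<^sub>C T A" for c A
      by (rule bop_eq_cinnerI) (simp add: T bop_simps cinner_simps suminf_mult[OF summ])
    show "norm (T A) \<le> C * norm A" for A using norm_T[of A] by (simp add: mult.commute)
  qed
  then have "is_kraus V (Bop T)"
    using summ by (simp add: is_kraus_def Bop_apply T summable_sums)
  then show ?thesis by (rule that)
qed

text \<open>The partial sums are bounded by norm A * norm \<Phi> uniformly in N, so convergence of
  matrix elements is enough.\<close>

lemma is_kraus_weak_star_sums: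
  assumes "is_kraus V \<Phi>"
  shows "weak_star_sums (\<lambda>n. adj (V n) * A * V n) (\<Phi> \<cdot> A)"
proof (rule weak_star_sumsI)
  show "(\<lambda>n. \<langle>x, (adj (V n) * A * V n) \<cdot> y\<rangle>) sums \<langle>x, (\<Phi> \<cdot> A) \<cdot> y\<rangle>" for x y
    using is_kraus_sums[OF assms] by (simp add: times_bop.rep_eq cinner_adj_right)
  show "norm (\<Sum>n<N. adj (V n) * A * V n) \<le> norm A * norm \<Phi>" for N
  proof (rule bop_norm_leI, simp, rule norm_le_cinner)
    fix x y
    have "cmod \<langle>y, (\<Sum>n<N. adj (V n) * A * V n) \<cdot> x\<rangle> \<le> (\<Sum>n<N. cmod \<langle>V n \<cdot> y, A \<cdot> V n \<cdot> x\<rangle>)"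
      by (simp add: bop_sum_left cinner_sum_right times_bop.rep_eq cinner_adj_right norm_sum)
    also have "\<dots> \<le> (\<Sum>n<N. norm A * (norm (V n \<cdot> y) * norm (V n \<cdot> x)))"
      by (intro sum_mono) (use cinner_bop_bound in \<open>simp add: mult.assoc[symmetric]\<close>)
    also have "\<dots> \<le> norm A * (norm \<Phi> * norm y * norm x)"
      unfolding sum_distrib_left[symmetric]
      by (intro mult_left_mono sum_norm_mult_le is_kraus_sum_le[OF assms]) simp_all
    finally show "cmod \<langle>y, (\<Sum>n<N. adj (V n) * A * V n) \<cdot> x\<rangle> \<le> norm A * norm \<Phi> * norm x * norm y"
      by (simp add: mult_ac)
  qed simp
qed

section \<open>Positivity on Gram matrices and its Cauchy-Schwarz inequality\<close>

text \<open>Complete positivity tested on the matrices \<open>adj (a i) * a j\<close>; this is what conditional complete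
  positivity of a generator yields directly.\<close>

definition kernel_positive :: "'h::chilbert_space bop bop \<Rightarrow> bool"
  where "kernel_positive \<Phi> \<longleftrightarrow> (\<forall>(n :: nat) a x.
    (\<Sum>i<n. \<Sum>j<n. \<langle>x i, (\<Phi> \<cdot> (adj (a i) * a j)) \<cdot> x j\<rangle>) \<in> \<real>\<^sub>\<ge>\<^sub>0)"

text \<open>For the identity map the kernel form is a squared norm. In particular it vanishes
  exactly on the families with \<Sum> \<open>a j \<cdot> x j\<close> = 0, the ones on which a
  generator is conditionally positive.\<close>

lemma cinner_gram_sum:
  "(\<Sum>i<n. \<Sum>j<n. \<langle>x i, (adj (a i) * a j) \<cdot> x j\<rangle>) = complex_of_real ((norm (\<Sum>j<n. a j \<cdot> x j))\<^sup>2)"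
  unfolding cinner_norm[symmetric]
  by (simp only: cinner_sum_left) (simp only: cinner_sum_right times_bop.rep_eq cinner_adj_right)

lemma mat_positive_gram: "mat_positive n (\<lambda>i j. adj (a i) * a j)"
  unfolding mat_positive_def cinner_gram_sum by (simp del: of_real_power)

lemma CP_kernel_positive:
  assumes "\<Phi> \<in> CP"
  shows "kernel_positive \<Phi>"
  unfolding kernel_positive_def
proof (intro allI)
  fix n and a :: "nat \<Rightarrow> 'a bop" and x :: "nat \<Rightarrow> 'a"
  have "mat_positive n (\<lambda>i j. \<Phi> \<cdot> (adj (a i) * a j))"
    using assms mat_positive_gram[of n a] by (simp add: CP_def)
  then show "(\<Sum>i<n. \<Sum>j<n. \<langle>x i, (\<Phi> \<cdot> (adj (a i) * a j)) \<cdot> x j\<rangle>) \<in> \<real>\<^sub>\<ge>\<^sub>0"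
    by (simp add: mat_positive_def)
qed

lemma (in orthonormal_basis) mat_positive_transposition:
  assumes "mat_positive n a"
  shows "mat_positive n (\<lambda>i j. transposition E (a j i))"
  unfolding mat_positive_def
proof
  fix x :: "nat \<Rightarrow> 'h"
  have "(\<Sum>i<n. \<Sum>j<n. \<langle>x i, transposition E (a j i) \<cdot> x j\<rangle>)
      = (\<Sum>j<n. \<Sum>i<n. \<langle>conj_vec E (x j), a j i \<cdot> conj_vec E (x i)\<rangle>)"
    by (subst sum.swap) (simp add: cinner_transposition)
  also have "\<dots> \<in> \<real>\<^sub>\<ge>\<^sub>0"
    using assms[unfolded mat_positive_def, rule_format, of "\<lambda>i. conj_vec E (x i)"] by simp
  finally show "(\<Sum>i<n. \<Sum>j<n. \<langle>x i, transposition E (a j i) \<cdot> x j\<rangle>) \<in> \<real>\<^sub>\<ge>\<^sub>0" .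
qed

text \<open>Transposing the entries of a positive matrix and swapping its indices keeps it positive,
  and the swap undoes the one in the definition of \<open>coCP\<close>. Copositive maps thereby
  become accessible to all results on \<open>kernel_positive\<close>.\<close>

lemma (in orthonormal_basis) coCP_kernel_positive:
  assumes "\<Phi> \<in> coCP"
  shows "kernel_positive (\<Phi> * transp)"
  unfolding kernel_positive_def
proof (intro allI)
  fix n and a :: "nat \<Rightarrow> 'h bop" and x :: "nat \<Rightarrow> 'h"
  have "mat_positive n (\<lambda>i j. \<Phi> \<cdot> transposition E (adj (a i) * a j))"
    using assms mat_positive_transposition[OF mat_positive_gram[of n a]] by (simp add: coCP_def)
  then show "(\<Sum>i<n. \<Sum>j<n. \<langle>x i, ((\<Phi> * transp) \<cdot> (adj (a i) * a j)) \<cdot> x j\<rangle>) \<in> \<real>\<^sub>\<ge>\<^sub>0"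
    by (simp add: mat_positive_def times_bop.rep_eq transp_apply)
qed

lemma sum_Suc_Suc:
  fixes f :: "nat \<Rightarrow> nat \<Rightarrow> 'a::comm_monoid_add"
  shows "(\<Sum>i<Suc n. \<Sum>j<Suc n. f i j) = (\<Sum>i<n. \<Sum>j<n. f i j) + (\<Sum>i<n. f i n) + (\<Sum>j<n. f n j) + f n n"
  by (simp add: sum.distrib add_ac)

text \<open>The form bordered by one more pair (b, y). With n = 1 it yields the two-by-two
  inequalities, with general n the Schur complement.\<close>

lemma kernel_positive_insert:
  fixes n :: nat
  assumes "kernel_positive \<Phi>"
  shows "(\<Sum>i<n. \<Sum>j<n. \<langle>x i, (\<Phi> \<cdot> (adj (a i) * a j)) \<cdot> x j\<rangle>) + (\<Sum>i<n. \<langle>x i, (\<Phi> \<cdot> (adj (a i) * b)) \<cdot> y\<rangle>)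
    + (\<Sum>j<n. \<langle>y, (\<Phi> \<cdot> (adj b * a j)) \<cdot> x j\<rangle>) + \<langle>y, (\<Phi> \<cdot> (adj b * b)) \<cdot> y\<rangle> \<in> \<real>\<^sub>\<ge>\<^sub>0"
  using assms[unfolded kernel_positive_def, rule_format, of "x(n := y)" "a(n := b)" "Suc n"]
  unfolding sum_Suc_Suc by simp

lemma kernel_positive_gram:
  "kernel_positive \<Phi> \<Longrightarrow> \<langle>x, (\<Phi> \<cdot> (adj a * a)) \<cdot> x\<rangle> \<in> \<real>\<^sub>\<ge>\<^sub>0"
  using kernel_positive_insert[of \<Phi> "\<lambda>_. x" "\<lambda>_. a" 0 a x] by simp

lemma nonneg_Reals_of_real: "z \<in> \<real>\<^sub>\<ge>\<^sub>0 \<Longrightarrow> complex_of_real (Re z) = z \<and> Re z \<ge> 0"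
  by (simp add: complex_nonneg_Reals_iff complex_eq_iff)

lemma kernel_positive_pair:
  assumes "kernel_positive \<Phi>"
  shows "\<langle>x, (\<Phi> \<cdot> (adj a * a)) \<cdot> x\<rangle> + c * \<langle>x, (\<Phi> \<cdot> (adj a * b)) \<cdot> y\<rangle>
    + cnj c * \<langle>y, (\<Phi> \<cdot> (adj b * a)) \<cdot> x\<rangle> + complex_of_real ((cmod c)\<^sup>2) * \<langle>y, (\<Phi> \<cdot> (adj b * b)) \<cdot> y\<rangle> \<in> \<real>\<^sub>\<ge>\<^sub>0"
  unfolding complex_norm_square
  using kernel_positive_insert[OF assms, where n = 1 and x = "\<lambda>_. x" and a = "\<lambda>_. a" and b = b and y = "c *\<^sub>C y"]
  by (simp add: bop_simps cinner_simps mult_ac)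

text \<open>The form on the pair is real for c = 1 and for c = \<i>; comparing imaginary parts gives
  one real equation each.\<close>

lemma kernel_positive_hermitian:
  assumes "kernel_positive \<Phi>"
  shows "\<langle>y, (\<Phi> \<cdot> (adj b * a)) \<cdot> x\<rangle> = cnj \<langle>x, (\<Phi> \<cdot> (adj a * b)) \<cdot> y\<rangle>"
proof -
  have "Im \<langle>x, (\<Phi> \<cdot> (adj a * a)) \<cdot> x\<rangle> = 0" "Im \<langle>y, (\<Phi> \<cdot> (adj b * b)) \<cdot> y\<rangle> = 0"
    using kernel_positive_gram[OF assms] by (simp_all add: complex_nonneg_Reals_iff)
  moreover have "Im \<langle>x, (\<Phi> \<cdot> (adj a * a)) \<cdot> x\<rangle> + Im \<langle>x, (\<Phi> \<cdot> (adj a * b)) \<cdot> y\<rangle>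
      + Im \<langle>y, (\<Phi> \<cdot> (adj b * a)) \<cdot> x\<rangle> + Im \<langle>y, (\<Phi> \<cdot> (adj b * b)) \<cdot> y\<rangle> = 0"
    using kernel_positive_pair[OF assms, of x a 1 b y] by (simp add: complex_nonneg_Reals_iff)
  moreover have "Im \<langle>x, (\<Phi> \<cdot> (adj a * a)) \<cdot> x\<rangle> + Re \<langle>x, (\<Phi> \<cdot> (adj a * b)) \<cdot> y\<rangle>
      - Re \<langle>y, (\<Phi> \<cdot> (adj b * a)) \<cdot> x\<rangle> + Im \<langle>y, (\<Phi> \<cdot> (adj b * b)) \<cdot> y\<rangle> = 0"
    using kernel_positive_pair[OF assms, of x a \<i> b y] by (simp add: complex_nonneg_Reals_iff)
  ultimately show ?thesis by (intro complex_eqI) simp_all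
qed

lemma kernel_positive_Cauchy_Schwarz:
  assumes "kernel_positive \<Phi>"
  shows "(cmod \<langle>x, (\<Phi> \<cdot> (adj a * b)) \<cdot> y\<rangle>)\<^sup>2
    \<le> Re \<langle>x, (\<Phi> \<cdot> (adj a * a)) \<cdot> x\<rangle> * Re \<langle>y, (\<Phi> \<cdot> (adj b * b)) \<cdot> y\<rangle>"
proof (rule discriminant_bound)
  show "0 \<le> Re \<langle>y, (\<Phi> \<cdot> (adj b * b)) \<cdot> y\<rangle>"
    using kernel_positive_gram[OF assms, of y b] by (simp add: complex_nonneg_Reals_iff)
  fix c
  show "0 \<le> Re \<langle>x, (\<Phi> \<cdot> (adj a * a)) \<cdot> x\<rangle> + 2 * Re (c * \<langle>x, (\<Phi> \<cdot> (adj a * b)) \<cdot> y\<rangle>)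
      + (cmod c)\<^sup>2 * Re \<langle>y, (\<Phi> \<cdot> (adj b * b)) \<cdot> y\<rangle>"
    using kernel_positive_pair[OF assms, of x a c b y]
    unfolding kernel_positive_hermitian[OF assms, of y b a x]
    by (simp add: complex_nonneg_Reals_iff del: of_real_power)
qed

text \<open>A bound on the diagonal controls everything with the same constant. It is meant for the
  Cholesky residues, whose diagonals decrease, and so gives a bound independent of the step.\<close>

lemma kernel_positive_bound:
  assumes "kernel_positive \<Phi>" and le: "\<And>x a. Re \<langle>x, (\<Phi> \<cdot> (adj a * a)) \<cdot> x\<rangle> \<le> C * (norm a)\<^sup>2 * (norm x)\<^sup>2"
  shows "cmod \<langle>x, (\<Phi> \<cdot> (adj a * b)) \<cdot> y\<rangle> \<le> C * (norm a * norm b) * norm x * norm y"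
proof -
  have pos: "0 \<le> Re \<langle>x, (\<Phi> \<cdot> (adj a * a)) \<cdot> x\<rangle>" for x a
    using kernel_positive_gram[OF assms(1), of x a] by (simp add: complex_nonneg_Reals_iff)
  show ?thesis
  proof (cases "a = 0 \<or> x = 0")
    case True
    have "\<langle>x, (\<Phi> \<cdot> (adj a * b)) \<cdot> y\<rangle> = 0"
      using True adj_scaleR[of 0 a] by (auto simp: bop_simps)
    then show ?thesis using True by auto
  next
    case False
    \<comment> \<open>The sign of C is not given; it follows from one nonzero pair, which is why
      degenerate pairs are treated separately.\<close>
    have "0 \<le> C * (norm a)\<^sup>2 * (norm x)\<^sup>2" using pos le by (rule order_trans)
    with False have C: "C \<ge> 0" by (simp add: zero_le_mult_iff)
    have "(cmod \<langle>x, (\<Phi> \<cdot> (adj a * b)) \<cdot> y\<rangle>)\<^sup>2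
        \<le> (C * (norm a)\<^sup>2 * (norm x)\<^sup>2) * (C * (norm b)\<^sup>2 * (norm y)\<^sup>2)"
      using kernel_positive_Cauchy_Schwarz[OF assms(1), of x a b y] C pos
      by (elim order_trans) (intro mult_mono le, simp_all)
    also have "\<dots> = (C * (norm a * norm b) * norm x * norm y)\<^sup>2"
      by (simp add: power2_eq_square mult_ac)
    finally show ?thesis
      by (rule power2_le_imp_le) (use C in simp)
  qed
qed

text \<open>With a unit vector u, |a><b| is the product of |a><u| and |u><b|, so rank-one operators
  are of the form to which \<open>kernel_positive\<close> applies. In the zero space u = 0 does, as
  all operators agree.\<close>

lemma rank1_factor:
  "\<exists>u :: 'h::chilbert_space. norm u \<le> 1 \<and> (\<forall>a b. rank1 a b = adj (rank1 u a) * rank1 u b)"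
proof (cases "\<exists>z :: 'h. z \<noteq> 0")
  case True
  then obtain z :: 'h where "z \<noteq> 0" by blast
  define u where "u = (1 / norm z) *\<^sub>R z"
  have u: "norm u = 1" using \<open>z \<noteq> 0\<close> by (simp add: u_def)
  show ?thesis
    by (intro exI[of _ u]) (simp add: u adj_rank1 rank1_mult_rank1 cinner_norm)
next
  case False
  then have z: "z = 0" for z :: 'h by simp
  have "A = B" for A B :: "'h bop" by (rule bop_eqI) (metis z)
  then show ?thesis by (intro exI[of _ 0]) simp
qed

section \<open>Cholesky decomposition of a positive kernel\<close>

text \<open>One step of a Cholesky decomposition with pivot \<open>(a, x)\<close>: a Schur complement.\<close>

lemma kernel_positive_pivot:
  assumes pos: "kernel_positive \<Phi>"
  obtains V where "kernel_positive (\<Phi> - sandwich (adj V) V)"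
    "\<langle>x, ((\<Phi> - sandwich (adj V) V) \<cdot> rank1 a a) \<cdot> x\<rangle> = 0"
proof -
  obtain u :: 'a where u: "\<forall>a b. rank1 a b = adj (rank1 u a) * rank1 u b"
    using rank1_factor by blast
  define k where "k = Re \<langle>x, (\<Phi> \<cdot> rank1 a a) \<cdot> x\<rangle>"
  have k: "\<langle>x, (\<Phi> \<cdot> rank1 a a) \<cdot> x\<rangle> = complex_of_real k" "k \<ge> 0"
    using nonneg_Reals_of_real[OF kernel_positive_gram[OF pos, of x "rank1 u a"]] u[rule_format, of a a, symmetric] by (simp_all add: k_def)
  show ?thesis
  proof (cases "k = 0")
    case True
    have "sandwich (adj 0) 0 = (0 :: 'a bop bop)"
      by (rule bop_eqI) (simp add: sandwich_apply zero_bop.rep_eq)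
    then show ?thesis using pos k True by (intro that[of 0]) simp_all
  next
    case False
    then have kpos: "k > 0" using k by simp
    define r where "r = sqrt k"
    have r: "r > 0" "r * r = k" using kpos by (simp_all add: r_def)
    have bound: "cmod (\<langle>x, (\<Phi> \<cdot> rank1 a b) \<cdot> y\<rangle> / complex_of_real r) \<le> (norm \<Phi> * norm a * norm x / r) * norm b * norm y" for b y
    proof -
      have "cmod \<langle>x, (\<Phi> \<cdot> rank1 a b) \<cdot> y\<rangle> \<le> norm (\<Phi> \<cdot> rank1 a b) * norm x * norm y"
        by (rule cinner_bop_bound)
      also have "norm (\<Phi> \<cdot> rank1 a b) \<le> norm \<Phi> * (norm a * norm b)"
        by (rule order_trans[OF bop_norm_bound]) (simp add: mult_left_mono norm_rank1_le)
      finally have "cmod \<langle>x, (\<Phi> \<cdot> rank1 a b) \<cdot> y\<rangle> \<le> norm \<Phi> * (norm a * norm b) * norm x * norm y"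
        by (simp add: mult_right_mono)
      then show ?thesis using r(1) by (simp add: norm_divide divide_right_mono mult_ac)
    qed
    have rank1_add: "rank1 a (b + b') = rank1 a b + rank1 a b'" for b b'
      by (rule bop_eqI) (simp add: rank1_apply bop_simps cinner_simps scaleC_add_left)
    have rank1_scale: "rank1 a (c *\<^sub>C b) = cnj c *\<^sub>C rank1 a b" for b c
      by (rule bop_eqI) (simp add: rank1_apply bop_simps cinner_simps scaleC_scaleC)
    \<comment> \<open>V is the pivot row divided by the square root of the pivot entry, as in the
      scalar Cholesky step.\<close>
    obtain V where V: "\<And>b y. \<langle>b, V \<cdot> y\<rangle> = \<langle>x, (\<Phi> \<cdot> rank1 a b) \<cdot> y\<rangle> / complex_of_real r"
    proof (rule bounded_form_bop[of "\<lambda>b y. \<langle>x, (\<Phi> \<cdot> rank1 a b) \<cdot> y\<rangle> / complex_of_real r" "norm \<Phi> * norm a * norm x / r"])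
      show "0 \<le> norm \<Phi> * norm a * norm x / r" using r by simp
    qed (use bound in \<open>auto simp: rank1_add rank1_scale bop_simps cinner_simps add_divide_distrib\<close>)
    have V': "\<langle>x, (\<Phi> \<cdot> rank1 a b) \<cdot> y\<rangle> = complex_of_real r * \<langle>b, V \<cdot> y\<rangle>" for b y
      using r(1) by (simp add: V)
    have "kernel_positive (\<Phi> - sandwich (adj V) V)"
      unfolding kernel_positive_def
    proof (intro allI)
      fix n and b :: "nat \<Rightarrow> 'a bop" and y :: "nat \<Rightarrow> 'a"
      \<comment> \<open>The family is bordered by (|w><a|, z), which completes the square: the two
        border sums are - N and the corner is N, so the bordered form is the old form minus N, and N
        is exactly what the sandwich subtracts.\<close>
      define w where "w = (\<Sum>j<n. b j \<cdot> V \<cdot> y j)"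
      define z where "z = (- 1 / r) *\<^sub>R x"
      define N where "N = \<langle>w, w\<rangle>"
      have N: "N = complex_of_real ((norm w)\<^sup>2)" by (simp only: N_def cinner_norm)
      have "\<langle>z, (\<Phi> \<cdot> (adj (rank1 w a) * b j)) \<cdot> y j\<rangle> = - \<langle>w, b j \<cdot> V \<cdot> y j\<rangle>" for j
        using r(1) by (simp add: z_def adj_rank1 rank1_mult cinner_scaleR_left cinner_minus_left V' cinner_adj_left)
      then have row: "(\<Sum>j<n. \<langle>z, (\<Phi> \<cdot> (adj (rank1 w a) * b j)) \<cdot> y j\<rangle>) = - N"
        by (simp add: sum_negf N_def flip: cinner_sum_right w_def)
      have "(\<Sum>i<n. \<langle>y i, (\<Phi> \<cdot> (adj (b i) * rank1 w a)) \<cdot> z\<rangle>)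
          = cnj (\<Sum>j<n. \<langle>z, (\<Phi> \<cdot> (adj (rank1 w a) * b j)) \<cdot> y j\<rangle>)"
        by (simp add: kernel_positive_hermitian[OF pos, of "y _" "b _" "rank1 w a" z])
      then have col: "(\<Sum>i<n. \<langle>y i, (\<Phi> \<cdot> (adj (b i) * rank1 w a)) \<cdot> z\<rangle>) = - N"
        by (simp add: row N)
      have diag: "\<langle>z, (\<Phi> \<cdot> (adj (rank1 w a) * rank1 w a)) \<cdot> z\<rangle> = N"
        using r kpos by (simp add: z_def adj_rank1 rank1_mult_rank1 bop_simps cinner_simps k N_def field_simps
            flip: of_real_mult)
      have "(\<Sum>i<n. \<Sum>j<n. \<langle>y i, ((\<Phi> - sandwich (adj V) V) \<cdot> (adj (b i) * b j)) \<cdot> y j\<rangle>)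
          = (\<Sum>i<n. \<Sum>j<n. \<langle>y i, (\<Phi> \<cdot> (adj (b i) * b j)) \<cdot> y j\<rangle>)
            - (\<Sum>i<n. \<Sum>j<n. \<langle>V \<cdot> y i, (adj (b i) * b j) \<cdot> V \<cdot> y j\<rangle>)"
        by (simp add: minus_bop.rep_eq cinner_diff_right sum_subtractf sandwich_apply times_bop.rep_eq cinner_adj_right)
      also have "(\<Sum>i<n. \<Sum>j<n. \<langle>V \<cdot> y i, (adj (b i) * b j) \<cdot> V \<cdot> y j\<rangle>) = N"
        by (simp only: cinner_gram_sum w_def N)
      finally show "(\<Sum>i<n. \<Sum>j<n. \<langle>y i, ((\<Phi> - sandwich (adj V) V) \<cdot> (adj (b i) * b j)) \<cdot> y j\<rangle>) \<in> \<real>\<^sub>\<ge>\<^sub>0"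
        using kernel_positive_insert[OF pos, where n = n and x = y and a = b and b = "rank1 w a" and y = z] unfolding row col diag by simp
    qed
    moreover have "\<langle>x, ((\<Phi> - sandwich (adj V) V) \<cdot> rank1 a a) \<cdot> x\<rangle> = 0"
    proof -
      have aV: "\<langle>a, V \<cdot> x\<rangle> = complex_of_real r"
        using r kpos by (simp add: V k field_simps flip: of_real_mult)
      have "\<langle>x, (sandwich (adj V) V \<cdot> rank1 a a) \<cdot> x\<rangle> = \<langle>a, V \<cdot> x\<rangle> * \<langle>V \<cdot> x, a\<rangle>"
        by (simp add: sandwich_apply times_bop.rep_eq cinner_adj_right rank1_apply cinner_scaleC_right bop_apply_scaleC)
      also have "\<dots> = complex_of_real k"
        using cinner_commute[of "V \<cdot> x" a] r by (simp add: aV flip: of_real_mult)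
      finally show ?thesis by (simp add: minus_bop.rep_eq cinner_diff_right k)
    qed
    ultimately show ?thesis by (rule that)
  qed
qed

text \<open>After all pivots the residue is 0 on rank-one operators, but a singular state, for
  example, also vanishes there. Normality makes the residue vanish at 1 as well, and Cauchy-Schwarz
  between 1 and A then removes it everywhere.\<close>

theorem (in orthonormal_basis) kraus_decomposition:
  assumes sep: "separable_space (euclidean :: 'h topology)"
    and pos: "kernel_positive \<Phi>"
    and normal: "\<And>x \<epsilon>. \<epsilon> > 0 \<Longrightarrow> \<exists>F. finite F \<and> F \<subseteq> E \<and> Re \<langle>x, (\<Phi> \<cdot> (1 - proj F)) \<cdot> x\<rangle> < \<epsilon>"
  obtains V where "is_kraus V \<Phi>"
proof -
  obtain u :: 'h where u: "norm u \<le> 1" "\<forall>a b. rank1 a b = adj (rank1 u a) * rank1 u b"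
    using rank1_factor by blast
  obtain D :: "'h set" where D: "countable D" "closure D = UNIV"
    using sep unfolding separable_space_def by auto
  then have "D \<noteq> {}" by auto
  \<comment> \<open>Every pair of points of D occurs; repetitions are harmless, since a diagonal
    entry that is 0 remains 0.\<close>
  define p where "p = from_nat_into (D \<times> D)"
  have p: "\<exists>m. p m = (a, x)" if "a \<in> D" "x \<in> D" for a x
    using that from_nat_into_surj[of "D \<times> D" "(a, x)"] D(1) unfolding p_def by auto
  have "\<exists>\<Psi>. \<forall>n. (kernel_positive (\<Psi> n) \<and> (n = 0 \<longrightarrow> \<Psi> n = \<Phi>)) \<and>
    (\<exists>V. \<Psi> (Suc n) = \<Psi> n - sandwich (adj V) V \<and> \<langle>snd (p n), (\<Psi> (Suc n) \<cdot> rank1 (fst (p n)) (fst (p n))) \<cdot> snd (p n)\<rangle> = 0)"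
  proof (rule dependent_nat_choice)
    show "\<exists>\<Psi>. kernel_positive \<Psi> \<and> (0 = (0 :: nat) \<longrightarrow> \<Psi> = \<Phi>)" using pos by blast
    fix \<Psi> and n :: nat assume \<Psi>: "kernel_positive \<Psi> \<and> (n = 0 \<longrightarrow> \<Psi> = \<Phi>)"
    then obtain V where "kernel_positive (\<Psi> - sandwich (adj V) V)"
      "\<langle>snd (p n), ((\<Psi> - sandwich (adj V) V) \<cdot> rank1 (fst (p n)) (fst (p n))) \<cdot> snd (p n)\<rangle> = 0"
      using kernel_positive_pivot[of \<Psi> "snd (p n)" "fst (p n)"] by blast
    then show "\<exists>\<Psi>'. (kernel_positive \<Psi>' \<and> (Suc n = 0 \<longrightarrow> \<Psi>' = \<Phi>)) \<and>
        (\<exists>V. \<Psi>' = \<Psi> - sandwich (adj V) V \<and> \<langle>snd (p n), (\<Psi>' \<cdot> rank1 (fst (p n)) (fst (p n))) \<cdot> snd (p n)\<rangle> = 0)"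
      by (intro exI[of _ "\<Psi> - sandwich (adj V) V"]) auto
  qed
  then obtain \<Psi> where \<Psi>_pos: "\<And>n. kernel_positive (\<Psi> n)" and \<Psi>_0: "\<Psi> 0 = \<Phi>"
    and step: "\<forall>n. \<exists>V. \<Psi> (Suc n) = \<Psi> n - sandwich (adj V) V
      \<and> \<langle>snd (p n), (\<Psi> (Suc n) \<cdot> rank1 (fst (p n)) (fst (p n))) \<cdot> snd (p n)\<rangle> = 0" by blast
  from step obtain V where "\<forall>n. \<Psi> (Suc n) = \<Psi> n - sandwich (adj (V n)) (V n)
      \<and> \<langle>snd (p n), (\<Psi> (Suc n) \<cdot> rank1 (fst (p n)) (fst (p n))) \<cdot> snd (p n)\<rangle> = 0"
    unfolding choice_iff by (elim exE)
  then have \<Psi>_Suc: "\<And>n. \<Psi> (Suc n) = \<Psi> n - sandwich (adj (V n)) (V n)"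
    and pivot: "\<And>n. \<langle>snd (p n), (\<Psi> (Suc n) \<cdot> rank1 (fst (p n)) (fst (p n))) \<cdot> snd (p n)\<rangle> = 0" by blast+
  define q where "q n a x = Re \<langle>x, (\<Psi> n \<cdot> (adj a * a)) \<cdot> x\<rangle>" for n a x
  have q_nonneg: "0 \<le> q n a x" for n a x
    using kernel_positive_gram[OF \<Psi>_pos, of x n a] by (simp add: q_def complex_nonneg_Reals_iff)
  have \<Psi>_diff: "\<langle>x, (\<Psi> (Suc n) \<cdot> A) \<cdot> y\<rangle> = \<langle>x, (\<Psi> n \<cdot> A) \<cdot> y\<rangle> - \<langle>V n \<cdot> x, A \<cdot> V n \<cdot> y\<rangle>" for n x A y
    by (simp add: \<Psi>_Suc minus_bop.rep_eq cinner_diff_right sandwich_apply times_bop.rep_eq cinner_adj_right)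
  \<comment> \<open>One step subtracts the squared norm of
    \<open>a \<cdot> V n \<cdot> x\<close>.\<close>
  have "q (Suc n) a x \<le> q n a x" for n a x
    by (simp add: q_def \<Psi>_diff times_bop.rep_eq cinner_adj_right cinner_norm flip: of_real_power)
  then have q_antimono: "antimono (\<lambda>n. q n a x)" for a x
    by (simp add: antimono_iff_le_Suc)
  have q_le: "q n a x \<le> norm \<Phi> * (norm a)\<^sup>2 * (norm x)\<^sup>2" for n a x
  proof -
    have "q n a x \<le> q 0 a x" using antimonoD[OF q_antimono, of 0 n] by simp
    also have "\<dots> \<le> norm (\<Phi> \<cdot> (adj a * a)) * norm x * norm x"
      unfolding q_def \<Psi>_0 by (rule order_trans[OF complex_Re_le_cmod cinner_bop_bound])
    also have "norm (\<Phi> \<cdot> (adj a * a)) \<le> norm \<Phi> * (norm (adj a) * norm a)"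
      by (rule order_trans[OF bop_norm_bound mult_left_mono[OF norm_mult_ineq]]) simp
    finally show ?thesis
      by (simp add: norm_adj power2_eq_square mult_right_mono mult.assoc)
  qed
  have bound: "cmod \<langle>x, (\<Psi> n \<cdot> (adj a * b)) \<cdot> y\<rangle> \<le> norm \<Phi> * (norm a * norm b) * norm x * norm y" for n a b x y
    by (rule kernel_positive_bound[OF \<Psi>_pos]) (rule q_le[unfolded q_def])
  have bound1: "cmod \<langle>x, (\<Psi> n \<cdot> rank1 a b) \<cdot> y\<rangle> \<le> norm \<Phi> * (norm a * norm b) * norm x * norm y" for n a b x y
  proof -
    have "norm (rank1 u a) * norm (rank1 u b) \<le> norm a * norm b"
      using norm_rank1_le[of u a] norm_rank1_le[of u b] u(1) mult_right_mono[OF u(1), of "norm a"] mult_right_mono[OF u(1), of "norm b"]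
      by (intro mult_mono) simp_all
    then have "norm \<Phi> * (norm (rank1 u a) * norm (rank1 u b)) * norm x * norm y \<le> norm \<Phi> * (norm a * norm b) * norm x * norm y"
      by (intro mult_right_mono mult_left_mono) simp_all
    with bound[of x n "rank1 u a" "rank1 u b" y] show ?thesis
      by (simp add: u(2)[rule_format, of a b, symmetric])
  qed
  \<comment> \<open>A pivot that has been used has diagonal entry 0, monotonicity keeps it 0, and
    Cauchy-Schwarz clears its whole row.\<close>
  have vanish: "\<langle>x, (\<Psi> n \<cdot> rank1 a b) \<cdot> y\<rangle> = 0" if "p m = (a, x)" "n > m" for n m a x b y
  proof -
    have "q (Suc m) (rank1 u a) x = 0"
      using pivot[of m] that(1) by (simp add: q_def u(2)[rule_format, of a a, symmetric])
    moreover have "q n (rank1 u a) x \<le> q (Suc m) (rank1 u a) x"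
      using that(2) by (intro antimonoD[OF q_antimono]) simp
    ultimately have "q n (rank1 u a) x = 0" using q_nonneg[of n "rank1 u a" x] by simp
    then show ?thesis
      using kernel_positive_Cauchy_Schwarz[OF \<Psi>_pos, of x n "rank1 u a" "rank1 u b" y]
      by (simp add: q_def u(2)[rule_format, of a b, symmetric])
  qed
  \<comment> \<open>Both a and x are moved to points of D. The pivot removes the main term, and the
    errors are small uniformly in n by \<open>bound1\<close>.\<close>
  have rank1_lim: "(\<lambda>n. \<langle>x, (\<Psi> n \<cdot> rank1 a a) \<cdot> x\<rangle>) \<longlonglongrightarrow> 0" for x a
  proof (rule tendstoI)
    fix \<epsilon> :: real assume "\<epsilon> > 0"
    have "a \<in> closure D" "x \<in> closure D" using D(2) by simp_all
    then obtain s t where s: "\<And>k. s k \<in> D" "s \<longlonglongrightarrow> a" and t: "\<And>k. t k \<in> D" "t \<longlonglongrightarrow> x"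
      unfolding closure_sequential by blast
    have "(\<lambda>k. norm \<Phi> * (norm a * norm a) * norm (x - t k) * norm x + norm \<Phi> * (norm (a - s k) * norm a) * norm (t k) * norm x)
        \<longlonglongrightarrow> norm \<Phi> * (norm a * norm a) * norm (x - x) * norm x + norm \<Phi> * (norm (a - a) * norm a) * norm x * norm x"
      by (intro tendsto_intros s t)
    then have "\<forall>\<^sub>F k in sequentially. norm \<Phi> * (norm a * norm a) * norm (x - t k) * norm x
        + norm \<Phi> * (norm (a - s k) * norm a) * norm (t k) * norm x < \<epsilon>"
      using \<open>\<epsilon> > 0\<close> by (intro order_tendstoD) simp_all
    then obtain k where k: "norm \<Phi> * (norm a * norm a) * norm (x - t k) * norm x
        + norm \<Phi> * (norm (a - s k) * norm a) * norm (t k) * norm x < \<epsilon>"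
      using eventually_happens by force
    obtain m where m: "p m = (s k, t k)" using p s(1) t(1) by blast
    have "dist \<langle>x, (\<Psi> n \<cdot> rank1 a a) \<cdot> x\<rangle> 0 < \<epsilon>" if "n > m" for n
    proof -
      have "rank1 a a = rank1 (a - s k) a + rank1 (s k) a"
        by (rule bop_eqI) (simp add: rank1_apply bop_simps complex_vector.scale_right_diff_distrib)
      then have "\<langle>x, (\<Psi> n \<cdot> rank1 a a) \<cdot> x\<rangle> = \<langle>x - t k, (\<Psi> n \<cdot> rank1 a a) \<cdot> x\<rangle>
          + \<langle>t k, (\<Psi> n \<cdot> rank1 (a - s k) a) \<cdot> x\<rangle> + \<langle>t k, (\<Psi> n \<cdot> rank1 (s k) a) \<cdot> x\<rangle>"
        by (simp add: cinner_diff_left cinner_add_right bop_add_right plus_bop.rep_eq)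
      then have "\<langle>x, (\<Psi> n \<cdot> rank1 a a) \<cdot> x\<rangle> = \<langle>x - t k, (\<Psi> n \<cdot> rank1 a a) \<cdot> x\<rangle>
          + \<langle>t k, (\<Psi> n \<cdot> rank1 (a - s k) a) \<cdot> x\<rangle>"
        using vanish[OF m that] by simp
      also have "cmod \<dots> \<le> norm \<Phi> * (norm a * norm a) * norm (x - t k) * norm x
          + norm \<Phi> * (norm (a - s k) * norm a) * norm (t k) * norm x"
        by (intro norm_triangle_le add_mono bound1)
      finally show ?thesis using k by simp
    qed
    then show "\<forall>\<^sub>F n in sequentially. dist \<langle>x, (\<Psi> n \<cdot> rank1 a a) \<cdot> x\<rangle> 0 < \<epsilon>"
      unfolding eventually_at_top_dense by blast
  qed
  \<comment> \<open>Here normality enters: the value at \<open>1 - proj F\<close> stays below its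
    initial value, which is small for a suitable F, and \<open>proj F\<close> is a finite sum of
    rank-one operators.\<close>
  have one_lim: "(\<lambda>n. q n 1 x) \<longlonglongrightarrow> 0" for x
  proof (rule tendstoI)
    fix \<epsilon> :: real assume "\<epsilon> > 0"
    then obtain F where F: "finite F" "F \<subseteq> E" "Re \<langle>x, (\<Phi> \<cdot> (1 - proj F)) \<cdot> x\<rangle> < \<epsilon> / 2"
      using normal[of "\<epsilon> / 2" x] by auto
    have "(\<lambda>n. \<Sum>e\<in>F. Re \<langle>x, (\<Psi> n \<cdot> rank1 e e) \<cdot> x\<rangle>) \<longlonglongrightarrow> (\<Sum>e\<in>F. Re 0)"
      by (intro tendsto_sum tendsto_Re rank1_lim)
    then have "\<forall>\<^sub>F n in sequentially. (\<Sum>e\<in>F. Re \<langle>x, (\<Psi> n \<cdot> rank1 e e) \<cdot> x\<rangle>) < \<epsilon> / 2"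
      using \<open>\<epsilon> > 0\<close> by (elim order_tendstoD(2)) simp
    then show "\<forall>\<^sub>F n in sequentially. dist (q n 1 x) 0 < \<epsilon>"
    proof eventually_elim
      case (elim n)
      have "q n (1 - proj F) x \<le> q 0 (1 - proj F) x"
        by (rule antimonoD[OF q_antimono]) simp
      also have "\<dots> < \<epsilon> / 2"
        using F by (simp add: q_def \<Psi>_0 adj_coproj coproj_idem)
      finally have "q n (1 - proj F) x < \<epsilon> / 2" .
      moreover have "q n 1 x = q n (1 - proj F) x + (\<Sum>e\<in>F. Re \<langle>x, (\<Psi> n \<cdot> rank1 e e) \<cdot> x\<rangle>)"
        using F(1,2) by (simp add: q_def adj_coproj coproj_idem)
          (simp add: proj_def bop_simps cinner_simps cinner_sum_right)
      ultimately show ?case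
        using elim q_nonneg[of n 1 x] by simp
    qed
  qed
  have lim: "(\<lambda>n. \<langle>x, (\<Psi> n \<cdot> A) \<cdot> y\<rangle>) \<longlonglongrightarrow> 0" for x A y
  proof -
    define K where "K = norm \<Phi> * (norm A)\<^sup>2 * (norm y)\<^sup>2"
    have "cmod \<langle>x, (\<Psi> n \<cdot> A) \<cdot> y\<rangle> \<le> sqrt (q n 1 x * K)" for n
    proof (rule real_le_rsqrt)
      have "(cmod \<langle>x, (\<Psi> n \<cdot> A) \<cdot> y\<rangle>)\<^sup>2 \<le> q n 1 x * q n A y"
        using kernel_positive_Cauchy_Schwarz[OF \<Psi>_pos, of x n 1 A y] by (simp add: q_def)
      also have "\<dots> \<le> q n 1 x * K"
        unfolding K_def by (intro mult_left_mono q_le q_nonneg)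
      finally show "(cmod \<langle>x, (\<Psi> n \<cdot> A) \<cdot> y\<rangle>)\<^sup>2 \<le> q n 1 x * K" .
    qed
    moreover have "(\<lambda>n. sqrt (q n 1 x * K)) \<longlonglongrightarrow> sqrt (0 * K)"
      by (intro tendsto_intros one_lim)
    then have "(\<lambda>n. sqrt (q n 1 x * K)) \<longlonglongrightarrow> 0" by simp
    ultimately show ?thesis
      by (rule Lim_null_comparison[OF always_eventually[OF allI]])
  qed
  have "(\<Sum>n<N. \<langle>V n \<cdot> x, A \<cdot> V n \<cdot> y\<rangle>) = \<langle>x, (\<Phi> \<cdot> A) \<cdot> y\<rangle> - \<langle>x, (\<Psi> N \<cdot> A) \<cdot> y\<rangle>" for N x A y
    by (induction N) (simp_all add: \<Psi>_0 \<Psi>_diff)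
  then have "(\<lambda>n. \<langle>V n \<cdot> x, A \<cdot> V n \<cdot> y\<rangle>) sums \<langle>x, (\<Phi> \<cdot> A) \<cdot> y\<rangle>" for x A y
    using tendsto_diff[OF tendsto_const lim[of x A y], of "\<langle>x, (\<Phi> \<cdot> A) \<cdot> y\<rangle>"] by (simp add: sums_def)
  then show ?thesis by (intro that[of V]) (simp add: is_kraus_def)
qed

section \<open>Normal maps\<close>

text \<open>Normality with an explicit bound: the preadjoint multiplies mass by at most
  \<open>M\<close>. Powers then have bound \<open>M ^ n\<close>, which is what makes the exponential
  series converge in the predual.\<close>

definition normal_map :: "real \<Rightarrow> 'h::chilbert_space bop bop \<Rightarrow> bool"
  where "normal_map M T \<longleftrightarrow> 0 \<le> M \<and> (\<forall>c f. nuclear c f \<longrightarrow> nuclear (M * c) (\<lambda>A. f (T \<cdot> A)))"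

lemma normal_mapI:
  assumes "\<And>x y. nuclear (M * ((norm x)\<^sup>2 + (norm y)\<^sup>2)) (\<lambda>A. \<langle>x, (T \<cdot> A) \<cdot> y\<rangle>)" "M \<ge> 0"
  shows "normal_map M T"
  unfolding normal_map_def using nuclear_compose[of _ _ M "\<lambda>A. T \<cdot> A"] assms by blast

lemma normal_map_nuclear: "normal_map M T \<Longrightarrow> nuclear c f \<Longrightarrow> nuclear (M * c) (\<lambda>A. f (T \<cdot> A))"
  by (simp add: normal_map_def)

lemma normal_map_predual: "normal_map M T \<Longrightarrow> f \<in> predual \<Longrightarrow> (\<lambda>A. f (T \<cdot> A)) \<in> predual"
  unfolding predual_iff_nuclear using normal_map_nuclear by blast

lemma normal_map_add:
  assumes "normal_map M S" "normal_map N T"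
  shows "normal_map (M + N) (S + T)"
  unfolding normal_map_def
proof (intro conjI allI impI)
  fix c and f :: "'a bop \<Rightarrow> complex" assume f: "nuclear c f"
  have "f (S \<cdot> A + T \<cdot> A) = f (S \<cdot> A) + f (T \<cdot> A)" for A
    by (rule linear_add[OF bounded_linear.linear[OF nuclear_bounded_linear[OF f]]])
  then show "nuclear ((M + N) * c) (\<lambda>A. f ((S + T) \<cdot> A))"
    using nuclear_add[OF assms[THEN normal_map_nuclear, OF f]] by (simp add: bop_simps distrib_right)
qed (use assms in \<open>simp add: normal_map_def\<close>)

lemma normal_map_mult:
  assumes S: "normal_map M S" and T: "normal_map N T"
  shows "normal_map (N * M) (S * T)"
  unfolding normal_map_def
proof (intro conjI allI impI)
  fix c and f :: "'a bop \<Rightarrow> complex" assume f: "nuclear c f"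
  show "nuclear (N * M * c) (\<lambda>A. f ((S * T) \<cdot> A))"
    using normal_map_nuclear[OF T normal_map_nuclear[OF S f]] by (simp add: times_bop.rep_eq mult.assoc)
qed (use S T in \<open>simp add: normal_map_def\<close>)

lemma normal_map_power: "normal_map M T \<Longrightarrow> normal_map (M ^ n) (T ^ n)"
proof (induction n)
  case 0
  show ?case by (simp add: normal_map_def one_bop.rep_eq)
next
  case (Suc n)
  then show ?case using normal_map_mult[of M T "M ^ n" "T ^ n"] by (simp add: mult.commute)
qed

lemma normal_map_sandwich: "normal_map ((norm B)\<^sup>2 + (norm C)\<^sup>2) (sandwich B C)"
proof (rule normal_mapI)
  fix x y
  have "(norm (adj B \<cdot> x))\<^sup>2 + (norm (C \<cdot> y))\<^sup>2 \<le> (norm B * norm x)\<^sup>2 + (norm C * norm y)\<^sup>2"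
    using bop_norm_bound[of "adj B" x] bop_norm_bound[of C y]
    by (intro add_mono power_mono) (simp_all add: norm_adj)
  also have "\<dots> \<le> ((norm B)\<^sup>2 + (norm C)\<^sup>2) * ((norm x)\<^sup>2 + (norm y)\<^sup>2)"
    by (simp add: power_mult_distrib algebra_simps)
  finally show "nuclear (((norm B)\<^sup>2 + (norm C)\<^sup>2) * ((norm x)\<^sup>2 + (norm y)\<^sup>2)) (\<lambda>A. \<langle>x, (sandwich B C \<cdot> A) \<cdot> y\<rangle>)"
    using nuclear_mono[OF nuclear_cinner[of "adj B \<cdot> x" "C \<cdot> y"]]
    by (simp add: sandwich_apply times_bop.rep_eq cinner_adj_left)
qed simp

lemma (in orthonormal_basis) normal_map_transp: "normal_map 1 transp"
proof (rule normal_mapI)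
  fix x y
  show "nuclear (1 * ((norm x)\<^sup>2 + (norm y)\<^sup>2)) (\<lambda>A. \<langle>x, (transp \<cdot> A) \<cdot> y\<rangle>)"
    using nuclear_cinner[of "conj_vec E y" "conj_vec E x"]
    by (simp add: transp_apply cinner_transposition add.commute)
qed simp

lemma normal_map_kraus:
  assumes "is_kraus V \<Phi>"
  shows "normal_map (norm \<Phi>) \<Phi>"
proof (rule normal_mapI)
  fix x y
  have "nuclear (\<Sum>n. (norm (V n \<cdot> x))\<^sup>2 + (norm (V n \<cdot> y))\<^sup>2) (\<lambda>A. \<langle>x, (\<Phi> \<cdot> A) \<cdot> y\<rangle>)"
    unfolding nuclear_def
    using is_kraus_sums[OF assms] is_kraus_summable[OF assms]
    by (intro exI[of _ "\<lambda>n. V n \<cdot> x"] exI[of _ "\<lambda>n. V n \<cdot> y"]) (auto simp: sums_iff intro: summable_add)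
  moreover have "(\<Sum>n. (norm (V n \<cdot> x))\<^sup>2 + (norm (V n \<cdot> y))\<^sup>2) \<le> norm \<Phi> * ((norm x)\<^sup>2 + (norm y)\<^sup>2)"
    using is_kraus_suminf_le[OF assms, of x] is_kraus_suminf_le[OF assms, of y]
    by (simp add: suminf_add[OF is_kraus_summable[OF assms] is_kraus_summable[OF assms], symmetric] distrib_left)
  ultimately show "nuclear (norm \<Phi> * ((norm x)\<^sup>2 + (norm y)\<^sup>2)) (\<lambda>A. \<langle>x, (\<Phi> \<cdot> A) \<cdot> y\<rangle>)"
    by (rule nuclear_mono)
qed simp

text \<open>The pulled-back functional is a series of normal functionals with masses t^n M^n c / n!,
  hence normal by \<open>nuclear_suminf\<close>.\<close>

lemma normal_map_bop_exp:
  assumes L: "normal_map M L" and t: "t \<ge> 0"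
  shows "continuous_map weak_star weak_star (bop_apply (bop_exp (t *\<^sub>R L)))"
proof (rule continuous_map_weak_star)
  fix f :: "'a bop \<Rightarrow> complex" assume "f \<in> predual"
  then obtain c where f: "nuclear c f" using predual_iff_nuclear by blast
  have fl: "bounded_linear f" by (rule nuclear_bounded_linear[OF f])
  define a where "a n = t ^ n / fact n" for n
  have a: "a n \<ge> 0" for n using t by (simp add: a_def)
  have "nuclear (a n * (M ^ n * c)) (\<lambda>A. complex_of_real (a n) * f ((L ^ n) \<cdot> A))" for n
    by (intro nuclear_scale normal_map_nuclear[OF normal_map_power[OF L] f] a)
  moreover have "summable (\<lambda>n. a n * (M ^ n * c))"
    using summable_mult2[OF summable_exp_generic[of "t * M"], of c]
    by (simp add: a_def power_mult_distrib divide_inverse mult_ac)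
  ultimately have "nuclear (\<Sum>n. a n * (M ^ n * c)) (\<lambda>A. \<Sum>n. complex_of_real (a n) * f ((L ^ n) \<cdot> A))"
    by (rule nuclear_suminf)
  moreover have "(\<Sum>n. complex_of_real (a n) * f ((L ^ n) \<cdot> A)) = f (bop_exp (t *\<^sub>R L) \<cdot> A)" for A
  proof -
    have bl: "bounded_linear (\<lambda>T. f (T \<cdot> A))"
      by (rule bounded_linear_compose[OF fl bounded_linear_bop_eval])
    have "f (bop_exp (t *\<^sub>R L) \<cdot> A) = (\<Sum>n. f (((t *\<^sub>R L) ^ n /\<^sub>R fact n) \<cdot> A))"
      unfolding bop_exp_def by (rule bounded_linear.suminf[OF bl summable_bop_exp])
    also have "\<dots> = (\<Sum>n. complex_of_real (a n) * f ((L ^ n) \<cdot> A))"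
      by (simp add: bop_scaleR_power a_def scaleR_bop.rep_eq linear_scale[OF bounded_linear.linear[OF fl]]
          scaleR_conv_of_real divide_inverse mult_ac)
    finally show ?thesis by simp
  qed
  ultimately show "(\<lambda>A. f (bop_exp (t *\<^sub>R L) \<cdot> A)) \<in> predual"
    unfolding predual_iff_nuclear by auto
qed

section \<open>Generators in standard form\<close>

lemma predual_linear: "\<phi> \<in> predual \<Longrightarrow> linear \<phi>"
  unfolding predual_iff_nuclear using nuclear_bounded_linear bounded_linear.linear by blast

lemma weak_star_sums_iff: "weak_star_sums f S \<longleftrightarrow> (\<forall>\<phi>\<in>predual. (\<lambda>n. \<phi> (f n)) sums \<phi> S)"
proof -
  have "\<phi> (\<Sum>n<N. f n) = (\<Sum>n<N. \<phi> (f n))" if "\<phi> \<in> predual" for \<phi> :: "'a bop \<Rightarrow> complex" and N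
    by (rule linear_sum[OF predual_linear[OF that]])
  then show ?thesis
    unfolding weak_star_sums_def limitin_weak_star_iff sums_def by simp
qed

lemma weak_star_sums_add: "weak_star_sums f S \<Longrightarrow> weak_star_sums g T \<Longrightarrow> weak_star_sums (\<lambda>n. f n + g n) (S + T)"
  unfolding weak_star_sums_iff by (auto simp: linear_add[OF predual_linear] intro!: sums_add)

lemma weak_star_sums_diff: "weak_star_sums f S \<Longrightarrow> weak_star_sums g T \<Longrightarrow> weak_star_sums (\<lambda>n. f n - g n) (S - T)"
  unfolding weak_star_sums_iff by (auto simp: linear_diff[OF predual_linear] intro!: sums_diff)

lemma weak_star_sums_normal_map:
  "normal_map M T \<Longrightarrow> weak_star_sums f S \<Longrightarrow> weak_star_sums (\<lambda>n. T \<cdot> f n) (T \<cdot> S)"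
  unfolding weak_star_sums_iff using normal_map_predual by fastforce

lemma weak_star_sums_mult: "weak_star_sums f S \<Longrightarrow> weak_star_sums (\<lambda>n. B * f n * C) (B * S * C)"
  using weak_star_sums_normal_map[OF normal_map_sandwich[of B C]] by (simp add: sandwich_apply)

lemma weak_star_sums_scaleR: "weak_star_sums f S \<Longrightarrow> weak_star_sums (\<lambda>n. r *\<^sub>R f n) (r *\<^sub>R S)"
  using weak_star_sums_mult[of f S "r *\<^sub>R 1" 1] by simp

lemma weak_star_sums_unique: "weak_star_sums f S \<Longrightarrow> weak_star_sums f T \<Longrightarrow> S = T"
  by (rule bop_eq_cinnerI) (metis weak_star_sums_cinner sums_unique2)

text \<open>Diagonal matrix elements of the partial sums are sums of squared norms increasing to
  \<open>\<langle>x, S \<cdot> x\<rangle>\<close>, so norm S is the uniform bound that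
  \<open>is_kraus_exists\<close> asks for.\<close>

lemma weak_star_summable_is_kraus:
  assumes "weak_star_summable (\<lambda>n. adj (V n) * V n)"
  obtains \<Phi> where "is_kraus V \<Phi>"
proof -
  obtain S where S: "weak_star_sums (\<lambda>n. adj (V n) * V n) S"
    using assms unfolding weak_star_summable_def by blast
  have sums: "(\<lambda>n. (norm (V n \<cdot> x))\<^sup>2) sums Re \<langle>x, S \<cdot> x\<rangle>" for x
    using sums_Re[OF weak_star_sums_cinner[OF S, of x x]]
    by (simp add: times_bop.rep_eq cinner_adj_right cinner_norm del: of_real_power)
  show ?thesis
  proof (rule is_kraus_exists[of V "norm S"])
    fix x N
    have "(\<Sum>n<N. (norm (V n \<cdot> x))\<^sup>2) \<le> Re \<langle>x, S \<cdot> x\<rangle>"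
      using sums[of x] sum_le_suminf[of "\<lambda>n. (norm (V n \<cdot> x))\<^sup>2" "{..<N}"] by (simp add: sums_iff)
    also have "\<dots> \<le> norm S * norm x * norm x"
      by (rule order_trans[OF complex_Re_le_cmod cinner_bop_bound])
    finally show "(\<Sum>n<N. (norm (V n \<cdot> x))\<^sup>2) \<le> norm S * (norm x)\<^sup>2"
      by (simp add: power2_eq_square mult.assoc)
  qed (use that in auto)
qed

lemma is_kraus_weak_star_sums_one:
  "is_kraus V \<Phi> \<Longrightarrow> weak_star_sums (\<lambda>n. adj (V n) * V n) (\<Phi> \<cdot> 1)"
  using is_kraus_weak_star_sums[of V \<Phi> 1] by simp

lemma is_kraus_adj_one:
  assumes "is_kraus V \<Phi>"
  shows "adj (\<Phi> \<cdot> 1) = \<Phi> \<cdot> 1"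
proof (rule adj_eqI)
  fix x y
  have "(\<lambda>n. cnj \<langle>V n \<cdot> y, V n \<cdot> x\<rangle>) sums cnj \<langle>y, (\<Phi> \<cdot> 1) \<cdot> x\<rangle>"
    using is_kraus_sums[OF assms, of y 1 x] by (simp add: sums_cnj one_bop.rep_eq)
  moreover have "(\<lambda>n. \<langle>V n \<cdot> x, V n \<cdot> y\<rangle>) sums \<langle>x, (\<Phi> \<cdot> 1) \<cdot> y\<rangle>"
    using is_kraus_sums[OF assms, of x 1 y] by (simp add: one_bop.rep_eq)
  ultimately show "\<langle>x, (\<Phi> \<cdot> 1) \<cdot> y\<rangle> = \<langle>(\<Phi> \<cdot> 1) \<cdot> x, y\<rangle>"
    by (metis (no_types, lifting) cinner_commute ext sums_unique2)
qed

context orthonormal_basis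
begin

text \<open>The anticommutator consists of two multiplications by A; these are normal and may be
  applied to the series of rates term by term.\<close>

lemma generator_series:
  assumes V: "is_kraus V \<Phi>" and W: "is_kraus W \<Psi>"
  shows "weak_star_sums
      (\<lambda>n. adj (V n) * A * V n + adj (W n) * transposition E A * W n
        - (1/2) *\<^sub>R anticommutator (adj (V n) * V n + adj (W n) * W n) A)
      (\<Phi> \<cdot> A + \<Psi> \<cdot> transp \<cdot> A - (1/2) *\<^sub>R anticommutator (\<Phi> \<cdot> 1 + \<Psi> \<cdot> 1) A)"
proof (intro weak_star_sums_diff weak_star_sums_add weak_star_sums_scaleR)
  show "weak_star_sums (\<lambda>n. adj (V n) * A * V n) (\<Phi> \<cdot> A)"
    by (rule is_kraus_weak_star_sums[OF V])
  show "weak_star_sums (\<lambda>n. adj (W n) * transposition E A * W n) (\<Psi> \<cdot> transp \<cdot> A)"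
    unfolding transp_apply by (rule is_kraus_weak_star_sums[OF W])
  define T where "T = (\<lambda>n. adj (V n) * V n + adj (W n) * W n)"
  have "weak_star_sums T (\<Phi> \<cdot> 1 + \<Psi> \<cdot> 1)"
    unfolding T_def by (intro weak_star_sums_add is_kraus_weak_star_sums_one V W)
  from weak_star_sums_add[OF weak_star_sums_mult[OF this, of 1 A] weak_star_sums_mult[OF this, of A 1]]
  show "weak_star_sums (\<lambda>n. anticommutator (adj (V n) * V n + adj (W n) * W n) A) (anticommutator (\<Phi> \<cdot> 1 + \<Psi> \<cdot> 1) A)"
    by (simp add: anticommutator_def T_def)
qed

text \<open>Grouped as G + Q, with the copositive term last, to match
  \<open>decomposable_bop_exp\<close>.\<close>

definition lindblad :: "'h bop \<Rightarrow> 'h bop bop \<Rightarrow> 'h bop bop \<Rightarrow> 'h bop bop"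
  where "lindblad K \<Phi> \<Psi> = (sandwich K 1 + sandwich 1 (adj K) + \<Phi>) + \<Psi> * transp"

lemma lindblad_apply: "lindblad K \<Phi> \<Psi> \<cdot> A = K * A + A * adj K + \<Phi> \<cdot> A + \<Psi> \<cdot> transp \<cdot> A"
  by (simp add: lindblad_def bop_simps sandwich_apply)

text \<open>Weak-* limits are unique, so the series statement is the same as an equation between
  maps. The hermitian part of K absorbs the anticommutator, the antihermitian part the commutator.
  Both directions of the theorem use this.\<close>

lemma has_generator_form_iff:
  assumes V: "is_kraus V \<Phi>" and W: "is_kraus W \<Psi>" and H: "adj H = H"
  shows "has_generator_form E L H V W \<longleftrightarrow>
    L = bop_apply (lindblad (\<i> *\<^sub>C H - (1/2) *\<^sub>R (\<Phi> \<cdot> 1 + \<Psi> \<cdot> 1)) \<Phi> \<Psi>)"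
proof -
  define K where "K = \<i> *\<^sub>C H - (1/2) *\<^sub>R (\<Phi> \<cdot> 1 + \<Psi> \<cdot> 1)"
  have adj_K: "adj K = - \<i> *\<^sub>C H - (1/2) *\<^sub>R (\<Phi> \<cdot> 1 + \<Psi> \<cdot> 1)"
    by (simp add: K_def adj_diff adj_scaleC adj_scaleR adj_add is_kraus_adj_one[OF V] is_kraus_adj_one[OF W] H)
  have eq: "lindblad K \<Phi> \<Psi> \<cdot> A - \<i> *\<^sub>C commutator H A
      = \<Phi> \<cdot> A + \<Psi> \<cdot> transp \<cdot> A - (1/2) *\<^sub>R anticommutator (\<Phi> \<cdot> 1 + \<Psi> \<cdot> 1) A" for A
    unfolding lindblad_apply adj_K
    by (simp add: K_def commutator_def anticommutator_def left_diff_distrib right_diff_distrib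
        distrib_left distrib_right scaleR_add_right bop_scaleC_mult_left bop_scaleC_mult_right
        complex_vector.scale_right_diff_distrib)
  have "has_generator_form E L H V W \<longleftrightarrow> (\<forall>A. L A - \<i> *\<^sub>C commutator H A = lindblad K \<Phi> \<Psi> \<cdot> A - \<i> *\<^sub>C commutator H A)"
  proof -
    have "weak_star_sums f X \<longleftrightarrow> X = Y" if "weak_star_sums f Y" for f and X Y :: "'h bop"
      using weak_star_sums_unique[OF that] that by blast
    from this[OF generator_series[OF V W]] show ?thesis
      unfolding has_generator_form_def eq by simp
  qed
  also have "\<dots> \<longleftrightarrow> L = bop_apply (lindblad K \<Phi> \<Psi>)"
    by auto
  finally show ?thesis by (simp add: K_def)
qed

lemma bop_exp_fixed:
  fixes L :: "'h bop bop"
  assumes "L \<cdot> A = 0"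
  shows "bop_exp (t *\<^sub>R L) \<cdot> A = A"
proof -
  have "bop_exp (t *\<^sub>R L) \<cdot> A = (\<Sum>n. ((t *\<^sub>R L) ^ n /\<^sub>R fact n) \<cdot> A)"
    unfolding bop_exp_def by (rule bounded_linear.suminf[OF bounded_linear_bop_eval summable_bop_exp])
  also have "\<dots> = (\<Sum>n\<in>{0}. ((t *\<^sub>R L) ^ n /\<^sub>R fact n) \<cdot> A)"
  proof (rule suminf_finite)
    fix n :: nat assume "n \<notin> {0}"
    then obtain m where "n = Suc m" by (cases n) auto
    then show "((t *\<^sub>R L) ^ n /\<^sub>R fact n) \<cdot> A = 0"
      unfolding bop_scaleR_power by (simp only: power_Suc2) (simp add: bop_simps assms)
  qed simp
  finally show ?thesis by (simp add: one_bop.rep_eq)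
qed

lemma lindblad_semigroup:
  assumes V: "is_kraus V \<Phi>" and W: "is_kraus W \<Psi>" and one: "lindblad K \<Phi> \<Psi> \<cdot> 1 = 0"
  shows "decomposable_dynamical_semigroup (\<lambda>t. bop_exp (t *\<^sub>R lindblad K \<Phi> \<Psi>))"
  unfolding decomposable_dynamical_semigroup_def
proof (intro conjI allI impI)
  fix t :: real assume t: "t \<ge> 0"
  have "\<Psi> * transp \<in> coCP"
    using is_kraus_CP[OF W] mat_positive_transposition
    by (simp add: CP_def coCP_def times_bop.rep_eq transp_apply)
  moreover have "1 + s *\<^sub>R (sandwich K 1 + sandwich 1 (adj K) + \<Phi>) + s\<^sup>2 *\<^sub>R sandwich K (adj K) \<in> CP" if "s \<ge> 0" for s
  proof -
    \<comment> \<open>The product (1 + s K) A \<open>adj (1 + s *\<^sub>R K)\<close> contains the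
      terms of order 0 and 1 and leaves K A \<open>adj K\<close> at order 2, which is the correction
      \<open>R\<close>.\<close>
    have "1 + s *\<^sub>R (sandwich K 1 + sandwich 1 (adj K) + \<Phi>) + s\<^sup>2 *\<^sub>R sandwich K (adj K)
        = sandwich (1 + s *\<^sub>R K) (adj (1 + s *\<^sub>R K)) + s *\<^sub>R \<Phi>"
      by (rule bop_eqI)
        (simp add: bop_simps sandwich_apply adj_add adj_scaleR algebra_simps power2_eq_square)
    then show ?thesis using CP_scale_add[OF sandwich_CP is_kraus_CP[OF V] that] by simp
  qed
  ultimately show "decomposable (bop_exp (t *\<^sub>R lindblad K \<Phi> \<Psi>))"
    unfolding lindblad_def using t by (intro decomposable_bop_exp)
  show "bop_exp (t *\<^sub>R lindblad K \<Phi> \<Psi>) \<cdot> 1 = 1"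
    by (rule bop_exp_fixed[OF one])
  show "continuous_map weak_star weak_star (bop_apply (bop_exp (t *\<^sub>R lindblad K \<Phi> \<Psi>)))"
    unfolding lindblad_def
    by (rule normal_map_bop_exp[OF normal_map_add[OF normal_map_add[OF normal_map_add[OF normal_map_sandwich
        normal_map_sandwich] normal_map_kraus[OF V]] normal_map_mult[OF normal_map_kraus[OF W] normal_map_transp]] t])
qed (simp_all add: bop_exp_add continuous_bop_exp)

text \<open>Here \<open>L\<close> is a bare function; that it is bounded and linear is part of the
  conclusion, obtained by identifying it with a \<open>lindblad\<close> map.\<close>

lemma generator_form_semigroup:
  assumes H: "adj H = H" and V: "weak_star_summable (\<lambda>n. adj (V n) * V n)"
    and W: "weak_star_summable (\<lambda>n. adj (W n) * W n)" and L: "has_generator_form E L H V W"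
  shows "bounded_clinear L \<and> decomposable_dynamical_semigroup (\<lambda>t. bop_exp (t *\<^sub>R Bop L))"
proof -
  obtain \<Phi> where \<Phi>: "is_kraus V \<Phi>" by (rule weak_star_summable_is_kraus[OF V])
  obtain \<Psi> where \<Psi>: "is_kraus W \<Psi>" by (rule weak_star_summable_is_kraus[OF W])
  define K where "K = \<i> *\<^sub>C H - (1/2) *\<^sub>R (\<Phi> \<cdot> 1 + \<Psi> \<cdot> 1)"
  have L_eq: "L = bop_apply (lindblad K \<Phi> \<Psi>)"
    using L has_generator_form_iff[OF \<Phi> \<Psi> H] by (simp add: K_def)
  have adj_K: "adj K = - \<i> *\<^sub>C H - (1/2) *\<^sub>R (\<Phi> \<cdot> 1 + \<Psi> \<cdot> 1)"
    by (simp add: K_def adj_diff adj_scaleC adj_scaleR adj_add is_kraus_adj_one[OF \<Phi>] is_kraus_adj_one[OF \<Psi>] H)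
  \<comment> \<open>K + \<open>adj K\<close> is minus the total rate, because the terms with H
    cancel.\<close>
  have "lindblad K \<Phi> \<Psi> \<cdot> 1 = 0"
    unfolding lindblad_apply adj_K
    by (simp add: K_def transp_apply transposition_one algebra_simps flip: scaleR_2)
  from lindblad_semigroup[OF \<Phi> \<Psi> this] show ?thesis
    using bop_apply[of "lindblad K \<Phi> \<Psi>"] by (simp add: L_eq bop_apply_inverse)
qed

end

section \<open>The generator of a smoothly decomposable semigroup\<close>

text \<open>\<open>D 0\<close> agrees with f only on the closed half-line, so the difference
  quotient is formed at 0 from the right.\<close>

lemma smooth_on_halfline_right_derivative:
  assumes "smooth_on_halfline f"
  obtains d where "((\<lambda>h. (f h - f 0) /\<^sub>R h) \<longlongrightarrow> d) (at_right 0)"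
proof -
  obtain D where D: "\<And>t. t \<ge> 0 \<Longrightarrow> D 0 t = f t"
    "\<And>n t. t \<ge> 0 \<Longrightarrow> (D n has_vector_derivative D (Suc n) t) (at t within {0..})"
    using assms unfolding smooth_on_halfline_def by blast
  have "(D 0 has_derivative (\<lambda>h. h *\<^sub>R D 1 0)) (at 0 within {0..})"
    using D(2)[of 0 0] by (simp add: has_vector_derivative_def)
  then have "((\<lambda>h. norm ((D 0 h - D 0 0) - (h - 0) *\<^sub>R D 1 0) / norm (h - 0)) \<longlongrightarrow> 0) (at 0 within {0..})"
    unfolding has_derivative_iff_norm by blast
  then have "((\<lambda>h. norm ((D 0 h - D 0 0) - (h - 0) *\<^sub>R D 1 0) / norm (h - 0)) \<longlongrightarrow> 0) (at_right 0)"
    by (rule tendsto_within_subset) auto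
  moreover have "\<forall>\<^sub>F h in at_right 0. norm ((D 0 h - D 0 0) - (h - 0) *\<^sub>R D 1 0) / norm (h - 0)
      = norm ((f h - f 0) /\<^sub>R h - D 1 0)"
  proof (rule eventually_at_rightI[of 0 1])
    fix h :: real assume "h \<in> {0<..<1}"
    then have h: "h > 0" by simp
    have "(f h - f 0) /\<^sub>R h - D 1 0 = ((f h - f 0) - h *\<^sub>R D 1 0) /\<^sub>R h"
      using h by (simp add: scaleR_diff_right)
    then show "norm ((D 0 h - D 0 0) - (h - 0) *\<^sub>R D 1 0) / norm (h - 0) = norm ((f h - f 0) /\<^sub>R h - D 1 0)"
      using h D(1) by (simp add: divide_inverse mult.commute)
  qed simp
  ultimately have "((\<lambda>h. norm ((f h - f 0) /\<^sub>R h - D 1 0)) \<longlongrightarrow> 0) (at_right 0)"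
    by (simp add: tendsto_cong)
  then have "((\<lambda>h. (f h - f 0) /\<^sub>R h) \<longlongrightarrow> D 1 0) (at_right 0)"
    by (simp add: tendsto_norm_zero_iff LIM_zero_iff)
  then show ?thesis by (rule that)
qed

lemma eventually_at_right_zeroI: "(\<And>h. h > 0 \<Longrightarrow> P h) \<Longrightarrow> \<forall>\<^sub>F h in at_right (0::real). P h"
  by (rule eventually_at_rightI[of 0 1]) auto

lemma coCP_gram:
  assumes "T \<in> coCP"
  shows "\<langle>x, (T \<cdot> (adj a * a)) \<cdot> x\<rangle> \<in> \<real>\<^sub>\<ge>\<^sub>0"
proof -
  have "mat_positive 1 (\<lambda>i j. T \<cdot> (adj a * a))"
    using assms mat_positive_gram[of 1 "\<lambda>_. a"] by (simp add: coCP_def)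
  from this[unfolded mat_positive_def, rule_format, of "\<lambda>_. x"] show ?thesis by simp
qed

text \<open>The hypothesis says that the dimension is at most one. Every operator is then a scalar,
  and a linear map that kills 1 is 0.\<close>

lemma scalar_if_no_orthogonal:
  fixes A :: "'h::chilbert_space bop" and x :: 'h
  assumes x: "\<And>b. \<langle>x, b\<rangle> = 0 \<Longrightarrow> b = 0"
  shows "\<exists>c. A = c *\<^sub>C 1"
proof
  have b: "(\<langle>x, b\<rangle> / \<langle>x, x\<rangle>) *\<^sub>C x = b" for b
  proof -
    \<comment> \<open>For x = 0 the quotient is 0 by convention and orthogonality to x is trivial;
      the hypothesis then makes the space zero.\<close>
    have "x = 0 \<or> \<langle>x, x\<rangle> \<noteq> 0" by (simp add: cinner_norm)
    then have "\<langle>x, (\<langle>x, b\<rangle> / \<langle>x, x\<rangle>) *\<^sub>C x - b\<rangle> = 0"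
      by (auto simp: cinner_simps)
    from x[OF this] show ?thesis by simp
  qed
  show "A = (\<langle>x, A \<cdot> x\<rangle> / \<langle>x, x\<rangle>) *\<^sub>C 1"
  proof (rule bop_eqI)
    fix y
    define k where "k = \<langle>x, y\<rangle> / \<langle>x, x\<rangle>"
    have y: "y = k *\<^sub>C x" using b[of y] by (simp add: k_def)
    have "A \<cdot> y = k *\<^sub>C (A \<cdot> x)"
      by (simp add: y bop_apply_scaleC)
    also have "A \<cdot> x = (\<langle>x, A \<cdot> x\<rangle> / \<langle>x, x\<rangle>) *\<^sub>C x" by (rule b[symmetric])
    finally show "A \<cdot> y = ((\<langle>x, A \<cdot> x\<rangle> / \<langle>x, x\<rangle>) *\<^sub>C 1) \<cdot> y"
      by (simp add: y bop_simps scaleC_scaleC mult.commute)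
  qed
qed

context orthonormal_basis
begin

lemma transp_transp: "transp * transp = 1"
  by (rule bop_eqI) (simp add: bop_simps transp_apply transposition_transposition)

lemma transposition_rank1: "transposition E (rank1 a b) = rank1 (conj_vec E b) (conj_vec E a)"
proof (rule bop_eq_cinnerI)
  fix x y
  show "\<langle>x, transposition E (rank1 a b) \<cdot> y\<rangle> = \<langle>x, rank1 (conj_vec E b) (conj_vec E a) \<cdot> y\<rangle>"
    using cinner_conj_vec[of "conj_vec E x" b] cinner_conj_vec_left[of y a]
    by (simp add: cinner_transposition rank1_apply cinner_scaleC_right mult.commute)
qed

lemma rank1_Cauchy_Schwarz:
  fixes \<Phi> :: "'h bop bop"
  assumes "kernel_positive \<Phi>"
  shows "(cmod \<langle>x, (\<Phi> \<cdot> rank1 a b) \<cdot> y\<rangle>)\<^sup>2 \<le> Re \<langle>x, (\<Phi> \<cdot> rank1 a a) \<cdot> x\<rangle> * Re \<langle>y, (\<Phi> \<cdot> rank1 b b) \<cdot> y\<rangle>"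
proof -
  obtain u :: 'h where u: "\<forall>a b. rank1 a b = adj (rank1 u a) * rank1 u b"
    using rank1_factor by blast
  show ?thesis
    using kernel_positive_Cauchy_Schwarz[OF assms, of x "rank1 u a" "rank1 u b" y]
    by (simp add: u[rule_format, symmetric])
qed

lemma rank1_nonneg:
  fixes \<Phi> :: "'h bop bop"
  assumes "kernel_positive \<Phi>"
  shows "0 \<le> Re \<langle>x, (\<Phi> \<cdot> rank1 a a) \<cdot> x\<rangle>"
proof -
  obtain u :: 'h where u: "\<forall>a b. rank1 a b = adj (rank1 u a) * rank1 u b"
    using rank1_factor by blast
  show ?thesis
    using kernel_positive_gram[OF assms, of x "rank1 u a"]
    by (simp add: u[rule_format, symmetric] complex_nonneg_Reals_iff)
qed

text \<open>For orthogonal \<open>x\<close> and \<open>b\<close>, Cauchy-Schwarz makes \<open>\<langle>x, \<psi>(|x\<rangle>\<langle>b|) b\<rangle>\<close> vanish. So \<open>\<phi>\<close> alone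
  reproduces \<open>|x\<rangle>\<langle>b|\<close>, which forces \<open>\<langle>x, \<psi>(|x\<rangle>\<langle>x|) x\<rangle> = 0\<close>.\<close>

lemma copositive_part_of_identity_zero:
  fixes \<phi> \<psi> :: "'h bop bop"
  assumes \<phi>: "\<phi> \<in> CP" and \<psi>: "\<psi> \<in> coCP" and sum: "\<phi> + \<psi> = 1"
    and dim: "\<And>x :: 'h. \<exists>b. b \<noteq> 0 \<and> \<langle>x, b\<rangle> = 0"
  shows "\<psi> = 0"
proof -
  define \<xi> where "\<xi> = \<psi> * transp"
  have kp: "kernel_positive \<phi>" and kc: "kernel_positive \<xi>"
    using CP_kernel_positive[OF \<phi>] coCP_kernel_positive[OF \<psi>] by (simp_all add: \<xi>_def)
  have \<psi>_eq: "\<psi> = \<xi> * transp"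
    by (simp add: \<xi>_def mult.assoc transp_transp)
  have sumA: "\<langle>x, (\<phi> \<cdot> A) \<cdot> y\<rangle> + \<langle>x, (\<psi> \<cdot> A) \<cdot> y\<rangle> = \<langle>x, A \<cdot> y\<rangle>" for x A y
    using arg_cong[OF sum, of "\<lambda>T. \<langle>x, (T \<cdot> A) \<cdot> y\<rangle>"] by (simp add: bop_simps cinner_simps)
  define P where "P x a = Re \<langle>x, (\<phi> \<cdot> rank1 a a) \<cdot> x\<rangle>" for x a
  define R where "R x a = Re \<langle>x, (\<psi> \<cdot> rank1 a a) \<cdot> x\<rangle>" for x a
  have \<psi>_rank1: "\<psi> \<cdot> rank1 a b = \<xi> \<cdot> rank1 (conj_vec E b) (conj_vec E a)" for a b
    by (simp add: \<psi>_eq times_bop.rep_eq transp_apply transposition_rank1)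
  have P: "0 \<le> P x a" for x a
    unfolding P_def by (rule rank1_nonneg[OF kp])
  have R: "0 \<le> R x a" for x a
    unfolding R_def \<psi>_rank1 by (rule rank1_nonneg[OF kc])
  have PR: "P x a + R x a = (cmod \<langle>a, x\<rangle>)\<^sup>2" for x a
    using arg_cong[OF sumA[of x "rank1 a a" x], of Re] cinner_commute[of x a]
    by (simp add: P_def R_def rank1_apply cinner_scaleC_right complex_mult_cnj cmod_power2 flip: power2_eq_square)
  have R_diag: "R x x = 0" for x
  proof -
    obtain b where b: "b \<noteq> 0" "\<langle>x, b\<rangle> = 0" using dim by blast
    have "R x b = 0" using PR[of x b] P[of x b] R[of x b] b(2) cinner_commute[of b x] by simp
    \<comment> \<open>Transposition crosses the diagonal entries: the bound for \<psi> is R x b * R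
      b x, whereas for \<phi> it is P x x * P b b. Orthogonality kills the former, so \<phi> carries
      the whole element and P x x is as large as it can be.\<close>
    then have "(cmod \<langle>x, (\<psi> \<cdot> rank1 x b) \<cdot> b\<rangle>)\<^sup>2 \<le> 0"
      using rank1_Cauchy_Schwarz[OF kc, of x "conj_vec E b" "conj_vec E x" b]
      by (simp add: R_def flip: \<psi>_rank1)
    then have "\<langle>x, (\<phi> \<cdot> rank1 x b) \<cdot> b\<rangle> = \<langle>x, x\<rangle> * \<langle>b, b\<rangle>"
      using sumA[of x "rank1 x b" b] by (simp add: rank1_apply cinner_scaleC_right mult.commute)
    then have "((norm x)\<^sup>2 * (norm b)\<^sup>2)\<^sup>2 \<le> P x x * P b b"
      using rank1_Cauchy_Schwarz[OF kp, of x x b b] by (simp add: P_def cinner_norm norm_mult norm_power)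
    also have "\<dots> \<le> P x x * ((norm b)\<^sup>2)\<^sup>2"
      using PR[of b b] R[of b b] P[of x x] by (intro mult_left_mono) (simp_all add: cinner_norm norm_power)
    finally have "((norm x)\<^sup>2)\<^sup>2 \<le> P x x"
      using b(1) by (simp add: power_mult_distrib)
    then show ?thesis
      using PR[of x x] R[of x x] by (simp add: cinner_norm norm_power)
  qed
  have "Re \<langle>x, (\<psi> \<cdot> 1) \<cdot> x\<rangle> = 0" if x: "norm x = 1" for x
  proof -
    \<comment> \<open>Q projects onto the orthogonal complement of x. The two nonnegative
      contributions at x add up to \<open>\<langle>x, Q \<cdot> x\<rangle>\<close> = 0, so \<psi>
      also vanishes there, and 1 is Q plus the rank-one projection already treated.\<close>
    define Q where "Q = 1 - rank1 x x"
    have "Q = adj Q * Q"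
      using x by (simp add: Q_def adj_diff adj_rank1 algebra_simps rank1_mult_rank1 cinner_norm)
    then have "0 \<le> Re \<langle>x, (\<phi> \<cdot> Q) \<cdot> x\<rangle>" "0 \<le> Re \<langle>x, (\<psi> \<cdot> Q) \<cdot> x\<rangle>"
      using kernel_positive_gram[OF kp, of x Q] coCP_gram[OF \<psi>, of x Q] by (simp_all add: complex_nonneg_Reals_iff)
    moreover have "\<langle>x, Q \<cdot> x\<rangle> = 0"
      using x by (simp add: Q_def bop_simps rank1_apply cinner_simps cinner_norm)
    ultimately have "Re \<langle>x, (\<psi> \<cdot> Q) \<cdot> x\<rangle> = 0"
      using arg_cong[OF sumA[of x Q x], of Re] by simp
    moreover have "\<psi> \<cdot> 1 = \<psi> \<cdot> Q + \<psi> \<cdot> rank1 x x"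
      by (simp add: Q_def bop_diff_right)
    ultimately show ?thesis
      using R_diag[of x] by (simp add: R_def bop_simps cinner_simps)
  qed
  then have unit: "Re \<langle>x, (\<xi> \<cdot> 1) \<cdot> x\<rangle> = 0" if "norm x = 1" for x
    using that by (simp add: \<xi>_def times_bop.rep_eq transp_apply transposition_one)
  have one: "Re \<langle>x, (\<xi> \<cdot> 1) \<cdot> x\<rangle> = 0" for x
  proof (cases "x = 0")
    case False
    define e where "e = (1 / norm x) *\<^sub>R x"
    have "x = norm x *\<^sub>R e" "norm e = 1" using False by (simp_all add: e_def)
    then have "\<langle>x, (\<xi> \<cdot> 1) \<cdot> x\<rangle> = complex_of_real ((norm x)\<^sup>2) * \<langle>e, (\<xi> \<cdot> 1) \<cdot> e\<rangle>"
      by (metis (no_types, lifting) bop_scaleR_right cinner_scaleR_left cinner_scaleR_right mult.assoc of_real_mult power2_eq_square)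
    then show ?thesis using unit[OF \<open>norm e = 1\<close>] by simp
  qed simp
  \<comment> \<open>Cauchy-Schwarz between 1 and A: a positive kernel that vanishes at 1 is
    0.\<close>
  have "\<xi> = 0"
  proof (rule bop_eqI, rule bop_eq_cinnerI)
    fix A x y
    show "\<langle>x, (\<xi> \<cdot> A) \<cdot> y\<rangle> = \<langle>x, (0 \<cdot> A) \<cdot> y\<rangle>"
      using kernel_positive_Cauchy_Schwarz[OF kc, of x 1 A y] one[of x] by (simp add: bop_simps)
  qed
  then show ?thesis by (simp add: \<psi>_eq)
qed

lemma bop_exp_one_imp_generator_one:
  fixes L :: "'h bop bop"
  assumes "\<And>t. t \<ge> 0 \<Longrightarrow> bop_exp (t *\<^sub>R L) \<cdot> A = A"
  shows "L \<cdot> A = 0"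
proof (rule tendsto_unique)
  have "((\<lambda>h. (bop_exp (h *\<^sub>R L) - 1) /\<^sub>R h) \<longlongrightarrow> L) (at_right 0)"
    by (rule tendsto_within_subset[OF bop_exp_derivative_zero]) simp
  then show "((\<lambda>h. ((bop_exp (h *\<^sub>R L) - 1) /\<^sub>R h) \<cdot> A) \<longlongrightarrow> L \<cdot> A) (at_right 0)"
    by (rule bounded_linear.tendsto[OF bounded_linear_bop_eval])
  have "\<forall>\<^sub>F h in at_right 0. ((bop_exp (h *\<^sub>R L) - 1) /\<^sub>R h) \<cdot> A = 0"
    by (rule eventually_at_right_zeroI) (simp add: assms bop_simps)
  then show "((\<lambda>h. ((bop_exp (h *\<^sub>R L) - 1) /\<^sub>R h) \<cdot> A) \<longlongrightarrow> 0) (at_right 0)"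
    by (simp add: tendsto_cong)
qed simp

text \<open>L is the norm limit of difference quotients that are weak-* continuous. Since
  \<open>1 - proj F\<close> has norm at most 1, replacing L by one quotient costs less than
  \<epsilon> / 2 uniformly in F.\<close>

lemma generator_coproj_tendsto:
  fixes L :: "'h bop bop"
  assumes cont: "\<And>t. t \<ge> 0 \<Longrightarrow> continuous_map weak_star weak_star (bop_apply (bop_exp (t *\<^sub>R L)))"
  shows "((\<lambda>F. \<langle>x, (L \<cdot> (1 - proj F)) \<cdot> x\<rangle>) \<longlongrightarrow> 0) (finite_subsets_at_top E)"
proof (rule tendstoI)
  fix \<epsilon> :: real assume \<epsilon>: "\<epsilon> > 0"
  define G where "G h = (bop_exp (h *\<^sub>R L) - 1) /\<^sub>R h" for h
  have "((\<lambda>h. norm (L - G h) * norm x * norm x) \<longlongrightarrow> norm (L - L) * norm x * norm x) (at_right 0)"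
    unfolding G_def by (intro tendsto_intros tendsto_within_subset[OF bop_exp_derivative_zero]) simp
  then have "\<forall>\<^sub>F h in at_right 0. norm (L - G h) * norm x * norm x < \<epsilon> / 2"
    by (rule order_tendstoD) (use \<epsilon> in simp)
  moreover have "\<forall>\<^sub>F h :: real in at_right 0. h > 0"
    by (rule eventually_at_right_zeroI)
  ultimately have "\<forall>\<^sub>F h in at_right 0. norm (L - G h) * norm x * norm x < \<epsilon> / 2 \<and> h > 0"
    by (rule eventually_conj)
  then obtain h where h: "norm (L - G h) * norm x * norm x < \<epsilon> / 2" "h > 0"
    using eventually_happens[of _ "at_right (0::real)"] by auto
  have "limitin weak_star (bop_apply (bop_exp (h *\<^sub>R L)) \<circ> (\<lambda>F. 1 - proj F)) (bop_exp (h *\<^sub>R L) \<cdot> 0) (finite_subsets_at_top E)"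
    using h(2) by (intro continuous_map_limit[OF cont limitin_coproj]) simp
  from limitin_weak_star_cinner[OF this, of x x]
  have "((\<lambda>F. \<langle>x, (bop_exp (h *\<^sub>R L) \<cdot> (1 - proj F)) \<cdot> x\<rangle>) \<longlongrightarrow> 0) (finite_subsets_at_top E)"
    by (simp add: bop_simps o_def)
  moreover have "((\<lambda>F. \<langle>x, (1 - proj F) \<cdot> x\<rangle>) \<longlongrightarrow> 0) (finite_subsets_at_top E)"
    using limitin_weak_star_cinner[OF limitin_coproj, of x x] by (simp add: zero_bop.rep_eq)
  ultimately have "((\<lambda>F. complex_of_real (inverse h) * (\<langle>x, (bop_exp (h *\<^sub>R L) \<cdot> (1 - proj F)) \<cdot> x\<rangle> - \<langle>x, (1 - proj F) \<cdot> x\<rangle>))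
      \<longlongrightarrow> complex_of_real (inverse h) * (0 - 0)) (finite_subsets_at_top E)"
    by (intro tendsto_intros)
  then have "\<forall>\<^sub>F F in finite_subsets_at_top E.
      dist (complex_of_real (inverse h) * (\<langle>x, (bop_exp (h *\<^sub>R L) \<cdot> (1 - proj F)) \<cdot> x\<rangle> - \<langle>x, (1 - proj F) \<cdot> x\<rangle>))
        (complex_of_real (inverse h) * (0 - 0)) < \<epsilon> / 2"
    using \<epsilon> by (intro tendstoD) simp_all
  moreover have "\<forall>\<^sub>F F in finite_subsets_at_top E. finite F \<and> F \<subseteq> E"
    by (rule eventually_finite_subsets_at_top_weakI) simp
  ultimately show "\<forall>\<^sub>F F in finite_subsets_at_top E. dist \<langle>x, (L \<cdot> (1 - proj F)) \<cdot> x\<rangle> 0 < \<epsilon>"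
  proof eventually_elim
    case (elim F)
    define Q where "Q = 1 - proj F"
    have 1: "cmod \<langle>x, (G h \<cdot> Q) \<cdot> x\<rangle> < \<epsilon> / 2"
      using elim(1) by (simp add: G_def Q_def[symmetric] scaleR_bop.rep_eq minus_bop.rep_eq one_bop.rep_eq cinner_simps)
    have "cmod \<langle>x, ((L - G h) \<cdot> Q) \<cdot> x\<rangle> \<le> norm ((L - G h) \<cdot> Q) * norm x * norm x"
      by (rule cinner_bop_bound)
    also have "norm ((L - G h) \<cdot> Q) \<le> norm (L - G h) * norm Q" by (rule bop_norm_bound)
    also have "\<dots> \<le> norm (L - G h) * 1"
      using elim(2) by (intro mult_left_mono) (simp_all add: Q_def norm_coproj_le)
    finally have 2: "cmod \<langle>x, ((L - G h) \<cdot> Q) \<cdot> x\<rangle> < \<epsilon> / 2"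
      using h(1) by (simp add: mult_right_mono)
    have "\<langle>x, (L \<cdot> Q) \<cdot> x\<rangle> = \<langle>x, ((L - G h) \<cdot> Q) \<cdot> x\<rangle> + \<langle>x, (G h \<cdot> Q) \<cdot> x\<rangle>"
      by (simp add: minus_bop.rep_eq cinner_diff_right)
    then have "cmod \<langle>x, (L \<cdot> Q) \<cdot> x\<rangle> < \<epsilon>"
      using norm_triangle_ineq[of "\<langle>x, ((L - G h) \<cdot> Q) \<cdot> x\<rangle>" "\<langle>x, (G h \<cdot> Q) \<cdot> x\<rangle>"] 1 2 by simp
    then show ?case by (simp add: Q_def)
  qed
qed

text \<open>Conditional positivity of the derivative is applied to given \<open>a\<^sub>j\<close>, \<open>x\<^sub>j\<close> completed by
  \<open>- |y\<rangle>\<langle>e|\<close> and \<open>e\<close>, where \<open>y = \<Sum> a\<^sub>j x\<^sub>j\<close>.\<close>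

lemma derivative_of_CP_at_identity:
  fixes \<phi> :: "real \<Rightarrow> 'h bop bop" and e :: 'h
  assumes \<phi>: "\<And>t. t \<ge> 0 \<Longrightarrow> \<phi> t \<in> CP" and D: "((\<lambda>h. (\<phi> h - 1) /\<^sub>R h) \<longlongrightarrow> D) (at_right 0)"
    and e: "norm e = 1"
  obtains K where "kernel_positive (D - sandwich K 1 - sandwich 1 (adj K))"
proof -
  have lim: "((\<lambda>h. \<langle>x, (((\<phi> h - 1) /\<^sub>R h) \<cdot> A) \<cdot> y\<rangle>) \<longlongrightarrow> \<langle>x, (D \<cdot> A) \<cdot> y\<rangle>) (at_right 0)" for x A y
    by (intro bounded_linear.tendsto[OF bounded_linear_cinner_bop] bounded_linear.tendsto[OF bounded_linear_bop_eval] D)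
  have herm: "\<langle>x, (D \<cdot> adj A) \<cdot> y\<rangle> = cnj \<langle>y, (D \<cdot> A) \<cdot> x\<rangle>" for x A y
  proof (rule tendsto_unique[OF _ lim[of x "adj A" y]])
    have "\<forall>\<^sub>F h in at_right 0. cnj \<langle>y, (((\<phi> h - 1) /\<^sub>R h) \<cdot> A) \<cdot> x\<rangle> = \<langle>x, (((\<phi> h - 1) /\<^sub>R h) \<cdot> adj A) \<cdot> y\<rangle>"
    proof (rule eventually_at_right_zeroI)
      fix h :: real assume "h > 0"
      then have "kernel_positive (\<phi> h)" by (intro CP_kernel_positive \<phi>) simp
      then have "\<langle>x, (\<phi> h \<cdot> adj A) \<cdot> y\<rangle> = cnj \<langle>y, (\<phi> h \<cdot> A) \<cdot> x\<rangle>"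
        using kernel_positive_hermitian[of "\<phi> h" x A 1 y] by simp
      moreover have "\<langle>x, adj A \<cdot> y\<rangle> = cnj \<langle>y, A \<cdot> x\<rangle>"
        using cinner_commute[of "A \<cdot> x" y] by (simp add: cinner_adj_right)
      ultimately show "cnj \<langle>y, (((\<phi> h - 1) /\<^sub>R h) \<cdot> A) \<cdot> x\<rangle> = \<langle>x, (((\<phi> h - 1) /\<^sub>R h) \<cdot> adj A) \<cdot> y\<rangle>"
        by (simp add: scaleR_bop.rep_eq minus_bop.rep_eq one_bop.rep_eq cinner_simps)
    qed
    then show "((\<lambda>h. \<langle>x, (((\<phi> h - 1) /\<^sub>R h) \<cdot> adj A) \<cdot> y\<rangle>) \<longlongrightarrow> cnj \<langle>y, (D \<cdot> A) \<cdot> x\<rangle>) (at_right 0)"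
      using tendsto_cnj[OF lim[of y A x]] by (simp add: tendsto_cong)
  qed simp
  \<comment> \<open>On such a family the identity contributes the squared norm of the vanishing sum,
    so the quotient by h has the sign of \<open>\<phi> h\<close> alone.\<close>
  have cond: "(\<Sum>i<n. \<Sum>j<n. \<langle>x i, (D \<cdot> (adj (a i) * a j)) \<cdot> x j\<rangle>) \<in> \<real>\<^sub>\<ge>\<^sub>0"
    if zero: "(\<Sum>j<n. a j \<cdot> x j) = 0" for n :: nat and a :: "nat \<Rightarrow> 'h bop" and x
  proof (rule Lim_in_closed_set[OF closed_nonneg_Reals_complex])
    show "((\<lambda>h. \<Sum>i<n. \<Sum>j<n. \<langle>x i, (((\<phi> h - 1) /\<^sub>R h) \<cdot> (adj (a i) * a j)) \<cdot> x j\<rangle>)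
        \<longlongrightarrow> (\<Sum>i<n. \<Sum>j<n. \<langle>x i, (D \<cdot> (adj (a i) * a j)) \<cdot> x j\<rangle>)) (at_right 0)"
      by (intro tendsto_sum lim)
    show "\<forall>\<^sub>F h in at_right 0. (\<Sum>i<n. \<Sum>j<n. \<langle>x i, (((\<phi> h - 1) /\<^sub>R h) \<cdot> (adj (a i) * a j)) \<cdot> x j\<rangle>) \<in> \<real>\<^sub>\<ge>\<^sub>0"
    proof (rule eventually_at_right_zeroI)
      fix h :: real assume h: "h > 0"
      then have kp: "kernel_positive (\<phi> h)" by (intro CP_kernel_positive \<phi>) simp
      have "(\<Sum>i<n. \<Sum>j<n. \<langle>x i, (((\<phi> h - 1) /\<^sub>R h) \<cdot> (adj (a i) * a j)) \<cdot> x j\<rangle>)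
          = complex_of_real (inverse h) * ((\<Sum>i<n. \<Sum>j<n. \<langle>x i, (\<phi> h \<cdot> (adj (a i) * a j)) \<cdot> x j\<rangle>)
            - (\<Sum>i<n. \<Sum>j<n. \<langle>x i, (adj (a i) * a j) \<cdot> x j\<rangle>))"
        by (simp add: scaleR_bop.rep_eq minus_bop.rep_eq one_bop.rep_eq cinner_scaleR_right cinner_diff_right
            sum_subtractf sum_distrib_left right_diff_distrib)
      also have "(\<Sum>i<n. \<Sum>j<n. \<langle>x i, (adj (a i) * a j) \<cdot> x j\<rangle>) = 0"
        unfolding cinner_gram_sum zero by simp
      finally show "(\<Sum>i<n. \<Sum>j<n. \<langle>x i, (((\<phi> h - 1) /\<^sub>R h) \<cdot> (adj (a i) * a j)) \<cdot> x j\<rangle>) \<in> \<real>\<^sub>\<ge>\<^sub>0"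
        using kp h unfolding kernel_positive_def by (auto intro!: nonneg_Reals_mult_I)
    qed
  qed simp
  \<comment> \<open>M is dictated by the bordered form: the added operator is - |y><e|, so the
    column entries are values D(|z><e|) e, linear in z.\<close>
  define M where "M = Bop (\<lambda>z. (D \<cdot> rank1 z e) \<cdot> e)"
  have M: "M \<cdot> z = (D \<cdot> rank1 z e) \<cdot> e" for z
    unfolding M_def
  proof (rule Bop_apply, rule bounded_clinearI[where K = "norm D"])
    have "rank1 (z + z') e = rank1 z e + rank1 z' e" for z z' :: 'h
      by (rule bop_eqI) (simp add: rank1_apply bop_simps scaleC_add_right)
    then show "(D \<cdot> rank1 (z + z') e) \<cdot> e = (D \<cdot> rank1 z e) \<cdot> e + (D \<cdot> rank1 z' e) \<cdot> e" for z z'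
      by (simp add: bop_simps)
    have "rank1 (c *\<^sub>C z) e = c *\<^sub>C rank1 z e" for c and z :: 'h
      by (rule bop_eqI) (simp add: rank1_apply bop_simps scaleC_scaleC mult.commute)
    then show "(D \<cdot> rank1 (c *\<^sub>C z) e) \<cdot> e = c *\<^sub>C (D \<cdot> rank1 z e) \<cdot> e" for c z
      by (simp add: bop_simps)
    show "norm ((D \<cdot> rank1 z e) \<cdot> e) \<le> norm D * norm z" for z
    proof -
      have "norm ((D \<cdot> rank1 z e) \<cdot> e) \<le> norm (D \<cdot> rank1 z e) * norm e" by (rule bop_norm_bound)
      also have "\<dots> \<le> norm D * norm (rank1 z e)" using bop_norm_bound[of D "rank1 z e"] by (simp add: e)
      also have "\<dots> \<le> norm D * norm z"
        using norm_rank1_le[of z e] by (intro mult_left_mono) (simp_all add: e)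
      finally show ?thesis .
    qed
  qed
  define r where "r = Re \<langle>e, (D \<cdot> rank1 e e) \<cdot> e\<rangle>"
  have r: "\<langle>e, (D \<cdot> rank1 e e) \<cdot> e\<rangle> = complex_of_real r"
    using herm[of e "rank1 e e" e] by (simp add: r_def adj_rank1 complex_eq_iff)
  \<comment> \<open>The corner of the bordered form is r times the Gram sum; half of it is put into
    K and half into \<open>adj K\<close>.\<close>
  define K where "K = M - (r / 2) *\<^sub>R 1"
  define \<Psi> where "\<Psi> = D - sandwich K 1 - sandwich 1 (adj K)"
  have \<Psi>: "\<Psi> \<cdot> A = D \<cdot> A - M * A - A * adj M + r *\<^sub>R A" for A
  proof -
    have "r *\<^sub>R A = (r / 2) *\<^sub>R A + (r / 2) *\<^sub>R A"
      by (simp flip: scaleR_add_left)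
    then show ?thesis
      by (simp add: \<Psi>_def K_def minus_bop.rep_eq sandwich_apply adj_diff adj_scaleR left_diff_distrib right_diff_distrib)
  qed
  have "kernel_positive \<Psi>"
    unfolding kernel_positive_def
  proof (intro allI)
    fix n :: nat and a :: "nat \<Rightarrow> 'h bop" and x :: "nat \<Rightarrow> 'h"
    define y where "y = (\<Sum>j<n. a j \<cdot> x j)"
    define b where "b = - rank1 y e"
    have ee: "\<langle>e, e\<rangle> = 1" using e by (simp add: cinner_norm)
    have adj_b: "adj b = - rank1 e y"
      using adj_scaleR[of "-1" "rank1 y e"] by (simp add: b_def adj_rank1)
    have "(\<Sum>j<Suc n. (a(n := b)) j \<cdot> (x(n := e)) j) = 0"
      by (simp add: y_def[symmetric] b_def uminus_bop.rep_eq rank1_apply ee)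
    from cond[OF this]
    have pos: "(\<Sum>i<n. \<Sum>j<n. \<langle>x i, (D \<cdot> (adj (a i) * a j)) \<cdot> x j\<rangle>) + (\<Sum>i<n. \<langle>x i, (D \<cdot> (adj (a i) * b)) \<cdot> e\<rangle>)
        + (\<Sum>j<n. \<langle>e, (D \<cdot> (adj b * a j)) \<cdot> x j\<rangle>) + \<langle>e, (D \<cdot> (adj b * b)) \<cdot> e\<rangle> \<in> \<real>\<^sub>\<ge>\<^sub>0"
      unfolding sum_Suc_Suc by simp
    have col: "\<langle>x i, (D \<cdot> (adj (a i) * b)) \<cdot> e\<rangle> = - (\<Sum>j<n. \<langle>x i, (M * (adj (a i) * a j)) \<cdot> x j\<rangle>)" for i
    proof -
      have "adj (a i) * b = - rank1 (adj (a i) \<cdot> y) e"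
        by (simp add: b_def mult_rank1)
      then have "\<langle>x i, (D \<cdot> (adj (a i) * b)) \<cdot> e\<rangle> = - \<langle>x i, M \<cdot> adj (a i) \<cdot> y\<rangle>"
        by (simp add: M bop_minus_right uminus_bop.rep_eq cinner_minus_right)
      then show ?thesis
        by (simp add: y_def bop_sum_right cinner_sum_right times_bop.rep_eq)
    qed
    have row: "\<langle>e, (D \<cdot> (adj b * a j)) \<cdot> x j\<rangle> = - (\<Sum>i<n. \<langle>x i, (adj (a i) * a j * adj M) \<cdot> x j\<rangle>)" for j
    proof -
      have cnj: "cnj \<langle>x j, (M * (adj (a j) * a i)) \<cdot> x i\<rangle> = \<langle>x i, (adj (a i) * a j * adj M) \<cdot> x j\<rangle>" for i
        using cinner_commute[of "(M * (adj (a j) * a i)) \<cdot> x i" "x j"]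
          cinner_adj_right[of "x i" "M * (adj (a j) * a i)" "x j"] by simp
      have "\<langle>e, (D \<cdot> (adj b * a j)) \<cdot> x j\<rangle> = cnj \<langle>x j, (D \<cdot> (adj (a j) * b)) \<cdot> e\<rangle>"
        using herm[of e "adj (a j) * b" "x j"] by simp
      also have "\<dots> = - (\<Sum>i<n. cnj \<langle>x j, (M * (adj (a j) * a i)) \<cdot> x i\<rangle>)"
        by (simp add: col)
      finally show ?thesis unfolding cnj .
    qed
    have "adj b * b = \<langle>y, y\<rangle> *\<^sub>C rank1 e e"
      unfolding adj_b by (simp add: b_def rank1_mult_rank1)
    then have diag: "\<langle>e, (D \<cdot> (adj b * b)) \<cdot> e\<rangle> = complex_of_real r * (\<Sum>i<n. \<Sum>j<n. \<langle>x i, (adj (a i) * a j) \<cdot> x j\<rangle>)"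
      unfolding cinner_gram_sum by (simp add: bop_simps cinner_simps r cinner_norm y_def mult.commute)
    have "(\<Sum>i<n. \<Sum>j<n. \<langle>x i, (\<Psi> \<cdot> (adj (a i) * a j)) \<cdot> x j\<rangle>) =
        (\<Sum>i<n. \<Sum>j<n. \<langle>x i, (D \<cdot> (adj (a i) * a j)) \<cdot> x j\<rangle>) + (\<Sum>i<n. \<langle>x i, (D \<cdot> (adj (a i) * b)) \<cdot> e\<rangle>)
        + (\<Sum>j<n. \<langle>e, (D \<cdot> (adj b * a j)) \<cdot> x j\<rangle>) + \<langle>e, (D \<cdot> (adj b * b)) \<cdot> e\<rangle>"
      unfolding col row diag sum_negf sum.swap[of "\<lambda>j i. \<langle>x i, (adj (a i) * a j * adj M) \<cdot> x j\<rangle>"]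
      by (simp add: \<Psi> plus_bop.rep_eq minus_bop.rep_eq scaleR_bop.rep_eq cinner_add_right cinner_diff_right
          cinner_scaleR_right sum.distrib sum_subtractf sum_distrib_left)
    with pos show "(\<Sum>i<n. \<Sum>j<n. \<langle>x i, (\<Psi> \<cdot> (adj (a i) * a j)) \<cdot> x j\<rangle>) \<in> \<real>\<^sub>\<ge>\<^sub>0" by simp
  qed
  then show ?thesis using that by (simp add: \<Psi>_def)
qed

text \<open>Unitality fixes the hermitian part of K as minus half of the total rate; the
  antihermitian part, divided by \<i>, is the Hamiltonian.\<close>

lemma generator_form_of_lindblad:
  assumes V: "is_kraus V \<Phi>" and W: "is_kraus W \<Psi>" and one: "lindblad K \<Phi> \<Psi> \<cdot> 1 = 0"
  shows "\<exists>H V W. adj H = H \<and> weak_star_summable (\<lambda>n. adj (V n) * V n) \<and>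
    weak_star_summable (\<lambda>n. adj (W n) * W n) \<and> has_generator_form E (bop_apply (lindblad K \<Phi> \<Psi>)) H V W"
proof (intro exI conjI)
  define H where "H = (- \<i> / 2) *\<^sub>C (K - adj K)"
  show H: "adj H = H"
    by (simp add: H_def adj_scaleC adj_diff complex_vector.scale_right_diff_distrib)
  have "(\<Phi> \<cdot> 1 + \<Psi> \<cdot> 1) + (K + adj K) = 0"
    using one by (simp add: lindblad_apply transp_apply transposition_one add_ac)
  then have "\<Phi> \<cdot> 1 + \<Psi> \<cdot> 1 = - (K + adj K)"
    by (rule eq_neg_iff_add_eq_0[THEN iffD2])
  moreover have "\<i> *\<^sub>C H = (1/2) *\<^sub>R (K - adj K)"
    by (simp add: H_def scaleC_scaleC scaleR_scaleC)
  moreover have "(1/2) *\<^sub>R (K - adj K) - (1/2) *\<^sub>R (- (K + adj K)) = K"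
    by (simp add: scaleR_right_diff_distrib scaleR_add_right flip: scaleR_add_left)
  ultimately have "\<i> *\<^sub>C H - (1/2) *\<^sub>R (\<Phi> \<cdot> 1 + \<Psi> \<cdot> 1) = K" by simp
  then show "has_generator_form E (bop_apply (lindblad K \<Phi> \<Psi>)) H V W"
    using has_generator_form_iff[OF V W H] by simp
  show "weak_star_summable (\<lambda>n. adj (V n) * V n)" "weak_star_summable (\<lambda>n. adj (W n) * W n)"
    unfolding weak_star_summable_def using is_kraus_weak_star_sums_one V W by blast+
qed

lemma smoothly_decomposable_generator_form:
  fixes L :: "'h bop bop"
  assumes sep: "separable_space (euclidean :: 'h topology)"
    and semi: "decomposable_dynamical_semigroup (\<lambda>t. bop_exp (t *\<^sub>R L))"
    and smooth: "smoothly_decomposable (\<lambda>t. bop_exp (t *\<^sub>R L))"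
  shows "\<exists>H V W. adj H = H \<and> weak_star_summable (\<lambda>n. adj (V n) * V n) \<and>
    weak_star_summable (\<lambda>n. adj (W n) * W n) \<and> has_generator_form E (bop_apply L) H V W"
proof -
  have one: "L \<cdot> 1 = 0"
    by (rule bop_exp_one_imp_generator_one) (use semi in \<open>simp add: decomposable_dynamical_semigroup_def\<close>)
  have cont: "\<And>t. t \<ge> 0 \<Longrightarrow> continuous_map weak_star weak_star (bop_apply (bop_exp (t *\<^sub>R L)))"
    using semi by (simp add: decomposable_dynamical_semigroup_def)
  \<comment> \<open>A vector with trivial orthogonal complement exists exactly in dimension at most
    one, where the identity is itself copositive and the splitting at 0 gives no
    information.\<close>
  show ?thesis
  proof (cases "\<exists>x :: 'h. \<forall>b. \<langle>x, b\<rangle> = 0 \<longrightarrow> b = 0")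
    case True
    then obtain x :: 'h where x: "\<And>b. \<langle>x, b\<rangle> = 0 \<Longrightarrow> b = 0" by blast
    have "L \<cdot> A = 0" for A
      using scalar_if_no_orthogonal[where x = x and A = A, OF x] one by (auto simp: bop_apply_scaleC)
    then have "L = lindblad 0 0 0"
      by (intro bop_eqI) (simp add: lindblad_apply zero_bop.rep_eq)
    moreover have "is_kraus (\<lambda>_. 0) (0 :: 'h bop bop)"
      by (simp add: is_kraus_def zero_bop.rep_eq)
    ultimately show ?thesis
      using generator_form_of_lindblad[of "\<lambda>_. 0" 0 "\<lambda>_. 0" 0 0] one by simp
  next
    case False
    then have dim: "\<exists>b. b \<noteq> 0 \<and> \<langle>x, b\<rangle> = 0" for x :: 'h by blast
    obtain \<phi> \<psi> where smooth: "smooth_on_halfline \<phi>" "smooth_on_halfline \<psi>"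
      and \<phi>: "\<And>t. t \<ge> 0 \<Longrightarrow> \<phi> t \<in> CP" and \<psi>: "\<And>t. t \<ge> 0 \<Longrightarrow> \<psi> t \<in> coCP"
      and sum: "\<And>t. t \<ge> 0 \<Longrightarrow> bop_exp (t *\<^sub>R L) = \<phi> t + \<psi> t"
      using smooth unfolding smoothly_decomposable_def by blast
    have \<psi>0: "\<psi> 0 = 0"
      using copositive_part_of_identity_zero[OF \<phi> \<psi> _ dim, of 0 0] sum[of 0] by simp
    then have \<phi>0: "\<phi> 0 = 1" using sum[of 0] by simp
    obtain D where D: "((\<lambda>h. (\<phi> h - 1) /\<^sub>R h) \<longlongrightarrow> D) (at_right 0)"
      using smooth_on_halfline_right_derivative[OF smooth(1)] unfolding \<phi>0 by blast
    obtain X where X: "((\<lambda>h. \<psi> h /\<^sub>R h) \<longlongrightarrow> X) (at_right 0)"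
      using smooth_on_halfline_right_derivative[OF smooth(2)] unfolding \<psi>0 by auto
    have coCP: "X \<in> coCP"
    proof (rule coCP_lim[OF _ X])
      show "\<forall>\<^sub>F h in at_right 0. \<psi> h /\<^sub>R h \<in> coCP"
        by (rule eventually_at_right_zeroI) (simp add: \<psi> coCP_scale)
    qed simp
    have L: "L = D + X"
    proof (rule tendsto_unique)
      show "((\<lambda>h. (bop_exp (h *\<^sub>R L) - 1) /\<^sub>R h) \<longlongrightarrow> L) (at_right 0)"
        by (rule tendsto_within_subset[OF bop_exp_derivative_zero]) simp
      have "\<forall>\<^sub>F h in at_right 0. (\<phi> h - 1) /\<^sub>R h + \<psi> h /\<^sub>R h = (bop_exp (h *\<^sub>R L) - 1) /\<^sub>R h"
        by (rule eventually_at_right_zeroI) (simp add: sum algebra_simps)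
      then show "((\<lambda>h. (bop_exp (h *\<^sub>R L) - 1) /\<^sub>R h) \<longlongrightarrow> D + X) (at_right 0)"
        using tendsto_add[OF D X] by (simp add: tendsto_cong)
    qed simp
    obtain b :: 'h where "b \<noteq> 0" using dim by blast
    then have "norm ((1 / norm b) *\<^sub>R b) = 1" by simp
    then obtain K where K: "kernel_positive (D - sandwich K 1 - sandwich 1 (adj K))"
      using derivative_of_CP_at_identity[OF \<phi> D] by blast
    define \<Phi> where "\<Phi> = D - sandwich K 1 - sandwich 1 (adj K)"
    define \<Psi> where "\<Psi> = X * transp"
    have \<Phi>: "kernel_positive \<Phi>" using K by (simp add: \<Phi>_def)
    have \<Psi>: "kernel_positive \<Psi>" unfolding \<Psi>_def by (rule coCP_kernel_positive[OF coCP])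
    have \<Psi>X: "\<Psi> * transp = X" by (simp add: \<Psi>_def mult.assoc transp_transp)
    have L_eq: "L = lindblad K \<Phi> \<Psi>"
      unfolding lindblad_def \<Psi>X by (simp add: \<Phi>_def L)
    \<comment> \<open>Both maps are nonnegative at the projection \<open>1 - proj F\<close>, so it
      suffices that their sum is small. That sum is L minus the two terms with K, and all three tend
      to 0.\<close>
    have normal: "\<exists>F. finite F \<and> F \<subseteq> E \<and> Re \<langle>x, (\<Phi> \<cdot> (1 - proj F)) \<cdot> x\<rangle> < \<epsilon> \<and> Re \<langle>x, (\<Psi> \<cdot> (1 - proj F)) \<cdot> x\<rangle> < \<epsilon>"
      if \<epsilon>: "\<epsilon> > 0" for x and \<epsilon> :: real
    proof -
      have "((\<lambda>F. \<langle>x, (L \<cdot> (1 - proj F)) \<cdot> x\<rangle> - \<langle>x, K \<cdot> (1 - proj F) \<cdot> x\<rangle> - \<langle>x, (1 - proj F) \<cdot> adj K \<cdot> x\<rangle>)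
          \<longlongrightarrow> 0 - \<langle>x, K \<cdot> 0\<rangle> - \<langle>x, 0\<rangle>) (finite_subsets_at_top E)"
        by (intro tendsto_diff generator_coproj_tendsto[OF cont]
            bounded_linear.tendsto[OF bounded_linear_cinner_right] bounded_linear.tendsto[OF bounded_linear_bop_apply] coproj_tendsto)
      from tendsto_Re[OF this] have "\<forall>\<^sub>F F in finite_subsets_at_top E.
          Re (\<langle>x, (L \<cdot> (1 - proj F)) \<cdot> x\<rangle> - \<langle>x, K \<cdot> (1 - proj F) \<cdot> x\<rangle> - \<langle>x, (1 - proj F) \<cdot> adj K \<cdot> x\<rangle>) < \<epsilon>"
        by (rule order_tendstoD) (use \<epsilon> in \<open>simp add: bop_zero_right\<close>)
      moreover have "\<forall>\<^sub>F F in finite_subsets_at_top E. finite F \<and> F \<subseteq> E"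
        by (rule eventually_finite_subsets_at_top_weakI) simp
      ultimately have "\<forall>\<^sub>F F in finite_subsets_at_top E. (finite F \<and> F \<subseteq> E) \<and>
          Re (\<langle>x, (L \<cdot> (1 - proj F)) \<cdot> x\<rangle> - \<langle>x, K \<cdot> (1 - proj F) \<cdot> x\<rangle> - \<langle>x, (1 - proj F) \<cdot> adj K \<cdot> x\<rangle>) < \<epsilon>"
        by eventually_elim simp
      then obtain F where F: "finite F" "F \<subseteq> E"
        and less: "Re (\<langle>x, (L \<cdot> (1 - proj F)) \<cdot> x\<rangle> - \<langle>x, K \<cdot> (1 - proj F) \<cdot> x\<rangle> - \<langle>x, (1 - proj F) \<cdot> adj K \<cdot> x\<rangle>) < \<epsilon>"
        using eventually_happens[of _ "finite_subsets_at_top E"] by auto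
      have "\<langle>x, (L \<cdot> (1 - proj F)) \<cdot> x\<rangle> = \<langle>x, K \<cdot> (1 - proj F) \<cdot> x\<rangle> + \<langle>x, (1 - proj F) \<cdot> adj K \<cdot> x\<rangle>
          + \<langle>x, (\<Phi> \<cdot> (1 - proj F)) \<cdot> x\<rangle> + \<langle>x, (\<Psi> \<cdot> (1 - proj F)) \<cdot> x\<rangle>"
        unfolding L_eq lindblad_apply transp_apply transposition_coproj[OF F(2)]
        by (simp add: plus_bop.rep_eq times_bop.rep_eq cinner_add_right)
      with less have "Re \<langle>x, (\<Phi> \<cdot> (1 - proj F)) \<cdot> x\<rangle> + Re \<langle>x, (\<Psi> \<cdot> (1 - proj F)) \<cdot> x\<rangle> < \<epsilon>" by simp
      moreover have "0 \<le> Re \<langle>x, (\<Phi> \<cdot> (1 - proj F)) \<cdot> x\<rangle>" "0 \<le> Re \<langle>x, (\<Psi> \<cdot> (1 - proj F)) \<cdot> x\<rangle>"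
        using kernel_positive_gram[OF \<Phi>, of x "1 - proj F"] kernel_positive_gram[OF \<Psi>, of x "1 - proj F"]
        by (simp_all only: adj_coproj coproj_idem[OF F] complex_nonneg_Reals_iff)
      ultimately show ?thesis using F by (intro exI[of _ F]) simp
    qed
    have normal_\<Phi>: "\<exists>F. finite F \<and> F \<subseteq> E \<and> Re \<langle>x, (\<Phi> \<cdot> (1 - proj F)) \<cdot> x\<rangle> < \<epsilon>"
      and normal_\<Psi>: "\<exists>F. finite F \<and> F \<subseteq> E \<and> Re \<langle>x, (\<Psi> \<cdot> (1 - proj F)) \<cdot> x\<rangle> < \<epsilon>" if "\<epsilon> > 0" for x and \<epsilon> :: real
      using normal[OF that, of x] by blast+
    obtain V where V: "is_kraus V \<Phi>" by (rule kraus_decomposition[OF sep \<Phi> normal_\<Phi>])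
    obtain W where W: "is_kraus W \<Psi>" by (rule kraus_decomposition[OF sep \<Psi> normal_\<Psi>])
    show ?thesis
      unfolding L_eq by (rule generator_form_of_lindblad[OF V W one[unfolded L_eq]])
  qed
qed

end

theorem theorem5:
  fixes E :: "'h::chilbert_space set"
  assumes "onb E"
  shows "(separable_space (euclidean :: 'h topology) \<longrightarrow>
      (\<forall>L :: 'h bop bop.
        decomposable_dynamical_semigroup (\<lambda>t. bop_exp (t *\<^sub>R L)) \<and>
        smoothly_decomposable (\<lambda>t. bop_exp (t *\<^sub>R L)) \<longrightarrow>
        (\<exists>H V W. adj H = H \<and>
          weak_star_summable (\<lambda>n. adj (V n) * V n) \<and>
          weak_star_summable (\<lambda>n. adj (W n) * W n) \<and>
          has_generator_form E (bop_apply L) H V W)))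
    \<and> (\<forall>(L :: 'h bop \<Rightarrow> 'h bop) H V W.
        adj H = H \<and>
        weak_star_summable (\<lambda>n. adj (V n) * V n) \<and>
        weak_star_summable (\<lambda>n. adj (W n) * W n) \<and>
        has_generator_form E L H V W \<longrightarrow>
        bounded_clinear L \<and>
        decomposable_dynamical_semigroup (\<lambda>t. bop_exp (t *\<^sub>R Bop L)))"
proof -
  interpret orthonormal_basis E by standard (rule assms)
  show ?thesis
    using smoothly_decomposable_generator_form generator_form_semigroup by blast
qed

end
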